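(* Let $n\ge 1$, $m\le\frac{n-4}{2}$, let $B\subset\mathbb{R}^n$ be the ball of radius $R$ centered at zero, and let $W(x)=W(|x|)$ be a Bessel potential on $(0,R)$. Assume $\frac{W_r(r)}{W(r)}=-\frac{\lambda}{r}+f(r)$, where $f(r)\ge0$ and $\lim_{r\to0}rf(r)=0$, and $\lambda\le n-2m-2$. Then for all $u\in C_0^\infty(B)$ $$\int_B\frac{|\Delta u|^2}{|x|^{2m}}dx\ge\beta_{n,m}\int_B\frac{u^2}{|x|^{2m+4}}dx+\beta(W;R)\Big(\frac{(n+2m)^2}{4}+\frac{(n-2m-\lambda-2)^2}{4}\Big)\int_B\frac{W(x)}{|x|^{2m+2}}u^2dx .$$
   Context: A non-negative $C^1$ function $W$ on $(0,R)$ is a Bessel potential on $(0,R)$ if there is $c>0$ such that $y''+\frac1r y'+cW(r)y=0$ has a positive solution on $(0,R)$; its weight $\beta(W;R)$ is the supremum of all such $c$. $W_r$ is the derivative in $r$. The constant $\beta_{n,m}$ is $$\beta_{n,m}=\inf_{u\in C_0^\infty(B)\setminus\{0\}}\frac{\int_B\frac{|\Delta u|^2}{|x|^{2m}}dx}{\int_B\frac{u^2}{|x|^{2m+4}}dx}.$$ *)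

theory Defs
  imports "HOL-Analysis.Analysis"
begin

text \<open>For an open set \<open>S\<close>, this is membership in \<open>C\<^sup>k(S)\<close>, phrased through iterated
  partial derivatives.\<close>

primrec Ck_on :: "nat \<Rightarrow> 'a::euclidean_space set \<Rightarrow> ('a \<Rightarrow> real) \<Rightarrow> bool" where
  "Ck_on 0 S u \<longleftrightarrow> continuous_on S u"
| "Ck_on (Suc k) S u \<longleftrightarrow> (\<forall>x\<in>S. u differentiable (at x)) \<and>
     (\<forall>b\<in>Basis. Ck_on k S (\<lambda>x. frechet_derivative u (at x) b))"

text \<open>\<open>C\<^sub>0\<^sup>\<infinity>(S)\<close> for an open set \<open>S\<close>; its elements are regarded as functions on the whole
  space, extended by zero.\<close>

definition test_functions :: "'a::euclidean_space set \<Rightarrow> ('a \<Rightarrow> real) set" where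
  "test_functions S = {u. (\<forall>k. Ck_on k UNIV u) \<and>
     compact (closure {x. u x \<noteq> 0}) \<and> closure {x. u x \<noteq> 0} \<subseteq> S}"

definition laplacian :: "('a::euclidean_space \<Rightarrow> real) \<Rightarrow> 'a \<Rightarrow> real" where
  "laplacian u x =
     (\<Sum>b\<in>Basis. frechet_derivative (\<lambda>y. frechet_derivative u (at y) b) (at x) b)"

definition bessel_constant :: "real \<Rightarrow> (real \<Rightarrow> real) \<Rightarrow> real \<Rightarrow> bool" where
  "bessel_constant R W c \<longleftrightarrow> 0 < c \<and>
     (\<exists>y y' y''. \<forall>r\<in>{0<..<R}. 0 < y r \<and>
        (y has_real_derivative y' r) (at r) \<and>
        (y' has_real_derivative y'' r) (at r) \<and>
        y'' r + 1 / r * y' r + c * W r * y r = 0)"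

definition bessel_potential :: "real \<Rightarrow> (real \<Rightarrow> real) \<Rightarrow> bool" where
  "bessel_potential R W \<longleftrightarrow> (\<forall>r\<in>{0<..<R}. 0 \<le> W r) \<and>
     W C1_differentiable_on {0<..<R} \<and> (\<exists>c. bessel_constant R W c)"

text \<open>The weight \<open>\<beta>(W;R)\<close>. The supremum is taken in \<open>[0,\<infinity>]\<close>, since it is infinite for
  \<open>W = 0\<close>.\<close>

definition bessel_weight :: "real \<Rightarrow> (real \<Rightarrow> real) \<Rightarrow> ennreal" where
  "bessel_weight R W = (SUP c\<in>{c. bessel_constant R W c}. ennreal c)"

text \<open>The constant \<open>\<beta>\<^sub>n\<^sub>,\<^sub>m\<close>, with \<open>n\<close> the dimension of \<^typ>\<open>'a\<close>. The integrals take values in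
  \<open>[0,\<infinity>]\<close>: when \<open>2 * m + 4 = n\<close> the denominator is infinite if \<open>u 0 \<noteq> 0\<close>, and the quotient
  is then \<open>0\<close>. The value of the integrands at the origin is immaterial.\<close>

definition rellich_constant :: "'a::euclidean_space itself \<Rightarrow> real \<Rightarrow> real \<Rightarrow> ennreal" where
  "rellich_constant _ R m =
     (INF u \<in> test_functions (ball (0::'a) R) - {\<lambda>_. 0}.
        (\<integral>\<^sup>+x\<in>ball 0 R. ennreal (\<bar>laplacian u x\<bar>\<^sup>2 / norm x powr (2 * m)) \<partial>lborel) /
        (\<integral>\<^sup>+x\<in>ball 0 R. ennreal ((u x)\<^sup>2 / norm x powr (2 * m + 4)) \<partial>lborel))"

end

theory Submission
  imports Defs
begin

text \<open>Write \<open>n\<close> for the dimension, \<open>a = (n - 4 - 2 m) / 2 \<ge> 0\<close>, \<open>p = (n + 2 m) / 2\<close>, \<open>D = x \<bullet> \<nabla>\<close>, \<open>E = D + a\<close>,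
  and let \<open>\<Lambda> = 1/2 \<Sum> L\<^sub>i\<^sub>j\<^sup>2\<close> with \<open>L\<^sub>i\<^sub>j = x\<^sub>i \<partial>\<^sub>j - x\<^sub>j \<partial>\<^sub>i\<close> be the spherical Laplacian. For the weight
  \<open>|x|\<^bsup>2a-n\<^esup> dx\<close> the commuting operators \<open>E\<close> and \<open>L\<^sub>i\<^sub>j\<close> are skew, and
  \<open>|x|\<^sup>2 \<Delta> = E\<^sup>2 + (p - a) E - (a p - \<Lambda>)\<close>. Expanding the square gives
  \<open>\<parallel>|x|\<^sup>2 \<Delta> u\<parallel>\<^sup>2 = \<parallel>E D u\<parallel>\<^sup>2 + p\<^sup>2 \<parallel>E u\<parallel>\<^sup>2 + \<Sum> \<parallel>L\<^sub>i\<^sub>j E u\<parallel>\<^sup>2 + \<parallel>(a p - \<Lambda>) u\<parallel>\<^sup>2\<close>,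
  without any expansion in spherical harmonics.

  With \<open>V = |x|\<^sup>2 W\<close>, the positive Bessel solution gives the Hardy inequality
  \<open>\<parallel>E \<phi>\<parallel>\<^sup>2 \<ge> c \<integral> V \<phi>\<^sup>2\<close>, used for \<open>\<phi> = u\<close> and \<open>\<phi> = D u\<close>; the growth condition on \<open>W\<close> gives
  \<open>\<integral> V (D u)\<^sup>2 \<ge> \<kappa>\<^sup>2 \<integral> V u\<^sup>2\<close> with \<open>\<kappa> = (n - 2 m - \<lambda> - 2) / 2\<close>. Together they yield the Bessel term.
  Finally \<open>\<parallel>(a p - \<Lambda>) u\<parallel>\<^sup>2 \<ge> \<beta> \<parallel>u\<parallel>\<^sup>2\<close> because \<open>\<beta>\<close> may be tested with
  functions \<open>X(ln |x|) |x|\<^bsup>-a\<^esup> u(e\<^sup>s x/|x|)\<close> where \<open>X\<close> varies slowly; averaging over \<open>s\<close> replaces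
  polar coordinates.\<close>

section \<open>Calculus of smooth functions\<close>

text \<open>The constant \<beta> is an infimum whose value is never computed, and testing it with u
  itself would already use up the whole square of |x|^2 \<Delta> u. The claim about \<beta> is
  therefore sharpened to the part of the square without radial derivatives, which leaves the radial
  terms free for the Bessel term. Their coefficients fit because (p - a)^2 + 2 a p = p^2 + a^2: the
  share a^2 of the norm of E u turns E^2 u into E D u, and two Hardy inequalities in succession
  apply to the latter. The obstacle is the origin. In the critical case a = 0 the weight |x|^-n is
  not integrable there and the norm of u may be infinite. Each use of skewness needs one factor that
  decays at 0: a derivative along a linear field does, and an undifferentiated u enters with the
  factor a in front. Nor is any behaviour of W or of the Bessel solution at 0 prescribed, so the
  Hardy inequalities rest on a cutoff whose error term has a favourable sign.\<close>

definition smooth_on :: "'a::euclidean_space set \<Rightarrow> ('a \<Rightarrow> real) \<Rightarrow> bool" where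
  "smooth_on S u \<longleftrightarrow> (\<forall>k. Ck_on k S u)"

lemma frechet_derivative_at':
  "(f has_derivative f') (at x) \<Longrightarrow> frechet_derivative f (at x) = f'"
  using frechet_derivative_at by metis

abbreviation pd :: "('a::euclidean_space \<Rightarrow> real) \<Rightarrow> 'a \<Rightarrow> 'a \<Rightarrow> real" where
  "pd u b \<equiv> \<lambda>x. frechet_derivative u (at x) b"

text \<open>The derivative at a point of the open set S depends only on values near that point, so
  the partials of f and g agree on all of S and the induction passes to them.\<close>

lemma Ck_on_cong:
  assumes "open S" "\<And>x. x \<in> S \<Longrightarrow> f x = g x"
  shows "Ck_on k S f \<Longrightarrow> Ck_on k S g"
  using assms
proof (induction k arbitrary: f g)
  case 0
  then show ?case by (simp cong: continuous_on_cong)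
next
  case (Suc k)
  have d: "f differentiable (at x)" if "x \<in> S" for x
    using Suc.prems(1) that by simp
  have fd: "frechet_derivative f (at x) = frechet_derivative g (at x)" if "x \<in> S" for x
    by (rule frechet_derivative_transform_within_open[OF d[OF that] \<open>open S\<close> that Suc.prems(3)])
  have "g differentiable (at x)" if "x \<in> S" for x
    using has_derivative_transform_within_open[OF d[OF that, unfolded frechet_derivative_works]
        \<open>open S\<close> that Suc.prems(3)] differentiable_def by blast
  moreover have "Ck_on k S (pd g b)" if "b \<in> Basis" for b
    by (rule Suc.IH[of "pd f b"])
       (use Suc.prems that fd in auto)
  ultimately show ?case by simp
qed

lemma Ck_on_SucD: "Ck_on (Suc k) S u \<Longrightarrow> Ck_on k S u"
proof (induction k arbitrary: u)
  case 0
  then show ?case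
    by (auto intro!: continuous_at_imp_continuous_on differentiable_imp_continuous_within)
qed simp

lemma Ck_on_Un:
  assumes "open S" "open T" shows "Ck_on k S u \<Longrightarrow> Ck_on k T u \<Longrightarrow> Ck_on k (S \<union> T) u"
  by (induction k arbitrary: u) (simp_all add: continuous_on_open_Un assms ball_Un)

lemma frechet_derivative_add_real:
  fixes f g :: "'a::euclidean_space \<Rightarrow> real"
  assumes "f differentiable (at x)" "g differentiable (at x)"
  shows "pd (\<lambda>x. f x + g x) b x =
    pd f b x + pd g b x"
  using frechet_derivative_at'[OF has_derivative_add[OF assms[unfolded frechet_derivative_works]]] by simp

lemma Ck_on_add:
  assumes S: "open S" shows "Ck_on k S f \<Longrightarrow> Ck_on k S g \<Longrightarrow> Ck_on k S (\<lambda>x. f x + g x)"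
proof (induction k arbitrary: f g)
  case (Suc k)
  have "Ck_on k S (\<lambda>x. pd (\<lambda>x. f x + g x) b x)" if "b \<in> Basis" for b
    by (rule Ck_on_cong[OF S _ Suc.IH[of "pd f b" "pd g b"]])
       (use Suc.prems that in \<open>simp_all add: frechet_derivative_add_real\<close>)
  with Suc.prems show ?case by simp
qed (auto intro: continuous_intros)

lemma frechet_derivative_mult_real:
  assumes "f differentiable (at x)" "g differentiable (at x)"
  shows "pd (\<lambda>x. f x * g x) b x =
    f x * pd g b x + pd f b x * g x"
proof -
  have "((\<lambda>x. f x * g x) has_derivative
    (\<lambda>b. f x * pd g b x + pd f b x * g x)) (at x)"
    using assms[unfolded frechet_derivative_works] by (rule has_derivative_mult)
  from frechet_derivative_at'[OF this] show ?thesis by simp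
qed

lemma Ck_on_mult:
  assumes S: "open S" shows "Ck_on k S f \<Longrightarrow> Ck_on k S g \<Longrightarrow> Ck_on k S (\<lambda>x. f x * g x)"
proof (induction k arbitrary: f g)
  case (Suc k)
  have "Ck_on k S (\<lambda>x. pd (\<lambda>x. f x * g x) b x)" if "b \<in> Basis" for b
    by (rule Ck_on_cong[OF S _ Ck_on_add[OF S Suc.IH[of f "pd g b"]
            Suc.IH[of "pd f b" g]]])
       (use Suc.prems that Ck_on_SucD[OF Suc.prems(1)] Ck_on_SucD[OF Suc.prems(2)] in
         \<open>simp_all add: frechet_derivative_mult_real\<close>)
  with Suc.prems show ?case by simp
qed (auto intro: continuous_intros)

lemma Ck_on_const: "Ck_on k S (\<lambda>x. c)"
  by (induction k arbitrary: c) (auto simp: frechet_derivative_const)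

lemma Ck_on_inner: "Ck_on k S (\<lambda>x. x \<bullet> v)"
proof (cases k)
  case (Suc j)
  have "((\<lambda>x. x \<bullet> v) has_derivative (\<lambda>x. x \<bullet> v)) (at x)" for x :: 'a
    by (rule bounded_linear.has_derivative[OF bounded_linear_inner_left]) simp
  then have "(\<lambda>x. x \<bullet> v) differentiable (at x)"
     "frechet_derivative (\<lambda>x. x \<bullet> v) (at x) = (\<lambda>x. x \<bullet> v)" for x :: 'a
    using differentiableI frechet_derivative_at' by blast+
  then show ?thesis using Suc by (simp add: Ck_on_const)
qed (auto intro: continuous_intros)

lemma Ck_on_sum:
  assumes S: "open S" shows "(\<And>i. i \<in> I \<Longrightarrow> Ck_on k S (f i)) \<Longrightarrow> Ck_on k S (\<lambda>x. \<Sum>i\<in>I. f i x)"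
  by (induction I rule: infinite_finite_induct) (auto simp: Ck_on_const intro: Ck_on_add[OF S])

lemma frechet_derivative_compose_components:
  fixes g :: "'a::euclidean_space \<Rightarrow> 'b::euclidean_space" and u :: "'b \<Rightarrow> real"
  assumes g: "\<And>c. c \<in> Basis \<Longrightarrow> (\<lambda>x. g x \<bullet> c) differentiable (at x)" and u: "u differentiable (at (g x))"
  shows "((\<lambda>x. u (g x)) has_derivative (\<lambda>b. \<Sum>c\<in>Basis. pd u c (g x) *
      pd (\<lambda>x. g x \<bullet> c) b x)) (at x)"
proof -
  define G where "G b = (\<Sum>c\<in>Basis. pd (\<lambda>x. g x \<bullet> c) b x *\<^sub>R c)" for b
  have G: "(g has_derivative G) (at x)"
    using has_derivative_componentwise_within[of g G x UNIV] g[unfolded frechet_derivative_works]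
    by (simp add: G_def inner_sum_left_Basis)
  have U: "(u has_derivative frechet_derivative u (at (g x))) (at (g x))"
    using u frechet_derivative_works by blast
  have "((\<lambda>x. u (g x)) has_derivative (\<lambda>b. pd u (G b) (g x))) (at x)"
    using has_derivative_compose[OF G U] .
  moreover have "pd u (G b) (g x) = (\<Sum>c\<in>Basis. pd u c (g x) *
      pd (\<lambda>x. g x \<bullet> c) b x)" for b
    using has_derivative_linear[OF U]
    by (simp add: G_def linear_sum linear_scale mult.commute)
  ultimately show ?thesis by simp
qed

text \<open>By the chain rule a partial of \<open>u (g x)\<close> is a sum of products of
  \<open>pd u c (g x)\<close> with partials of the coordinates of g; u is generalised so that the
  induction hypothesis reaches \<open>pd u c\<close>.\<close>

lemma Ck_on_compose:
  fixes g :: "'a::euclidean_space \<Rightarrow> 'b::euclidean_space"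
  assumes S: "open S" and T: "open T" and gST: "\<And>x. x \<in> S \<Longrightarrow> g x \<in> T"
  shows "Ck_on k T u \<Longrightarrow> (\<And>c. c \<in> Basis \<Longrightarrow> Ck_on k S (\<lambda>x. g x \<bullet> c)) \<Longrightarrow> Ck_on k S (\<lambda>x. u (g x))"
proof (induction k arbitrary: u)
  case 0
  have "continuous_on S g"
    using 0 by (subst continuous_on_componentwise) auto
  moreover have "continuous_on (g ` S) u"
    using 0 gST by (auto intro: continuous_on_subset)
  ultimately show ?case using continuous_on_compose[of S g u] by (simp add: o_def)
next
  case (Suc k)
  have D: "((\<lambda>x. u (g x)) has_derivative (\<lambda>b. \<Sum>c\<in>Basis. pd u c (g x) *
      pd (\<lambda>x. g x \<bullet> c) b x)) (at x)" if "x \<in> S" for x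
    by (rule frechet_derivative_compose_components) (use Suc.prems that gST in auto)
  have "Ck_on k S (\<lambda>x. pd u c (g x))" if "c \<in> Basis" for c
    by (rule Suc.IH[of "pd u c"])
       (use Suc.prems that Ck_on_SucD[OF Suc.prems(2)] in simp_all)
  then have "Ck_on k S (\<lambda>x. \<Sum>c\<in>Basis. pd u c (g x) *
      pd (\<lambda>x. g x \<bullet> c) b x)" if "b \<in> Basis" for b
    using Suc.prems(2) that by (auto intro!: Ck_on_sum[OF S] Ck_on_mult[OF S])
  from Ck_on_cong[OF S _ this]
  have "Ck_on k S (\<lambda>x. pd (\<lambda>x. u (g x)) b x)" if "b \<in> Basis" for b
    using frechet_derivative_at'[OF D] that by simp
  with differentiableI[OF D] show ?case by simp
qed

text \<open>Order k + 1 implies order k, so quantifying over successors only loses nothing, and the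
  quantifier over k can be moved inside. This removes the order from later arguments.\<close>

lemma smooth_on_iff_partials: "smooth_on S u \<longleftrightarrow> (\<forall>x\<in>S. u differentiable (at x)) \<and>
     (\<forall>b\<in>Basis. smooth_on S (pd u b))"
proof -
  have "smooth_on S u \<longleftrightarrow> (\<forall>k. Ck_on (Suc k) S u)"
    unfolding smooth_on_def
  proof (rule iffI; rule allI)
    fix k assume *: "\<forall>k. Ck_on (Suc k) S u"
    show "Ck_on k S u" by (rule Ck_on_SucD[OF *[rule_format]])
  qed (erule spec)
  moreover have "(\<forall>k. A \<and> (\<forall>b\<in>Basis. Q k b)) \<longleftrightarrow> A \<and> (\<forall>b\<in>Basis. \<forall>k. Q k b)"
    for A and Q :: "nat \<Rightarrow> 'a \<Rightarrow> bool"
    by blast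
  ultimately show ?thesis by (simp only: smooth_on_def Ck_on.simps)
qed

lemma smooth_on_differentiable: "smooth_on S u \<Longrightarrow> x \<in> S \<Longrightarrow> u differentiable (at x)"
  by (subst (asm) smooth_on_iff_partials) simp

lemma smooth_on_partial:
  "smooth_on S u \<Longrightarrow> b \<in> Basis \<Longrightarrow> smooth_on S (pd u b)"
  by (subst (asm) smooth_on_iff_partials) simp

lemma smooth_on_continuous: "smooth_on S u \<Longrightarrow> continuous_on S u"
  using Ck_on.simps(1) unfolding smooth_on_def by blast

lemma smooth_on_cong: "open S \<Longrightarrow> (\<And>x. x \<in> S \<Longrightarrow> f x = g x) \<Longrightarrow> smooth_on S f \<Longrightarrow> smooth_on S g"
  unfolding smooth_on_def using Ck_on_cong by blast

lemma smooth_on_Un: "open S \<Longrightarrow> open T \<Longrightarrow> smooth_on S u \<Longrightarrow> smooth_on T u \<Longrightarrow> smooth_on (S \<union> T) u"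
  unfolding smooth_on_def using Ck_on_Un by blast

lemma smooth_on_const: "smooth_on S (\<lambda>x. c)"
  unfolding smooth_on_def using Ck_on_const by blast

lemma smooth_on_inner: "smooth_on S (\<lambda>x. x \<bullet> v)"
  unfolding smooth_on_def using Ck_on_inner by blast

lemma smooth_on_add: "open S \<Longrightarrow> smooth_on S f \<Longrightarrow> smooth_on S g \<Longrightarrow> smooth_on S (\<lambda>x. f x + g x)"
  unfolding smooth_on_def using Ck_on_add by blast

lemma smooth_on_mult: "open S \<Longrightarrow> smooth_on S f \<Longrightarrow> smooth_on S g \<Longrightarrow> smooth_on S (\<lambda>x. f x * g x)"
  unfolding smooth_on_def using Ck_on_mult by blast

lemma smooth_on_sum:
  "open S \<Longrightarrow> (\<And>i. i \<in> I \<Longrightarrow> smooth_on S (f i)) \<Longrightarrow> smooth_on S (\<lambda>x. \<Sum>i\<in>I. f i x)"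
  by (simp add: smooth_on_def Ck_on_sum)

lemma smooth_on_compose:
  fixes g :: "'a::euclidean_space \<Rightarrow> 'b::euclidean_space"
  assumes "open S" "open T" "\<And>x. x \<in> S \<Longrightarrow> g x \<in> T"
    "smooth_on T u" "\<And>c. c \<in> Basis \<Longrightarrow> smooth_on S (\<lambda>x. g x \<bullet> c)"
  shows "smooth_on S (\<lambda>x. u (g x))"
  unfolding smooth_on_def
proof
  fix k
  show "Ck_on k S (\<lambda>x. u (g x))"
  proof (rule Ck_on_compose[OF assms(1,2)])
    show "Ck_on k T u" using assms(4) by (simp add: smooth_on_def)
  qed (use assms(3,5) in \<open>simp_all add: smooth_on_def\<close>)
qed

section \<open>Smoothness of powers and of the logarithm of the norm away from the origin\<close>

lemma has_derivative_norm_powr: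
  assumes "x \<noteq> 0"
  shows "((\<lambda>x::'a::euclidean_space. norm x powr \<alpha>) has_derivative (\<lambda>b. \<alpha> * norm x powr (\<alpha> - 2) * (x \<bullet> b))) (at x)"
proof -
  have "norm x powr (\<alpha> - 2) = norm x powr \<alpha> / norm x ^ 2"
    using assms powr_diff[of "norm x" \<alpha> 2] by (simp add: powr_realpow[of _ 2, simplified])
  then show ?thesis using assms
    by (auto intro!: derivative_eq_intros has_derivative_norm
          simp: sgn_div_norm field_simps power2_eq_square inner_commute)
qed

text \<open>The exponent is generalised because a partial derivative yields the exponent \<alpha> -
  2 times a linear function: up to such factors the family of powers is closed under
  differentiation.\<close>

lemma Ck_on_norm_powr: "Ck_on k (- {0}) (\<lambda>x::'a::euclidean_space. norm x powr \<alpha>)"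
proof (induction k arbitrary: \<alpha>)
  case 0
  then show ?case by (auto intro!: continuous_intros)
next
  case (Suc k)
  note D = has_derivative_norm_powr[where 'a='a and \<alpha>=\<alpha>]
  have "Ck_on k (- {0}) (\<lambda>x. \<alpha> * norm x powr (\<alpha> - 2) * (x \<bullet> b))" for b :: 'a
    by (intro Ck_on_mult Ck_on_const Suc Ck_on_inner) auto
  then have "Ck_on k (-{0}) (\<lambda>x. pd (\<lambda>x::'a. norm x powr \<alpha>) b x)" for b
    by (rule Ck_on_cong[rotated 2, of _ _ "\<lambda>x. \<alpha> * norm x powr (\<alpha> - 2) * (x \<bullet> b)"]) (simp_all add: frechet_derivative_at'[OF D] open_Compl)
  with differentiableI[OF D] show ?case by simp
qed

lemma smooth_on_norm_powr: "smooth_on (- {0}) (\<lambda>x::'a::euclidean_space. norm x powr \<alpha>)"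
  by (simp add: smooth_on_def Ck_on_norm_powr)

lemma has_derivative_ln_norm:
  assumes "x \<noteq> 0" shows "((\<lambda>x::'a::euclidean_space. ln (norm x)) has_derivative
    (\<lambda>b. norm x powr (- 2) * (x \<bullet> b))) (at x)"
proof -
  have "norm x powr (- 2) = 1 / norm x ^ 2"
    using assms powr_minus[of "norm x" 2] by (simp add: powr_realpow[of _ 2, simplified] field_simps)
  then show ?thesis using assms
    by (auto intro!: derivative_eq_intros has_derivative_norm simp: sgn_div_norm field_simps power2_eq_square inner_commute)
qed

lemma smooth_on_ln_norm: "smooth_on (- {0}) (\<lambda>x::'a::euclidean_space. ln (norm x))"
proof -
  have "smooth_on (- {0}) (\<lambda>x. norm x powr (- 2) * (x \<bullet> b))" for b :: 'a
    by (intro smooth_on_mult smooth_on_norm_powr smooth_on_inner) auto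
  then have "smooth_on (-{0}) (\<lambda>x. pd (\<lambda>x::'a. ln (norm x)) b x)" for b
    by (rule smooth_on_cong[rotated 2]) (simp_all add: frechet_derivative_at'[OF has_derivative_ln_norm] open_Compl)
  moreover have "(\<lambda>x. ln (norm x)) differentiable (at x)" if "x \<noteq> 0" for x :: 'a
    using differentiableI[OF has_derivative_ln_norm[OF that]] .
  ultimately show ?thesis
    by (subst smooth_on_iff_partials) simp
qed

section \<open>A dilation and rotation invariant measure\<close>

text \<open>The double integral of 1_A(x) 1_B(x + y) is evaluated in both orders: invariance of
  Lebesgue measure gives M(A) |B|, invariance of M gives |A| M(B). Since M(B) = |B| is finite and
  positive, it cancels.\<close>

lemma haar_unique:
  fixes M :: "'a::euclidean_space measure"
  assumes sets: "sets M = sets borel" and fin: "sigma_finite_measure M"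
    and inv: "\<And>y. distr M borel (\<lambda>x. x + y) = M"
    and B: "B \<in> sets borel" "emeasure M B = emeasure lborel B" "emeasure lborel B \<noteq> 0" "emeasure lborel B \<noteq> \<infinity>"
  shows "M = lborel"
proof (rule measure_eqI)
  show "sets M = sets lborel" using sets by simp
  fix A assume A: "A \<in> sets M"
  then have Ab[measurable]: "A \<in> sets borel" using sets by simp
  note B(1)[measurable]
  interpret M: sigma_finite_measure M by fact
  interpret P: pair_sigma_finite M lborel ..
  have [measurable_cong]: "sets M = sets borel" by fact
  let ?g = "\<lambda>x y::'a. indicator A x * indicator B (x + y) :: ennreal"
  have "emeasure M A * emeasure lborel B = (\<integral>\<^sup>+x. (\<integral>\<^sup>+y. ?g x y \<partial>lborel) \<partial>M)"
  proof -
    have "(\<integral>\<^sup>+y. ?g x y \<partial>lborel) = indicator A x * emeasure lborel B" for x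
    proof -
      have "(\<integral>\<^sup>+y. indicator B (x + y) \<partial>lborel) = (\<integral>\<^sup>+y. indicator B y \<partial>distr lborel borel ((+) x))"
        by (subst nn_integral_distr) auto
      also have "\<dots> = emeasure lborel B" by (simp add: lborel_distr_plus)
      finally show ?thesis by (simp add: nn_integral_cmult)
    qed
    then show ?thesis by (simp add: nn_integral_multc)
  qed
  also have "\<dots> = (\<integral>\<^sup>+y. (\<integral>\<^sup>+x. ?g x y \<partial>M) \<partial>lborel)"
    by (intro P.Fubini'[symmetric]) measurable
  also have "\<dots> = (\<integral>\<^sup>+y. (\<integral>\<^sup>+x. indicator A (x + - y) * indicator B x \<partial>M) \<partial>lborel)"
  proof (rule nn_integral_cong)
    fix y :: 'a
    have "(\<integral>\<^sup>+x. ?g x y \<partial>M) = (\<integral>\<^sup>+x. ?g x y \<partial>distr M borel (\<lambda>x. x + - y))"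
      by (subst inv[of "-y"]) simp
    also have "\<dots> = (\<integral>\<^sup>+x. indicator A (x + - y) * indicator B x \<partial>M)"
      by (subst nn_integral_distr) auto
    finally show "(\<integral>\<^sup>+x. ?g x y \<partial>M) = (\<integral>\<^sup>+x. indicator A (x + - y) * indicator B x \<partial>M)" .
  qed
  also have "\<dots> = (\<integral>\<^sup>+x. (\<integral>\<^sup>+y. indicator A (x + - y) * indicator B x \<partial>lborel) \<partial>M)"
    by (intro P.Fubini') measurable
  also have "\<dots> = emeasure lborel A * emeasure M B"
  proof -
    have "(\<integral>\<^sup>+y. indicator A (x + - y) * indicator B x \<partial>lborel) = emeasure lborel A * indicator B x" for x
    proof -
      have "(\<integral>\<^sup>+y. indicator A (x + - y) \<partial>lborel) = (\<integral>\<^sup>+y. indicator A y \<partial>distr lborel borel (\<lambda>y. x + (-1) *\<^sub>R y))"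
        by (subst nn_integral_distr) auto
      also have "\<dots> = emeasure lborel A"
        using lborel_affine[of "-1" x] by (simp add: density_1)
      finally show ?thesis by (simp add: nn_integral_multc)
    qed
    then show ?thesis by (simp add: nn_integral_cmult sets)
  qed
  finally show "emeasure M A = emeasure lborel A"
    using B by (metis ennreal_mult_cancel_left infinity_ennreal_def mult.commute)
qed

lemma distr_lborel_orthogonal:
  fixes T :: "'a::euclidean_space \<Rightarrow> 'a"
  assumes T: "orthogonal_transformation T"
  shows "distr lborel borel T = lborel"
proof (rule haar_unique[where B="cball 0 1"])
  have lin: "linear T" using T by (simp add: orthogonal_transformation_def)
  have cont: "continuous_on UNIV T" using lin linear_continuous_on linear_conv_bounded_linear by blast
  then have [measurable]: "T \<in> borel_measurable borel" by (rule borel_measurable_continuous_onI)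
  have surj: "surj T" using T orthogonal_transformation_surj by blast
  have vb: "T -` cball 0 r = cball 0 r" for r
    using orthogonal_transformation_norm[OF T] by auto
  show "sets (distr lborel borel T) = sets borel" by simp
  show "sigma_finite_measure (distr lborel borel T)"
  proof
    show "\<exists>A. countable A \<and> A \<subseteq> sets (distr lborel borel T) \<and> \<Union>A = space (distr lborel borel T) \<and>
      (\<forall>a\<in>A. emeasure (distr lborel borel T) a \<noteq> \<infinity>)"
    proof (intro exI[of _ "range (\<lambda>n::nat. cball 0 (real n))"] conjI ballI)
      show "\<Union>(range (\<lambda>n::nat. cball 0 (real n))) = space (distr lborel borel T)"
        by (auto simp: real_arch_simple)
      fix a :: "'a set" assume "a \<in> range (\<lambda>n::nat. cball 0 (real n))"
      then obtain n :: nat where "a = cball 0 (real n)" by auto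
      then show "emeasure (distr lborel borel T) a \<noteq> \<infinity>"
        by (simp add: emeasure_distr vb) (metis emeasure_lborel_cball_finite less_irrefl infinity_ennreal_def)
    qed auto
  qed
  show "emeasure (distr lborel borel T) (cball 0 1) = emeasure lborel (cball (0::'a) 1)"
    by (simp add: emeasure_distr vb)
  show "emeasure lborel (cball (0::'a) 1) \<noteq> \<infinity>"
    by (metis emeasure_lborel_cball_finite less_irrefl infinity_ennreal_def)
  show "emeasure lborel (cball (0::'a) 1) \<noteq> 0"
  proof
    assume "emeasure lborel (cball (0::'a) 1) = 0"
    then have "negligible (cball (0::'a) 1)"
      by (simp add: negligible_iff_null_sets null_sets_completionI null_setsI)
    then show False by (simp add: negligible_convex_interior)
  qed
  fix y
  obtain z where z: "T z = y" using surj by (metis surjD)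
  have "distr (distr lborel borel T) borel (\<lambda>x. x + y) = distr lborel borel (\<lambda>x. T x + y)"
    by (subst distr_distr) (auto simp: o_def)
  also have "\<dots> = distr (distr lborel borel ((+) z)) borel T"
    using z by (subst distr_distr) (auto simp: o_def linear_add[OF lin] add.commute)
  also have "\<dots> = distr lborel borel T" by (simp add: lborel_distr_plus)
  finally show "distr (distr lborel borel T) borel (\<lambda>x. x + y) = distr lborel borel T" .
qed auto

text \<open>In the coordinates ln |x| and x / |x| this is ds times the surface measure of the
  sphere; dilations become translations in s. The origin is a null set.\<close>

definition haar :: "'a::euclidean_space measure" where
  "haar = density lborel (\<lambda>x. ennreal (norm x powr - real DIM('a)))"

lemma sets_haar[simp, measurable_cong]: "sets haar = sets borel"
  by (simp add: haar_def)

lemma space_haar[simp]: "space haar = UNIV"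
  by (simp add: haar_def)

lemma sigma_finite_haar: "sigma_finite_measure (haar :: 'a::euclidean_space measure)"
  unfolding haar_def by (subst sigma_finite_measure.sigma_finite_iff_density_finite[OF lborel.sigma_finite_measure_axioms]) auto

lemma AE_haar_nonzero: "AE x in haar. x \<noteq> (0::'a::euclidean_space)"
  unfolding haar_def by (subst AE_density) (auto simp: AE_lborel_singleton)

lemma nn_integral_haar:
  fixes F :: "'a::euclidean_space \<Rightarrow> ennreal"
  assumes [measurable]: "F \<in> borel_measurable borel"
  shows "(\<integral>\<^sup>+x. F x \<partial>haar) = (\<integral>\<^sup>+x. ennreal (norm x powr - real DIM('a)) * F x \<partial>lborel)"
  unfolding haar_def by (subst nn_integral_density) auto

lemma distr_haar_orthogonal:
  fixes T :: "'a::euclidean_space \<Rightarrow> 'a"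
  assumes T: "orthogonal_transformation T"
  shows "distr haar borel T = haar"
proof (rule measure_eqI)
  have lin: "linear T" using T by (simp add: orthogonal_transformation_def)
  have cont: "continuous_on UNIV T" using lin linear_continuous_on linear_conv_bounded_linear by blast
  then have [measurable]: "T \<in> borel_measurable borel" by (rule borel_measurable_continuous_onI)
  fix A assume "A \<in> sets (distr haar borel T)"
  then have [measurable]: "A \<in> sets borel" by simp
  have "emeasure (distr haar borel T) A = (\<integral>\<^sup>+x. indicator A x \<partial>distr haar borel T)" by simp
  also have "\<dots> = (\<integral>\<^sup>+x. ennreal (norm (T x) powr - real DIM('a)) * indicator A (T x) \<partial>lborel)"
    by (subst nn_integral_distr) (auto simp: nn_integral_haar orthogonal_transformation_norm[OF T])
  also have "\<dots> = (\<integral>\<^sup>+x. ennreal (norm x powr - real DIM('a)) * indicator A x \<partial>distr lborel borel T)"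
    by (subst nn_integral_distr) auto
  also have "\<dots> = emeasure haar A"
    by (simp add: distr_lborel_orthogonal[OF T] nn_integral_haar[symmetric] del: nn_integral_indicator)
       (simp add: nn_integral_haar[symmetric])
  finally show "emeasure (distr haar borel T) A = emeasure haar A" .
qed auto

lemma distr_haar_scale:
  assumes t: "t > 0"
  shows "distr haar borel (\<lambda>x::'a::euclidean_space. t *\<^sub>R x) = haar"
proof (rule measure_eqI)
  fix A :: "'a set" assume "A \<in> sets (distr haar borel ((*\<^sub>R) t))"
  then have [measurable]: "A \<in> sets borel" by simp
  let ?N = "real DIM('a)"
  have "emeasure haar A = (\<integral>\<^sup>+x. ennreal (norm x powr - ?N) * indicator A x \<partial>lborel)"
    by (simp add: nn_integral_haar[symmetric] del: nn_integral_indicator)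
       (simp add: nn_integral_haar[symmetric])
  also have "\<dots> = (\<integral>\<^sup>+x. ennreal (norm x powr - ?N) * indicator A x
       \<partial>density (distr lborel borel (\<lambda>x. 0 + t *\<^sub>R x)) (\<lambda>_. ennreal (\<bar>t\<bar> ^ DIM('a))))"
    using t lborel_affine[of t "0::'a"] by simp
  also have "\<dots> = (\<integral>\<^sup>+x. ennreal (t ^ DIM('a)) * (ennreal (norm (t *\<^sub>R x) powr - ?N) * indicator A (t *\<^sub>R x)) \<partial>lborel)"
    using t by (subst nn_integral_density, simp, simp, subst nn_integral_distr) auto
  also have "\<dots> = (\<integral>\<^sup>+x. ennreal (norm x powr - ?N) * indicator A (t *\<^sub>R x) \<partial>lborel)"
    using t by (intro nn_integral_cong)
     (auto simp: powr_mult powr_minus powr_realpow ennreal_mult'[symmetric] indicator_def field_simps)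
  also have "\<dots> = emeasure (distr haar borel ((*\<^sub>R) t)) A"
  proof -
    have "emeasure (distr haar borel ((*\<^sub>R) t)) A = (\<integral>\<^sup>+x. indicator A x \<partial>distr haar borel ((*\<^sub>R) t))" by simp
    also have "\<dots> = (\<integral>\<^sup>+x. indicator A (t *\<^sub>R x) \<partial>haar)"
      by (subst nn_integral_distr) auto
    finally show ?thesis by (simp add: nn_integral_haar)
  qed
  finally show "emeasure (distr haar borel ((*\<^sub>R) t)) A = emeasure haar A" ..
qed auto

text \<open>Integration by parts without boundary terms. By the fundamental theorem the integral of
  g along the flow over the times [0, 1] is h (T 1 x) - h x; integrating over x, Fubini and
  invariance turn the left side into the integral of g and the right side into 0.\<close>

lemma integral_flow_derivative_eq_0:
  fixes M :: "'a::euclidean_space measure" and T :: "real \<Rightarrow> 'a \<Rightarrow> 'a" and h g :: "'a \<Rightarrow> real"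
  assumes sf: "sigma_finite_measure M" and setsM: "sets M = sets borel"
    and T: "(\<lambda>(t, x). T t x) \<in> borel_measurable (borel \<Otimes>\<^sub>M borel)"
    and T0: "\<And>x. T 0 x = x" and inv: "\<And>t. distr M borel (T t) = M"
    and der: "AE x in M. \<forall>t. ((\<lambda>t. h (T t x)) has_real_derivative g (T t x)) (at t)"
    and cont: "AE x in M. \<forall>t. isCont (\<lambda>t. g (T t x)) t"
    and h: "integrable M h" and g: "integrable M g"
  shows "(\<integral>x. g x \<partial>M) = 0"
proof -
  note [measurable_cong] = setsM
  have [measurable]: "g \<in> borel_measurable borel" "h \<in> borel_measurable borel"
    using borel_measurable_integrable[OF g] borel_measurable_integrable[OF h] by measurable
  have Tm: "T t \<in> borel_measurable borel" for t
    using measurable_compose[OF measurable_Pair1' T, of t] by simp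
  note [measurable] = T
  interpret M: sigma_finite_measure M by fact
  interpret P: pair_sigma_finite lborel M ..
  let ?f = "\<lambda>t x. indicator {0..1::real} t * g (T t x)"
  have inte: "integrable M (\<lambda>x. k (T t x))" "(\<integral>x. k (T t x) \<partial>M) = (\<integral>x. k x \<partial>M)"
    if "integrable M k" for k :: "'a \<Rightarrow> real" and t
  proof -
    have [measurable]: "k \<in> borel_measurable borel"
      using borel_measurable_integrable[OF that] by measurable
    have [measurable]: "T t \<in> measurable M borel" using Tm by measurable
    show "integrable M (\<lambda>x. k (T t x))"
      using that integrable_distr_eq[of "T t" M borel k] inv[of t] by simp
    show "(\<integral>x. k (T t x) \<partial>M) = (\<integral>x. k x \<partial>M)"
      using integral_distr[of "T t" M borel k] inv[of t] by simp
  qed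
  have int: "integrable (lborel \<Otimes>\<^sub>M M) (\<lambda>(t, x). ?f t x)"
  proof (rule P.Fubini_integrable)
    show "(\<lambda>(t, x). ?f t x) \<in> borel_measurable (lborel \<Otimes>\<^sub>M M)" by measurable
    have "(\<integral>x. norm (?f t x) \<partial>M) = indicator {0..1} t * (\<integral>x. \<bar>g x\<bar> \<partial>M)" for t
      using inte(2)[OF integrable_abs[OF g], of t] by (simp add: abs_mult)
    then show "integrable lborel (\<lambda>t. \<integral>x. norm (case (t, x) of (t, x) \<Rightarrow> ?f t x) \<partial>M)"
      by simp
    show "AE t in lborel. integrable M (\<lambda>x. case (t, x) of (t, x) \<Rightarrow> ?f t x)"
      using inte(1)[OF g] by simp
  qed
  have "(\<integral>x. g x \<partial>M) = (\<integral>t. (\<integral>x. ?f t x \<partial>M) \<partial>lborel)"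
    using inte(2)[OF g] by simp
  also have "\<dots> = (\<integral>x. (\<integral>t. ?f t x \<partial>lborel) \<partial>M)"
    using P.Fubini_integral[OF int] by simp
  also have "\<dots> = (\<integral>x. h (T 1 x) - h x \<partial>M)"
  proof (rule integral_cong_AE)
    show "AE x in M. (\<integral>t. ?f t x \<partial>lborel) = h (T 1 x) - h x"
      using der cont
    proof eventually_elim
      case (elim x)
      have "(\<integral>t. g (T t x) * indicator {0..1} t \<partial>lborel) = h (T 1 x) - h (T 0 x)"
        by (rule integral_FTC_Icc_real) (use elim in auto)
      then show ?case by (simp add: T0 mult.commute)
    qed
    show "(\<lambda>x. \<integral>t. ?f t x \<partial>lborel) \<in> borel_measurable M" by measurable
    show "(\<lambda>x. h (T 1 x) - h x) \<in> borel_measurable M" using Tm by measurable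
  qed
  also have "\<dots> = 0" using inte[OF h, of 1] h by simp
  finally show ?thesis .
qed

section \<open>Shells in place of polar coordinates\<close>

lemma nn_integral_haar_scale:
  fixes F :: "'a::euclidean_space \<Rightarrow> ennreal"
  assumes [measurable]: "F \<in> borel_measurable borel" and "t > 0"
  shows "(\<integral>\<^sup>+x. F (t *\<^sub>R x) \<partial>haar) = (\<integral>\<^sup>+x. F x \<partial>haar)"
  using nn_integral_distr[of "\<lambda>x. t *\<^sub>R x" haar borel F] distr_haar_scale[OF \<open>t > 0\<close>, where 'a='a]
  by simp

lemma nn_integral_lborel_shift:
  fixes k :: "real \<Rightarrow> ennreal"
  assumes [measurable]: "k \<in> borel_measurable borel"
  shows "(\<integral>\<^sup>+s. k (s + c) \<partial>lborel) = (\<integral>\<^sup>+s. k s \<partial>lborel)"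
    "(\<integral>\<^sup>+s. k (c - s) \<partial>lborel) = (\<integral>\<^sup>+s. k s \<partial>lborel)"
  using nn_integral_real_affine[of k 1 c] nn_integral_real_affine[of k "-1" c]
  by (simp_all add: add.commute)

text \<open>This replaces polar coordinates: the shell \<open>k (ln (norm x)) haar\<close> plays the role of the
  surface measure of the sphere.\<close>

lemma nn_integral_shell:
  fixes F :: "'a::euclidean_space \<Rightarrow> ennreal" and k :: "real \<Rightarrow> ennreal"
  assumes [measurable]: "F \<in> borel_measurable borel" "k \<in> borel_measurable borel"
  shows "(\<integral>\<^sup>+s. (\<integral>\<^sup>+x. k (ln (norm x)) * F ((exp s / norm x) *\<^sub>R x) \<partial>haar) \<partial>lborel) =
    (\<integral>\<^sup>+s. k s \<partial>lborel) * (\<integral>\<^sup>+x. F x \<partial>haar)"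
proof -
  interpret M: sigma_finite_measure "haar :: 'a measure" by (rule sigma_finite_haar)
  interpret P: pair_sigma_finite lborel "haar :: 'a measure" ..
  have "(\<integral>\<^sup>+s. (\<integral>\<^sup>+x. k (ln (norm x)) * F ((exp s / norm x) *\<^sub>R x) \<partial>haar) \<partial>lborel) =
     (\<integral>\<^sup>+x. (\<integral>\<^sup>+s. k (ln (norm x)) * F ((exp s / norm x) *\<^sub>R x) \<partial>lborel) \<partial>haar)"
    by (rule P.Fubini'[symmetric]) measurable
  also have "\<dots> = (\<integral>\<^sup>+x. (\<integral>\<^sup>+s. k (ln (norm x)) * F (exp s *\<^sub>R x) \<partial>lborel) \<partial>haar)"
  proof (rule nn_integral_cong_AE)
    show "AE x in haar. (\<integral>\<^sup>+s. k (ln (norm x)) * F ((exp s / norm x) *\<^sub>R x) \<partial>lborel) =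
      (\<integral>\<^sup>+s. k (ln (norm x)) * F (exp s *\<^sub>R x) \<partial>lborel)"
      using AE_haar_nonzero
    proof eventually_elim
      case (elim x)
      have e: "exp s / norm x = exp (s + - ln (norm x))" for s
        using elim by (simp add: exp_diff)
      show ?case unfolding e
        by (rule nn_integral_lborel_shift(1)[of "\<lambda>s. k (ln (norm x)) * F (exp s *\<^sub>R x)"]) measurable
    qed
  qed
  also have "\<dots> = (\<integral>\<^sup>+s. (\<integral>\<^sup>+x. k (ln (norm x)) * F (exp s *\<^sub>R x) \<partial>haar) \<partial>lborel)"
    by (rule P.Fubini') measurable
  also have "\<dots> = (\<integral>\<^sup>+s. (\<integral>\<^sup>+x. k (ln (norm x) - s) * F x \<partial>haar) \<partial>lborel)"
  proof (rule nn_integral_cong)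
    fix s :: real
    \<comment> \<open>Dilation invariance moves the factor \<open>exp s\<close> from F into k, where
      s enters as a translation; integrating over s then gives a constant that does not depend on
      x.\<close>
    have "(\<integral>\<^sup>+x. k (ln (norm x)) * F (exp s *\<^sub>R x) \<partial>haar) =
      (\<integral>\<^sup>+x. k (ln (norm (exp s *\<^sub>R x)) - s) * F (exp s *\<^sub>R x) \<partial>haar)"
      by (rule nn_integral_cong_AE, rule AE_mp[OF AE_haar_nonzero]) (auto simp: ln_mult)
    also have "\<dots> = (\<integral>\<^sup>+x. k (ln (norm x) - s) * F x \<partial>haar)"
      by (rule nn_integral_haar_scale) auto
    finally show "(\<integral>\<^sup>+x. k (ln (norm x)) * F (exp s *\<^sub>R x) \<partial>haar) =
      (\<integral>\<^sup>+x. k (ln (norm x) - s) * F x \<partial>haar)" .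
  qed
  also have "\<dots> = (\<integral>\<^sup>+x. (\<integral>\<^sup>+s. k (ln (norm x) - s) * F x \<partial>lborel) \<partial>haar)"
    by (rule P.Fubini'[symmetric]) measurable
  also have "\<dots> = (\<integral>\<^sup>+s. k s \<partial>lborel) * (\<integral>\<^sup>+x. F x \<partial>haar)"
  proof -
    have "(\<integral>\<^sup>+s. k (ln (norm x) - s) * F x \<partial>lborel) = (\<integral>\<^sup>+s. k s \<partial>lborel) * F x" for x
      using nn_integral_lborel_shift(2)[of k "ln (norm x)"] by (simp add: nn_integral_multc)
    then show ?thesis by (simp add: nn_integral_cmult)
  qed
  finally show ?thesis .
qed

lemma shell_measure_finite:
  assumes "a > 0"
  shows "(\<integral>\<^sup>+x. indicator {a..b} (norm (x::'a::euclidean_space)) \<partial>haar) < \<infinity>"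
proof -
  have "(\<integral>\<^sup>+x. indicator {a..b} (norm (x::'a)) \<partial>haar) =
    (\<integral>\<^sup>+x. ennreal (norm x powr - real DIM('a)) * indicator {a..b} (norm (x::'a)) \<partial>lborel)"
    by (simp add: nn_integral_haar)
  also have "\<dots> \<le> (\<integral>\<^sup>+x. ennreal (a powr - real DIM('a)) * indicator (cball (0::'a) b) x \<partial>lborel)"
    using assms by (intro nn_integral_mono) (auto simp: indicator_def intro!: ennreal_leI powr_mono2')
  also have "\<dots> = ennreal (a powr - real DIM('a)) * emeasure lborel (cball (0::'a) b)"
    by (subst nn_integral_cmult_indicator) auto
  also have "\<dots> < \<infinity>"
    using emeasure_lborel_cball_finite[of "0::'a" b] by (simp add: ennreal_mult_less_top)
  finally show ?thesis .
qed

text \<open>The shell formula with k the indicator of [0, 1], read from right to left, bounds the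
  integral by that of a function of s alone over a shell of finite measure. What remains is the
  integral of exp (\<delta> s) over s \<le> ln r, which converges because \<delta> > 0.\<close>

lemma nn_integral_haar_powr_finite:
  assumes "\<delta> > 0"
  shows "(\<integral>\<^sup>+x. ennreal (norm x powr \<delta>) * indicator (cball (0::'a::euclidean_space) r) x \<partial>haar) < \<infinity>"
    (is "?I < \<infinity>")
proof (cases "r > 0")
  case False
  have "?I = (\<integral>\<^sup>+x. 0 \<partial>(haar::'a measure))"
  proof (rule nn_integral_cong)
    fix x :: 'a
    show "ennreal (norm x powr \<delta>) * indicator (cball 0 r) x = 0"
      using False norm_ge_zero[of x] by (cases "x = 0") (auto simp: indicator_def simp flip: zero_less_norm_iff)
  qed
  then show ?thesis by simp
next
  case True
  let ?k = "indicator {0..1} :: real \<Rightarrow> ennreal"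
  have "?I = (\<integral>\<^sup>+s. ?k s \<partial>lborel) * ?I" by simp
  also have "\<dots> = (\<integral>\<^sup>+s. (\<integral>\<^sup>+x. ?k (ln (norm x)) * (ennreal (norm ((exp s / norm x) *\<^sub>R x) powr \<delta>)
      * indicator (cball (0::'a) r) ((exp s / norm x) *\<^sub>R x)) \<partial>haar) \<partial>lborel)"
    by (rule nn_integral_shell[symmetric]) (auto intro!: borel_measurable_times_ennreal borel_measurable_indicator)
  also have "\<dots> \<le> (\<integral>\<^sup>+s. (\<integral>\<^sup>+x. indicator {exp 0..exp 1} (norm (x::'a)) * (ennreal (exp (\<delta> * s))
      * indicator {..ln r} s) \<partial>haar) \<partial>lborel)"
  proof (rule nn_integral_mono, rule nn_integral_mono_AE, rule AE_mp[OF AE_haar_nonzero],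
      rule AE_I2, rule impI)
    fix s :: real and x :: 'a assume x: "x \<noteq> 0"
    have "exp 0 \<le> norm x \<and> norm x \<le> exp 1" if "0 \<le> ln (norm x)" "ln (norm x) \<le> 1"
      using that x by (metis exp_le_cancel_iff exp_ln zero_less_norm_iff)
    moreover have "exp s \<le> r \<longleftrightarrow> s \<le> ln r" using True by (metis exp_le_cancel_iff exp_ln)
    ultimately show "?k (ln (norm x)) * (ennreal (norm ((exp s / norm x) *\<^sub>R x) powr \<delta>)
      * indicator (cball (0::'a) r) ((exp s / norm x) *\<^sub>R x)) \<le>
      indicator {exp 0..exp 1} (norm (x::'a)) * (ennreal (exp (\<delta> * s)) * indicator {..ln r} s)"
      using x by (auto simp: indicator_def powr_def)
  qed
  also have "\<dots> = (\<integral>\<^sup>+x. indicator {exp 0..exp 1} (norm (x::'a)) \<partial>haar) *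
      (\<integral>\<^sup>+s. ennreal (exp (\<delta> * s)) * indicator {..ln r} s \<partial>lborel)"
    by (simp add: nn_integral_multc nn_integral_cmult)
  also have "(\<integral>\<^sup>+s. ennreal (exp (\<delta> * s)) * indicator {..ln r} s \<partial>lborel) =
      (\<integral>\<^sup>+s. ennreal (exp (\<delta> * (ln r - s))) * indicator {0..} s \<partial>lborel)"
    using nn_integral_lborel_shift(2)[of "\<lambda>s. ennreal (exp (\<delta> * s)) * indicator {..ln r} s" "ln r"]
    by (auto simp: indicator_def)
  also have "\<dots> = ennreal (0 - (- exp (\<delta> * (ln r - 0)) / \<delta>))"
  proof (rule nn_integral_FTC_atLeast)
    show "((\<lambda>s. - exp (\<delta> * (ln r - s)) / \<delta>) \<longlongrightarrow> 0) at_top"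
    proof -
      have "filterlim (\<lambda>s. exp (\<delta> * s)) at_top at_top"
        using filterlim_compose[OF exp_at_top
          filterlim_tendsto_pos_mult_at_top[OF tendsto_const[of \<delta>] assms filterlim_ident]] .
      then have "((\<lambda>s. inverse (exp (\<delta> * s))) \<longlongrightarrow> 0) at_top"
        by (rule tendsto_inverse_0_at_top)
      then have "((\<lambda>s. - (exp (\<delta> * ln r) / \<delta>) * inverse (exp (\<delta> * s))) \<longlongrightarrow> - (exp (\<delta> * ln r) / \<delta>) * 0) at_top"
        by (intro tendsto_mult tendsto_const)
      then show ?thesis by (simp add: right_diff_distrib exp_diff field_simps)
    qed
  qed (use assms in \<open>auto intro!: derivative_eq_intros\<close>)
  finally have "?I \<le> (\<integral>\<^sup>+x. indicator {exp 0..exp 1} (norm (x::'a)) \<partial>haar) *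
      ennreal (0 - (- exp (\<delta> * (ln r - 0)) / \<delta>))" .
  also have "\<dots> < \<infinity>"
    using shell_measure_finite[of "exp 0" "exp 1", where 'a='a] by (simp add: ennreal_mult_less_top)
  finally show ?thesis .
qed

section \<open>Derivatives along linear vector fields\<close>

text \<open>The operators D and L_ij of the overview are \<open>euler\<close> and
  \<open>lie (rot i j)\<close>. Treating both as derivatives along linear fields lets smoothness,
  support and commutation be settled once, for every linear A.\<close>

definition lie :: "('a::euclidean_space \<Rightarrow> 'a) \<Rightarrow> ('a \<Rightarrow> real) \<Rightarrow> 'a \<Rightarrow> real" where
  "lie A u x = pd u (A x) x"

abbreviation euler :: "('a::euclidean_space \<Rightarrow> real) \<Rightarrow> 'a \<Rightarrow> real" where
  "euler \<equiv> lie (\<lambda>x. x)"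

definition rot :: "'a::euclidean_space \<Rightarrow> 'a \<Rightarrow> 'a \<Rightarrow> 'a" where
  "rot i j x = (x \<bullet> i) *\<^sub>R j - (x \<bullet> j) *\<^sub>R i"

lemma linear_rot: "linear (rot i j)"
  by (rule linearI) (simp_all add: rot_def inner_add_left algebra_simps)

lemma linear_self: "linear (\<lambda>x::'a::real_vector. x)"
  by (rule linearI) simp_all

lemma frechet_derivative_basis_sum:
  fixes u :: "'a::euclidean_space \<Rightarrow> real"
  assumes "u differentiable (at x)"
  shows "pd u v x = (\<Sum>b\<in>Basis. (v \<bullet> b) * pd u b x)"
proof -
  interpret L: linear "frechet_derivative u (at x)" by (rule linear_frechet_derivative[OF assms])
  have "pd u v x = pd u (\<Sum>b\<in>Basis. (v \<bullet> b) *\<^sub>R b) x"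
    by (simp add: euclidean_representation)
  then show ?thesis by (simp add: L.sum L.scale)
qed

lemma lie_eq_sum:
  "u differentiable (at x) \<Longrightarrow>
    lie A u x = (\<Sum>b\<in>Basis. (A x \<bullet> b) * pd u b x)"
  unfolding lie_def by (rule frechet_derivative_basis_sum)

text \<open>Turns the coefficients of a linear field into inner products with fixed vectors, the
  form that \<open>smooth_on_inner\<close> covers.\<close>

lemma linear_inner_adjoint:
  fixes A :: "'a::euclidean_space \<Rightarrow> 'a"
  shows "linear A \<Longrightarrow> A x \<bullet> b = x \<bullet> adjoint A b"
  by (rule adjoint_works[symmetric])

lemma smooth_on_lie:
  assumes S: "open S" and A: "linear A" and u: "smooth_on S u"
  shows "smooth_on S (lie A u)"
proof (rule smooth_on_cong[OF S])
  show "smooth_on S (\<lambda>x. \<Sum>b\<in>Basis. (x \<bullet> adjoint A b) * pd u b x)"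
    by (intro smooth_on_sum smooth_on_mult smooth_on_inner smooth_on_partial u S)
qed (simp add: lie_eq_sum[OF smooth_on_differentiable[OF u]] linear_inner_adjoint[OF A])

lemma lie_mult:
  "u differentiable (at x) \<Longrightarrow> v differentiable (at x) \<Longrightarrow>
    lie A (\<lambda>x. u x * v x) x = u x * lie A v x + lie A u x * v x"
  unfolding lie_def by (rule frechet_derivative_mult_real)

lemma lie_add:
  "u differentiable (at x) \<Longrightarrow> v differentiable (at x) \<Longrightarrow>
    lie A (\<lambda>x. u x + v x) x = lie A u x + lie A v x"
  unfolding lie_def by (rule frechet_derivative_add_real)

lemma lie_cmult: "u differentiable (at x) \<Longrightarrow> lie A (\<lambda>x. c * u x) x = c * lie A u x"
  using lie_mult[of "\<lambda>_. c" x u A] by (simp add: lie_def)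

lemma lie_cong:
  assumes "open S" "x \<in> S" "\<And>y. y \<in> S \<Longrightarrow> u y = v y" "u differentiable (at x)"
  shows "lie A u x = lie A v x"
  unfolding lie_def using frechet_derivative_transform_within_open[OF assms(4,1,2,3)] by simp

lemma smooth_on_cmult: "open S \<Longrightarrow> smooth_on S u \<Longrightarrow> smooth_on S (\<lambda>x. c * u x)"
  by (intro smooth_on_mult smooth_on_const)

text \<open>Schwarz's theorem: the two mixed difference quotients coincide, and the mean value theorem
  expresses each as a mixed partial at a nearby point.\<close>

lemma mixed_difference_mvt:
  fixes u :: "'a::euclidean_space \<Rightarrow> real"
  assumes u: "smooth_on UNIV u" and b: "b \<in> Basis" and c: "c \<in> Basis" and e: "e > 0"
  obtains s t where "0 < s" "s < e" "0 < t" "t < e"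
    "u (x + e *\<^sub>R b + e *\<^sub>R c) - u (x + e *\<^sub>R b) - u (x + e *\<^sub>R c) + u x =
      e * (e * pd (pd u b) c (x + s *\<^sub>R b + t *\<^sub>R c))"
proof -
  have d: "((\<lambda>s. f (y + s *\<^sub>R v)) has_real_derivative pd f v (y + s *\<^sub>R v)) (at s)"
    if "smooth_on UNIV f" for f :: "'a \<Rightarrow> real" and y v s
  proof -
    have "(f has_derivative frechet_derivative f (at (y + s *\<^sub>R v))) (at (y + s *\<^sub>R v))"
      using smooth_on_differentiable[OF that] by (simp add: frechet_derivative_works)
    moreover have "((\<lambda>s. y + s *\<^sub>R v) has_derivative (\<lambda>h. h *\<^sub>R v)) (at s)"
      by (auto intro!: derivative_eq_intros)
    ultimately have "((\<lambda>s. f (y + s *\<^sub>R v)) has_derivative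
        (\<lambda>h. pd f (h *\<^sub>R v) (y + s *\<^sub>R v))) (at s)"
      by (metis has_derivative_compose)
    then show ?thesis
      using linear_scale[OF linear_frechet_derivative[OF smooth_on_differentiable[OF that UNIV_I]]]
      by (simp add: has_field_derivative_def mult.commute[of _ "frechet_derivative _ _ _"] mult_commute_abs)
  qed
  let ?g = "\<lambda>s. u ((x + e *\<^sub>R c) + s *\<^sub>R b) - u (x + s *\<^sub>R b)"
  have g: "(?g has_real_derivative (pd u b ((x + e *\<^sub>R c) + s *\<^sub>R b)
       - pd u b (x + s *\<^sub>R b))) (at s)" for s
    by (intro DERIV_diff d u)
  obtain s where s: "0 < s" "s < e" "?g e - ?g 0 = (e - 0) *
      (pd u b ((x + e *\<^sub>R c) + s *\<^sub>R b) - pd u b (x + s *\<^sub>R b))"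
    using MVT2[OF e, OF g] by blast
  have ub: "smooth_on UNIV (pd u b)"
    by (rule smooth_on_partial[OF u b])
  let ?k = "\<lambda>t. pd u b ((x + s *\<^sub>R b) + t *\<^sub>R c)"
  obtain t where t: "0 < t" "t < e" "?k e - ?k 0 = (e - 0) *
      pd (pd u b) c ((x + s *\<^sub>R b) + t *\<^sub>R c)"
    using MVT2[OF e, OF d[OF ub]] by blast
  have "(x + e *\<^sub>R c) + s *\<^sub>R b = (x + s *\<^sub>R b) + e *\<^sub>R c" by (simp add: algebra_simps)
  then have "?g e - ?g 0 = e * (e * pd (pd u b) c ((x + s *\<^sub>R b) + t *\<^sub>R c))"
    using s(3) t(3) by (simp only: diff_zero scaleR_zero_left add_0_right)
  then show ?thesis using s t by (intro that[of s t]) (simp_all add: algebra_simps)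
qed

lemma mixed_partials_le:
  assumes u: "smooth_on UNIV u" and b: "b \<in> Basis" and c: "c \<in> Basis"
  shows "pd (pd u b) c x \<le>
    pd (pd u c) b x"
proof (rule ccontr)
  let ?P = "\<lambda>x. pd (pd u b) c x"
  let ?Q = "\<lambda>x. pd (pd u c) b x"
  assume "\<not> ?P x \<le> ?Q x"
  then have d: "(?P x - ?Q x) / 2 > 0" by simp
  have "continuous_on UNIV ?P" "continuous_on UNIV ?Q"
    by (intro smooth_on_continuous smooth_on_partial u b c)+
  then have "isCont ?P x" "isCont ?Q x" by (auto simp: continuous_on_eq_continuous_at)
  then obtain d1 d2 where d1: "d1 > 0" "\<And>y. dist y x < d1 \<Longrightarrow> dist (?P y) (?P x) < (?P x - ?Q x) / 2"
    and d2: "d2 > 0" "\<And>y. dist y x < d2 \<Longrightarrow> dist (?Q y) (?Q x) < (?P x - ?Q x) / 2"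
    using d unfolding continuous_at_eps_delta by blast
  \<comment> \<open>The intermediate points lie within s + t < 2 e of x, hence in both continuity
    balls, where P and Q each move by less than half the gap between them.\<close>
  define e where "e = min d1 d2 / 2"
  have e: "e > 0" "2 * e \<le> d1" "2 * e \<le> d2" using d1 d2 by (auto simp: e_def)
  have near: "dist (x + s *\<^sub>R b' + t *\<^sub>R c') x < 2 * e"
    if "0 < s" "s < e" "0 < t" "t < e" "b' \<in> Basis" "c' \<in> Basis" for s t b' c'
  proof -
    have "norm (s *\<^sub>R b' + t *\<^sub>R c') \<le> s + t"
      using norm_triangle_ineq[of "s *\<^sub>R b'" "t *\<^sub>R c'"] that by simp
    then show ?thesis using that by (simp add: dist_norm add.assoc)
  qed
  obtain s t where st: "0 < s" "s < e" "0 < t" "t < e"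
    "u (x + e *\<^sub>R b + e *\<^sub>R c) - u (x + e *\<^sub>R b) - u (x + e *\<^sub>R c) + u x = e * (e * ?P (x + s *\<^sub>R b + t *\<^sub>R c))"
    using mixed_difference_mvt[OF u b c e(1)] by blast
  obtain s' t' where st': "0 < s'" "s' < e" "0 < t'" "t' < e"
    "u (x + e *\<^sub>R c + e *\<^sub>R b) - u (x + e *\<^sub>R c) - u (x + e *\<^sub>R b) + u x = e * (e * ?Q (x + s' *\<^sub>R c + t' *\<^sub>R b))"
    using mixed_difference_mvt[OF u c b e(1)] by blast
  have "x + e *\<^sub>R c + e *\<^sub>R b = x + e *\<^sub>R b + e *\<^sub>R c" by (simp add: algebra_simps)
  then have "e * (e * ?P (x + s *\<^sub>R b + t *\<^sub>R c)) = e * (e * ?Q (x + s' *\<^sub>R c + t' *\<^sub>R b))"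
    using st(5) st'(5) by (simp add: algebra_simps)
  then have "?P (x + s *\<^sub>R b + t *\<^sub>R c) = ?Q (x + s' *\<^sub>R c + t' *\<^sub>R b)" using e by simp
  moreover have "\<bar>?P (x + s *\<^sub>R b + t *\<^sub>R c) - ?P x\<bar> < (?P x - ?Q x) / 2"
    using d1(2)[of "x + s *\<^sub>R b + t *\<^sub>R c"] near[OF st(1-4) b c] e by (simp add: dist_real_def)
  moreover have "\<bar>?Q (x + s' *\<^sub>R c + t' *\<^sub>R b) - ?Q x\<bar> < (?P x - ?Q x) / 2"
    using d2(2)[of "x + s' *\<^sub>R c + t' *\<^sub>R b"] near[OF st'(1-4) c b] e by (simp add: dist_real_def)
  moreover have False if "p' = q'" "\<bar>p' - p\<bar> < (p - q) / 2" "\<bar>q' - q\<bar> < (p - q) / 2" for p q p' q' :: real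
  proof -
    have "p - p' < (p - q) / 2" "q' - q < (p - q) / 2"
      using that(2,3) unfolding abs_less_iff by simp_all
    then have "p - p' + (q' - q) < (p - q) / 2 + (p - q) / 2" by (rule add_strict_mono)
    then show False using that(1) by simp
  qed
  ultimately show False by blast
qed

lemma mixed_partials_commute:
  assumes "smooth_on UNIV u" "b \<in> Basis" "c \<in> Basis"
  shows "pd (pd u b) c x =
    pd (pd u c) b x"
  using mixed_partials_le[of u b c x] mixed_partials_le[of u c b x] assms by simp

section \<open>Second-order operators built from linear fields\<close>

definition hess :: "('a::euclidean_space \<Rightarrow> real) \<Rightarrow> 'a \<Rightarrow> 'a \<Rightarrow> 'a \<Rightarrow> real" where
  "hess u x v w = (\<Sum>b\<in>Basis. \<Sum>c\<in>Basis. (v \<bullet> b) * (w \<bullet> c) *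
     pd (pd u b) c x)"

lemma hess_commute: "smooth_on UNIV u \<Longrightarrow> hess u x v w = hess u x w v"
  unfolding hess_def
  by (subst sum.swap) (auto intro!: sum.cong simp: mixed_partials_commute mult_ac)

text \<open>The product rule splits off the derivative of the coefficient field B, which along A is
  \<open>B (A x)\<close>. As the second-order part is symmetric, two such operators commute as soon
  as the linear maps do.\<close>

lemma lie_lie:
  fixes u :: "'a::euclidean_space \<Rightarrow> real"
  assumes u: "smooth_on UNIV u" and A: "linear A" and B: "linear B"
  shows "lie A (lie B u) x = hess u x (B x) (A x) + pd u (B (A x)) x"
proof -
  have du: "u differentiable (at y)" for y using smooth_on_differentiable[OF u] by simp
  have ub: "smooth_on UNIV (pd u b)" if "b \<in> Basis" for b
    by (rule smooth_on_partial[OF u that])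
  have "(\<lambda>y. lie B u y) = (\<lambda>y. \<Sum>b\<in>Basis. (B y \<bullet> b) * pd u b y)"
    using lie_eq_sum[OF du] by blast
  moreover have "((\<lambda>y. \<Sum>b\<in>Basis. (B y \<bullet> b) * pd u b y) has_derivative
    (\<lambda>h. \<Sum>b\<in>Basis. (B x \<bullet> b) * pd (pd u b) h x
       + (B h \<bullet> b) * pd u b x)) (at x)"
  proof (rule has_derivative_sum)
    fix b :: 'a assume b: "b \<in> Basis"
    have 1: "((pd u b) has_derivative
      frechet_derivative (pd u b) (at x)) (at x)"
      using smooth_on_differentiable[OF ub[OF b]] by (simp add: frechet_derivative_works)
    have 2: "((\<lambda>y. B y \<bullet> b) has_derivative (\<lambda>h. B h \<bullet> b)) (at x)"
      using B by (intro has_derivative_inner_left bounded_linear_imp_has_derivative)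
         (simp add: linear_conv_bounded_linear)
    show "((\<lambda>y. (B y \<bullet> b) * pd u b y) has_derivative
      (\<lambda>h. (B x \<bullet> b) * pd (pd u b) h x
       + (B h \<bullet> b) * pd u b x)) (at x)"
      by (rule has_derivative_mult[OF 2 1])
  qed
  ultimately have "lie A (lie B u) x = (\<Sum>b\<in>Basis. (B x \<bullet> b) *
      pd (pd u b) (A x) x
       + (B (A x) \<bullet> b) * pd u b x)"
    unfolding lie_def[of A] by (simp add: frechet_derivative_at')
  also have "\<dots> = (\<Sum>b\<in>Basis. (B x \<bullet> b) *
      pd (pd u b) (A x) x) +
      pd u (B (A x)) x"
    by (simp add: sum.distrib frechet_derivative_basis_sum[OF du, of _ "B (A x)"])
  also have "(\<Sum>b\<in>Basis. (B x \<bullet> b) *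
      pd (pd u b) (A x) x) = hess u x (B x) (A x)"
    unfolding hess_def using smooth_on_differentiable[OF ub]
    by (auto intro!: sum.cong simp: frechet_derivative_basis_sum[of _ _ "A x"] sum_distrib_left mult_ac)
  finally show ?thesis .
qed

lemma lie_commute:
  assumes "smooth_on UNIV u" "linear A" "linear B" "\<And>x. A (B x) = B (A x)"
  shows "lie A (lie B u) = lie B (lie A u)"
  using assms hess_commute[OF assms(1)] by (auto simp: lie_lie)

text \<open>Lagrange's identity for the second derivatives: summed over ordered pairs, the
  second-order parts of the squared rotations give twice |x|^2 \<Delta> u minus twice the radial
  second derivative. The first-order parts come from \<open>rot i j (rot i j x)\<close>, which is
  minus the projection of x to the plane of i and j when i and j differ. Ordered pairs count each
  plane twice, hence the division by 2.\<close>

lemma laplacian_decomposition: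
  fixes u :: "'a::euclidean_space \<Rightarrow> real"
  assumes u: "smooth_on UNIV u"
  shows "(norm x)\<^sup>2 * laplacian u x = euler (euler u) x + (real DIM('a) - 2) * euler u x
    + (\<Sum>i\<in>Basis. \<Sum>j\<in>Basis. lie (rot i j) (lie (rot i j) u) x) / 2"
proof -
  have du: "u differentiable (at y)" for y using smooth_on_differentiable[OF u] by simp
  let ?H = "\<lambda>b c. pd (pd u b) c x"
  interpret L: linear "frechet_derivative u (at x)" by (rule linear_frechet_derivative[OF du])
  let ?n = "real DIM('a)"
  have delta: "(\<Sum>b\<in>Basis. f b * (i \<bullet> b)) = f i" if "i \<in> Basis" for f :: "'a \<Rightarrow> real" and i
    using that by (simp add: inner_Basis if_distrib cong: if_cong)
  have H: "hess u x (rot i j x) (rot i j x) =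
      (x \<bullet> i)\<^sup>2 * ?H j j + (x \<bullet> j)\<^sup>2 * ?H i i - (x \<bullet> i) * (x \<bullet> j) * (?H i j + ?H j i)"
    if ij: "i \<in> Basis" "j \<in> Basis" for i j
  proof -
    have *: "(\<Sum>c\<in>Basis. (rot i j x \<bullet> c) * f c) = (x \<bullet> i) * f j - (x \<bullet> j) * f i" for f :: "'a \<Rightarrow> real"
    proof -
      have "(\<Sum>c\<in>Basis. (rot i j x \<bullet> c) * f c) =
        (x \<bullet> i) * (\<Sum>c\<in>Basis. f c * (j \<bullet> c)) - (x \<bullet> j) * (\<Sum>c\<in>Basis. f c * (i \<bullet> c))"
        by (simp add: rot_def inner_diff_left algebra_simps sum_subtractf sum_distrib_left)
      then show ?thesis using ij by (simp add: delta)
    qed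
    have "hess u x (rot i j x) (rot i j x) = (\<Sum>b\<in>Basis. (rot i j x \<bullet> b) * (\<Sum>c\<in>Basis. (rot i j x \<bullet> c) * ?H b c))"
      by (simp add: hess_def sum_distrib_left mult_ac)
    also have "\<dots> = (x \<bullet> i) * ((x \<bullet> i) * ?H j j - (x \<bullet> j) * ?H j i) - (x \<bullet> j) * ((x \<bullet> i) * ?H i j - (x \<bullet> j) * ?H i i)"
      unfolding * ..
    finally show ?thesis by (simp add: algebra_simps power2_eq_square)
  qed
  have R: "pd u (rot i j (rot i j x)) x =
     - (if i = j then 0 else (x \<bullet> i) * pd u i x + (x \<bullet> j) * pd u j x)"
    if ij: "i \<in> Basis" "j \<in> Basis" for i j
  proof -
    have "rot i j (rot i j x) = - (if i = j then 0 else (x \<bullet> i) *\<^sub>R i + (x \<bullet> j) *\<^sub>R j)"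
      using ij by (auto simp: rot_def inner_Basis inner_diff_left)
    then show ?thesis by (auto simp: L.neg L.add L.scale L.zero L.diff)
  qed
  have sq: "(\<Sum>i\<in>Basis. (x \<bullet> i)\<^sup>2) = (norm x)\<^sup>2"
    unfolding power2_norm_eq_inner by (subst euclidean_inner) (simp add: power2_eq_square)
  have "(\<Sum>i\<in>Basis. \<Sum>j\<in>Basis. hess u x (rot i j x) (rot i j x)) =
      (\<Sum>i\<in>Basis. \<Sum>j\<in>Basis. (x \<bullet> i)\<^sup>2 * ?H j j) + (\<Sum>i\<in>Basis. \<Sum>j\<in>Basis. (x \<bullet> j)\<^sup>2 * ?H i i)
      - ((\<Sum>i\<in>Basis. \<Sum>j\<in>Basis. (x \<bullet> i) * (x \<bullet> j) * ?H i j) + (\<Sum>i\<in>Basis. \<Sum>j\<in>Basis. (x \<bullet> i) * (x \<bullet> j) * ?H j i))"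
    by (simp add: H sum.distrib sum_subtractf ring_distribs)
  also have "(\<Sum>i\<in>Basis. \<Sum>j\<in>Basis. (x \<bullet> j)\<^sup>2 * ?H i i) = (\<Sum>i\<in>Basis. \<Sum>j\<in>Basis. (x \<bullet> i)\<^sup>2 * ?H j j)"
    by (rule sum.swap)
  also have "(\<Sum>i\<in>Basis. \<Sum>j\<in>Basis. (x \<bullet> i) * (x \<bullet> j) * ?H j i) = (\<Sum>i\<in>Basis. \<Sum>j\<in>Basis. (x \<bullet> i) * (x \<bullet> j) * ?H i j)"
    by (subst sum.swap) (simp add: mult_ac)
  also have "(\<Sum>i\<in>Basis. \<Sum>j\<in>Basis. (x \<bullet> i)\<^sup>2 * ?H j j) = (norm x)\<^sup>2 * laplacian u x"
    by (simp add: laplacian_def sq[symmetric] sum_product)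
  also have "(\<Sum>i\<in>Basis. \<Sum>j\<in>Basis. (x \<bullet> i) * (x \<bullet> j) * ?H i j) = hess u x x x"
    by (simp add: hess_def)
  finally have 1: "(\<Sum>i\<in>Basis. \<Sum>j\<in>Basis. hess u x (rot i j x) (rot i j x)) =
      2 * ((norm x)\<^sup>2 * laplacian u x) - 2 * hess u x x x" by simp
  \<comment> \<open>Off the diagonal every index occurs in n - 1 pairs as first and in n - 1 pairs
    as second entry.\<close>
  have gen: "(\<Sum>i\<in>Basis. \<Sum>j\<in>Basis. g i + g j - (if i = j then 2 * g i else 0)) =
      2 * (?n - 1) * (\<Sum>i\<in>Basis. g i)" for g :: "'a \<Rightarrow> real"
    by (simp add: sum.distrib sum_subtractf sum_distrib_left[symmetric] sum_distrib_right[symmetric] algebra_simps)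
  let ?g = "\<lambda>i. (x \<bullet> i) * pd u i x"
  have "(\<Sum>i\<in>Basis. \<Sum>j\<in>Basis. pd u (rot i j (rot i j x)) x) =
     - (\<Sum>i\<in>Basis. \<Sum>j\<in>Basis. (if i = j then 0 else ?g i + ?g j))"
    by (simp add: R sum_negf)
  also have "(\<Sum>i\<in>Basis. \<Sum>j\<in>Basis. (if i = j then 0 else ?g i + ?g j)) =
      (\<Sum>i\<in>Basis. \<Sum>j\<in>Basis. ?g i + ?g j - (if i = j then 2 * ?g i else 0))"
    by (intro sum.cong) auto
  also have "\<dots> = 2 * (?n - 1) * (\<Sum>i\<in>Basis. ?g i)"
    by (rule gen)
  also have "(\<Sum>i\<in>Basis. ?g i) = euler u x"
    by (simp add: lie_eq_sum[OF du])
  finally have 2: "(\<Sum>i\<in>Basis. \<Sum>j\<in>Basis. pd u (rot i j (rot i j x)) x) =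
     - (2 * (?n - 1) * euler u x)" .
  have "(\<Sum>i\<in>Basis. \<Sum>j\<in>Basis. lie (rot i j) (lie (rot i j) u) x) =
     2 * ((norm x)\<^sup>2 * laplacian u x) - 2 * hess u x x x - 2 * (?n - 1) * euler u x"
    by (simp add: lie_lie[OF u linear_rot linear_rot] sum.distrib 1 2)
  moreover have "euler (euler u) x = hess u x x x + euler u x"
    using lie_lie[OF u linear_self linear_self, of x] by (simp add: lie_def[of _ u])
  ultimately show ?thesis by (simp add: algebra_simps)
qed

section \<open>Integration by parts\<close>

text \<open>A derivative at time 0 is enough to ask for: the group law of dilations transports it to
  every time t by restarting the flow at \<open>exp t *\<^sub>R x\<close>.\<close>

lemma integral_dilation_derivative_eq_0:
  fixes F G :: "'a::euclidean_space \<Rightarrow> real"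
  assumes der: "\<And>x. x \<noteq> 0 \<Longrightarrow> ((\<lambda>t. F (exp t *\<^sub>R x)) has_real_derivative G x) (at 0)"
    and cont: "continuous_on (- {0}) G" and F: "integrable haar F" and G: "integrable haar G"
  shows "(\<integral>x. G x \<partial>haar) = 0"
proof (rule integral_flow_derivative_eq_0[where T="\<lambda>t x. exp t *\<^sub>R x" and h=F, OF sigma_finite_haar])
  show "distr haar borel (\<lambda>x. exp t *\<^sub>R x) = (haar :: 'a measure)" for t :: real
    by (rule distr_haar_scale) simp
  show "AE x in haar. \<forall>t. ((\<lambda>t. F (exp t *\<^sub>R x)) has_real_derivative G (exp t *\<^sub>R x)) (at t)"
    using AE_haar_nonzero
  proof eventually_elim
    case (elim x)
    show ?case
    proof
      fix t
      have "((\<lambda>s. F (exp s *\<^sub>R (exp t *\<^sub>R x))) has_real_derivative G (exp t *\<^sub>R x)) (at (t + - t))"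
        using der[of "exp t *\<^sub>R x"] elim by simp
      then have "((\<lambda>s. F (exp (s + - t) *\<^sub>R (exp t *\<^sub>R x))) has_real_derivative G (exp t *\<^sub>R x)) (at t)"
        unfolding DERIV_shift .
      then show "((\<lambda>t. F (exp t *\<^sub>R x)) has_real_derivative G (exp t *\<^sub>R x)) (at t)"
        by (simp add: exp_add[symmetric])
    qed
  qed
  show "AE x in haar. \<forall>t. isCont (\<lambda>t. G (exp t *\<^sub>R x)) t"
    using AE_haar_nonzero
  proof eventually_elim
    case (elim x)
    show ?case
    proof
      fix t
      have "isCont G (exp t *\<^sub>R x)"
        using cont elim by (simp add: continuous_on_eq_continuous_at open_Compl)
      then show "isCont (\<lambda>t. G (exp t *\<^sub>R x)) t"
        by (rule isCont_o2[rotated]) (auto intro!: continuous_intros)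
    qed
  qed
qed (use F G in auto)

lemma has_real_derivative_along:
  assumes u: "u differentiable (at (\<gamma> t))"
    and \<gamma>: "(\<gamma> has_vector_derivative A (\<gamma> t)) (at t)"
  shows "((\<lambda>t. u (\<gamma> t)) has_real_derivative lie A u (\<gamma> t)) (at t)"
proof -
  have "(u has_derivative frechet_derivative u (at (\<gamma> t))) (at (\<gamma> t))"
    using u by (simp add: frechet_derivative_works)
  with \<gamma> have "((\<lambda>t. u (\<gamma> t)) has_derivative (\<lambda>h. pd u (h *\<^sub>R A (\<gamma> t)) (\<gamma> t))) (at t)"
    unfolding has_vector_derivative_def by (rule has_derivative_compose)
  then show ?thesis
    using linear_scale[OF linear_frechet_derivative[OF u]]
    by (simp add: has_field_derivative_def lie_def mult_commute_abs)
qed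

lemma has_real_derivative_dilation:
  assumes "u differentiable (at x)"
  shows "((\<lambda>t. u (exp t *\<^sub>R x)) has_real_derivative euler u x) (at 0)"
proof -
  have "((\<lambda>t. exp t *\<^sub>R x) has_vector_derivative exp 0 *\<^sub>R x) (at 0)"
    by (auto intro!: derivative_eq_intros simp: has_vector_derivative_def)
  then show ?thesis
    using has_real_derivative_along[of u "\<lambda>t. exp t *\<^sub>R x" 0 "\<lambda>x. x"] assms by simp
qed

text \<open>Rotation by the angle t in the plane of i and j, written as the identity plus a
  correction in that plane. For distinct basis vectors it is the flow of the field
  \<open>rot i j\<close>.\<close>

definition rotate_plane :: "'a::euclidean_space \<Rightarrow> 'a \<Rightarrow> real \<Rightarrow> 'a \<Rightarrow> 'a" where
  "rotate_plane i j t x = x + (cos t - 1) *\<^sub>R ((x \<bullet> i) *\<^sub>R i + (x \<bullet> j) *\<^sub>R j) + sin t *\<^sub>R rot i j x"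

lemma orthogonal_rotate_plane:
  assumes "i \<in> Basis" "j \<in> Basis" "i \<noteq> j"
  shows "orthogonal_transformation (rotate_plane i j t)"
proof -
  have "linear (rotate_plane i j t)"
    by (rule linearI) (simp_all add: rotate_plane_def rot_def inner_add_left algebra_simps)
  moreover have "norm (rotate_plane i j t x) = norm x" for x
  proof -
    have "rotate_plane i j t x \<bullet> rotate_plane i j t x =
       x \<bullet> x + ((x \<bullet> i)\<^sup>2 + (x \<bullet> j)\<^sup>2) * ((sin t)\<^sup>2 + (cos t)\<^sup>2 - 1)"
      using assms
      by (simp add: rotate_plane_def rot_def inner_add_left inner_add_right inner_diff_left inner_diff_right
          inner_Basis inner_commute[of i x] inner_commute[of j x]
          del: sin_cos_squared_add sin_cos_squared_add2 sin_cos_squared_add3)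
        (simp add: algebra_simps power2_eq_square
          del: sin_cos_squared_add sin_cos_squared_add2 sin_cos_squared_add3)
    then show ?thesis by (simp add: norm_eq_sqrt_inner)
  qed
  ultimately show ?thesis by (simp add: orthogonal_transformation)
qed

lemma rotate_plane_derivative:
  assumes "i \<in> Basis" "j \<in> Basis" "i \<noteq> j"
  shows "((\<lambda>t. rotate_plane i j t x) has_vector_derivative rot i j (rotate_plane i j t x)) (at t)"
proof -
  have "rot i j (rotate_plane i j t x) =
      (- sin t) *\<^sub>R ((x \<bullet> i) *\<^sub>R i + (x \<bullet> j) *\<^sub>R j) + cos t *\<^sub>R rot i j x"
    using assms by (simp add: rotate_plane_def rot_def inner_add_left inner_diff_left inner_Basis algebra_simps)
  moreover have "((\<lambda>t. rotate_plane i j t x) has_vector_derivative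
      (- sin t) *\<^sub>R ((x \<bullet> i) *\<^sub>R i + (x \<bullet> j) *\<^sub>R j) + cos t *\<^sub>R rot i j x) (at t)"
    unfolding rotate_plane_def
    by (auto intro!: derivative_eq_intros simp: has_vector_derivative_def scaleR_add_right scaleR_diff_right mult_ac)
  ultimately show ?thesis by simp
qed

lemma integral_rotation_derivative_eq_0:
  fixes F :: "'a::euclidean_space \<Rightarrow> real"
  assumes ij: "i \<in> Basis" "j \<in> Basis" and d: "\<And>x. x \<noteq> 0 \<Longrightarrow> F differentiable (at x)"
    and cont: "continuous_on (- {0}) (lie (rot i j) F)"
    and F: "integrable haar F" and G: "integrable haar (lie (rot i j) F)"
  shows "(\<integral>x. lie (rot i j) F x \<partial>haar) = 0"
proof (cases "i = j")
  \<comment> \<open>For i = j the map \<open>rotate_plane i j t\<close> need not be an isometry, so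
    this case is separate: the field itself is zero.\<close>
  case True
  have "AE x in haar. lie (rot i j) F x = 0"
    using AE_haar_nonzero
  proof eventually_elim
    case (elim x)
    have "rot i j x = 0" using True by (simp add: rot_def)
    then show ?case unfolding lie_def using linear_0[OF linear_frechet_derivative[OF d[OF elim]]] by simp
  qed
  then show ?thesis by (rule integral_eq_zero_AE)
next
  case False
  let ?T = "rotate_plane i j"
  have nz: "?T t x \<noteq> 0" if "x \<noteq> 0" for t x
    using orthogonal_transformation_norm[OF orthogonal_rotate_plane[OF ij False], of t x] that by auto
  show ?thesis
  proof (rule integral_flow_derivative_eq_0[where T="?T" and h=F, OF sigma_finite_haar])
    show "distr haar borel (?T t) = (haar :: 'a measure)" for t
      by (rule distr_haar_orthogonal[OF orthogonal_rotate_plane[OF ij False]])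
    show "(\<lambda>(t, x). ?T t x) \<in> borel_measurable (borel \<Otimes>\<^sub>M borel)"
      unfolding rotate_plane_def rot_def by measurable
    show "?T 0 x = x" for x by (simp add: rotate_plane_def)
    show "AE x in haar. \<forall>t. ((\<lambda>t. F (?T t x)) has_real_derivative lie (rot i j) F (?T t x)) (at t)"
      using AE_haar_nonzero
    proof eventually_elim
      case (elim x)
      show ?case
      proof
        fix t
        show "((\<lambda>t. F (?T t x)) has_real_derivative lie (rot i j) F (?T t x)) (at t)"
          using has_real_derivative_along[of F "\<lambda>t. ?T t x" t "rot i j"]
            d[OF nz[OF elim]] rotate_plane_derivative[OF ij False] by blast
      qed
    qed
    show "AE x in haar. \<forall>t. isCont (\<lambda>t. lie (rot i j) F (?T t x)) t"
      using AE_haar_nonzero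
    proof eventually_elim
      case (elim x)
      show ?case
      proof
        fix t
        have "isCont (lie (rot i j) F) (?T t x)"
          using cont nz[OF elim] by (simp add: continuous_on_eq_continuous_at open_Compl)
        moreover have "isCont (\<lambda>t. ?T t x) t"
          using rotate_plane_derivative[OF ij False, of x t] has_vector_derivative_continuous by blast
        ultimately show "isCont (\<lambda>t. lie (rot i j) F (?T t x)) t"
          by (rule isCont_o2[rotated])
      qed
    qed
  qed (use F G in auto)
qed

section \<open>Integrability at the origin and admissible functions\<close>

lemma integrable_haar_bound:
  fixes F :: "'a::euclidean_space \<Rightarrow> real"
  assumes [measurable]: "F \<in> borel_measurable borel" and "\<delta> > 0"
    and b: "\<And>x. x \<noteq> 0 \<Longrightarrow> norm x \<le> r \<Longrightarrow> \<bar>F x\<bar> \<le> C * norm x powr \<delta>"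
    and z: "\<And>x. r < norm x \<Longrightarrow> F x = 0"
  shows "integrable haar F"
proof (rule integrableI_bounded)
  show "F \<in> borel_measurable haar" by measurable
  have "(\<integral>\<^sup>+x. ennreal (norm (F x)) \<partial>haar) \<le>
      (\<integral>\<^sup>+x. ennreal \<bar>C\<bar> * (ennreal (norm x powr \<delta>) * indicator (cball (0::'a) r) x) \<partial>haar)"
  proof (rule nn_integral_mono_AE, rule AE_mp[OF AE_haar_nonzero], rule AE_I2, rule impI)
    fix x :: 'a assume x: "x \<noteq> 0"
    show "ennreal (norm (F x)) \<le> ennreal \<bar>C\<bar> * (ennreal (norm x powr \<delta>) * indicator (cball 0 r) x)"
    proof (cases "norm x \<le> r")
      case True
      have "\<bar>F x\<bar> \<le> \<bar>C\<bar> * norm x powr \<delta>"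
        using b[OF x True] mult_right_mono[OF abs_ge_self[of C], of "norm x powr \<delta>"] by auto
      with True show ?thesis by (simp add: ennreal_mult'[symmetric] ennreal_leI)
    qed (simp add: z)
  qed
  also have "\<dots> = ennreal \<bar>C\<bar> * (\<integral>\<^sup>+x. ennreal (norm x powr \<delta>) * indicator (cball (0::'a) r) x \<partial>haar)"
    by (rule nn_integral_cmult) (auto intro!: borel_measurable_times_ennreal borel_measurable_indicator)
  also have "\<dots> < \<infinity>"
    using nn_integral_haar_powr_finite[OF \<open>\<delta> > 0\<close>, of r, where 'a='a] by (simp add: ennreal_mult_less_top)
  finally show "(\<integral>\<^sup>+x. ennreal (norm (F x)) \<partial>haar) < \<infinity>" .
qed

text \<open>The last condition makes \<open>h * norm powr (2 * a)\<close> integrable against \<open>haar\<close> at the origin, for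
  \<open>0 \<le> a\<close>.\<close>

definition adm :: "real \<Rightarrow> real \<Rightarrow> ('a::euclidean_space \<Rightarrow> real) \<Rightarrow> bool" where
  "adm a r h \<longleftrightarrow> smooth_on UNIV h \<and> (\<forall>x. r < norm x \<longrightarrow> h x = 0) \<and> (0 < a \<or> h 0 = 0)"

text \<open>The product of an \<open>adm\<close> and a \<open>test\<close> function is again
  \<open>adm\<close>, so in a pairing only one of the two factors has to decay at the
  origin.\<close>

definition test :: "real \<Rightarrow> ('a::euclidean_space \<Rightarrow> real) \<Rightarrow> bool" where
  "test r h \<longleftrightarrow> smooth_on UNIV h \<and> (\<forall>x. r < norm x \<longrightarrow> h x = 0)"

lemma adm_test: "adm a r h \<Longrightarrow> test r h"
  by (simp add: adm_def test_def)

lemma test_smooth: "test r h \<Longrightarrow> smooth_on UNIV h" by (simp add: test_def)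

lemma test_differentiable: "test r h \<Longrightarrow> h differentiable (at x)"
  using smooth_on_differentiable[OF test_smooth] by auto

lemma lie_eq_0_outside:
  assumes "\<And>x. r < norm x \<Longrightarrow> h x = 0" "r < norm x"
  shows "lie A h x = 0"
proof -
  have "lie A (\<lambda>_. 0) x = lie A h x"
    by (rule lie_cong[of "{x. r < norm x}"]) (use assms in \<open>auto intro: open_Collect_less continuous_intros\<close>)
  then show ?thesis by (simp add: lie_def)
qed

lemma test_lie: "linear A \<Longrightarrow> test r h \<Longrightarrow> test r (lie A h)"
  unfolding test_def using smooth_on_lie[of UNIV A h] lie_eq_0_outside[of r h] by auto

text \<open>A linear field vanishes at the origin, so one derivative along it makes any test
  function admissible, even for a = 0.\<close>

lemma adm_lie:
  assumes A: "linear A" and h: "test r h" shows "adm a r (lie A h)"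
proof -
  have "lie A h 0 = 0"
    using linear_0[OF A] linear_0[OF linear_frechet_derivative[OF test_differentiable[OF h, of 0]]]
    by (simp add: lie_def)
  then show ?thesis using test_lie[OF A h] by (simp add: adm_def test_def)
qed

lemma test_mult: "test r f \<Longrightarrow> test r g \<Longrightarrow> test r (\<lambda>x. f x * g x)"
  by (auto simp: test_def intro: smooth_on_mult)

lemma adm_mult: "adm a r f \<Longrightarrow> test r g \<Longrightarrow> adm a r (\<lambda>x. f x * g x)"
  by (auto simp: adm_def test_def intro: smooth_on_mult)

lemma adm_add: "adm a r f \<Longrightarrow> adm a r g \<Longrightarrow> adm a r (\<lambda>x. f x + g x)"
  by (auto simp: adm_def intro: smooth_on_add)

lemma adm_cmult: "adm a r f \<Longrightarrow> adm a r (\<lambda>x. c * f x)"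
  by (auto simp: adm_def intro: smooth_on_cmult)

lemma adm_sum: "(\<And>i. i \<in> I \<Longrightarrow> adm a r (f i)) \<Longrightarrow> adm a r (\<lambda>x. \<Sum>i\<in>I. f i x)"
  by (cases "0 < a") (auto simp: adm_def intro!: smooth_on_sum sum.neutral)

text \<open>For \<open>a = 0\<close> the factor \<open>a\<close> makes up for the missing decay at the origin.\<close>

lemma adm_cmult_test: "test r f \<Longrightarrow> 0 \<le> a \<Longrightarrow> adm a r (\<lambda>x. a * c * f x)"
  by (auto simp: adm_def test_def intro: smooth_on_cmult)

lemma test_bounded:
  fixes h :: "'a::euclidean_space \<Rightarrow> real"
  assumes c: "continuous_on UNIV h" and z: "\<And>x. r < norm x \<Longrightarrow> h x = 0"
  obtains C where "C \<ge> 0" "\<And>x. \<bar>h x\<bar> \<le> C"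
proof -
  have "compact (h ` cball 0 r)"
    by (intro compact_continuous_image continuous_on_subset[OF c]) auto
  then obtain C where C: "C > 0" "\<And>y. y \<in> h ` cball 0 r \<Longrightarrow> norm y \<le> C"
    using compact_imp_bounded bounded_pos by metis
  have "\<bar>h x\<bar> \<le> C" for x
    using C z[of x] by (cases "norm x \<le> r") auto
  with C show ?thesis by (intro that[of C]) auto
qed

lemma test_lipschitz:
  assumes h: "test r h"
  obtains C where "C \<ge> 0" "\<And>x. \<bar>h x - h 0\<bar> \<le> C * norm x"
proof -
  have d: "h differentiable (at x)" for x by (rule test_differentiable[OF h])
  have "\<exists>C\<ge>0. \<forall>x. \<bar>pd h b x\<bar> \<le> C" if b: "b \<in> Basis" for b
  proof -
    have "continuous_on UNIV (pd h b)"
      by (intro smooth_on_continuous smooth_on_partial test_smooth[OF h] b)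
    moreover have "pd h b x = 0" if "r < norm x" for x
      using lie_eq_0_outside[of r h x "\<lambda>_. b"] h that by (simp add: lie_def test_def)
    ultimately show ?thesis
      by (rule test_bounded[of "pd h b" r]) blast+
  qed
  then have "\<forall>b\<in>Basis. \<exists>C. C \<ge> 0 \<and> (\<forall>x. \<bar>pd h b x\<bar> \<le> C)" by blast
  then obtain C where C': "\<forall>b\<in>Basis. C b \<ge> 0 \<and> (\<forall>x. \<bar>pd h b x\<bar> \<le> C b)"
    by (rule bchoice[THEN exE])
  then have C: "\<And>b. b \<in> Basis \<Longrightarrow> C b \<ge> 0"
    "\<And>b x. b \<in> Basis \<Longrightarrow> \<bar>pd h b x\<bar> \<le> C b" by auto
  let ?C = "\<Sum>b\<in>Basis. C b"
  have "\<bar>pd h v x\<bar> \<le> ?C * norm v" for x v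
  proof -
    have "\<bar>pd h v x\<bar> \<le> (\<Sum>b\<in>Basis. \<bar>(v \<bullet> b) * pd h b x\<bar>)"
      unfolding frechet_derivative_basis_sum[OF d, of x v] by (rule sum_abs)
    also have "\<dots> \<le> (\<Sum>b\<in>Basis. norm v * C b)"
      unfolding abs_mult by (intro sum_mono mult_mono C Basis_le_norm) auto
    finally show ?thesis by (simp add: sum_distrib_left mult.commute)
  qed
  then have "onorm (frechet_derivative h (at x)) \<le> ?C" for x
    by (intro onorm_le) simp
  then have "norm (h x - h 0) \<le> ?C * norm (x - 0)" for x
    using d by (intro differentiable_bound[of UNIV h "\<lambda>x. frechet_derivative h (at x)"])
      (auto simp: frechet_derivative_works)
  then show ?thesis using C by (intro that[of ?C]) (auto intro: sum_nonneg)
qed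

lemma borel_measurable_continuous_nonzero:
  fixes F :: "'a::euclidean_space \<Rightarrow> real"
  assumes "continuous_on (- {0}) F"
  shows "F \<in> borel_measurable borel"
proof -
  have "(\<lambda>x. if x \<in> - {0} then F x else F 0) \<in> borel_measurable borel"
    by (intro borel_measurable_continuous_on_if assms) auto
  moreover have "(\<lambda>x. if x \<in> - {0} then F x else F 0) = F"
    by auto
  ultimately show ?thesis by simp
qed

lemma measurable_haar: "borel_measurable haar = borel_measurable borel"
  by (rule measurable_cong_sets) simp_all

text \<open>Any positive power of |x| as a bound makes a compactly supported function integrable
  against \<open>haar\<close>. For a > 0 the weight supplies the power 2 a; for a = 0 the Lipschitz
  bound and \<open>h 0 = 0\<close> supply the power 1.\<close>

lemma integrable_adm:
  assumes "adm a r h" and a: "0 \<le> a"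
  shows "integrable haar (\<lambda>x. h x * norm x powr (2 * a))"
proof -
  have h: "test r h" using assms adm_test by blast
  have cont: "continuous_on UNIV h" by (rule smooth_on_continuous[OF test_smooth[OF h]])
  then have [measurable]: "h \<in> borel_measurable borel" by (rule borel_measurable_continuous_onI)
  have z: "h x = 0" if "r < norm x" for x using h that by (simp add: test_def)
  show ?thesis
  proof (cases "a = 0")
    case True
    then have h0: "h 0 = 0" using assms by (simp add: adm_def)
    obtain C where "C \<ge> 0" "\<And>x. \<bar>h x - h 0\<bar> \<le> C * norm x" using test_lipschitz[OF h] by blast
    then show ?thesis using True h0
      by (intro integrable_haar_bound[of _ 1 r C]) (auto simp: z)
  next
    case False
    obtain C where C: "C \<ge> 0" "\<And>x. \<bar>h x\<bar> \<le> C" using test_bounded[OF cont z] by metis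
    then show ?thesis using False a
      by (intro integrable_haar_bound[of _ "2 * a" r C]) (auto simp: z abs_mult mult_right_mono)
  qed
qed

lemma lie_norm_powr:
  assumes "x \<noteq> 0"
  shows "euler (\<lambda>x::'a::euclidean_space. norm x powr \<alpha>) x = \<alpha> * norm x powr \<alpha>"
    and "lie (rot i j) (\<lambda>x::'a. norm x powr \<alpha>) x = 0"
proof -
  have "norm x powr (\<alpha> - 2) * (x \<bullet> x) = norm x powr \<alpha>"
    using assms powr_diff[of "norm x" \<alpha> 2]
    by (simp add: powr_realpow[of _ 2, simplified] power2_norm_eq_inner)
  then show "euler (\<lambda>x::'a. norm x powr \<alpha>) x = \<alpha> * norm x powr \<alpha>"
    by (simp add: lie_def frechet_derivative_at'[OF has_derivative_norm_powr[OF assms]])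
  show "lie (rot i j) (\<lambda>x::'a. norm x powr \<alpha>) x = 0"
    by (simp add: lie_def frechet_derivative_at'[OF has_derivative_norm_powr[OF assms]] rot_def
        inner_diff_right inner_commute)
qed

text \<open>Away from 0 the weight is an eigenfunction of \<open>euler\<close> with eigenvalue 2 a
  and is annihilated by rotations. Both integrands are therefore derivatives of h times the weight
  along flows that preserve \<open>haar\<close>.\<close>

lemma integral_lie_adm:
  fixes h :: "'a::euclidean_space \<Rightarrow> real"
  assumes h: "adm a r h" and a: "0 \<le> a"
  shows "(\<integral>x. (euler h x + 2 * a * h x) * norm x powr (2 * a) \<partial>haar) = 0"
    and "i \<in> Basis \<Longrightarrow> j \<in> Basis \<Longrightarrow> (\<integral>x. lie (rot i j) h x * norm x powr (2 * a) \<partial>haar) = 0"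
proof -
  have t: "test r h" using h adm_test by blast
  let ?F = "\<lambda>x. h x * norm x powr (2 * a)"
  have dp: "(\<lambda>x::'a. norm x powr (2 * a)) differentiable (at x)" if "x \<noteq> 0" for x
    using has_derivative_norm_powr[OF that] differentiableI by blast
  have dF: "?F differentiable (at x)" if "x \<noteq> 0" for x
    using test_differentiable[OF t] dp[OF that] by simp
  have eF: "euler ?F x = (euler h x + 2 * a * h x) * norm x powr (2 * a)" if "x \<noteq> 0" for x
    using lie_mult[OF test_differentiable[OF t] dp[OF that], of "\<lambda>x. x"] lie_norm_powr(1)[OF that]
    by (simp add: algebra_simps)
  have intF: "integrable haar ?F" by (rule integrable_adm[OF h a])
  have co: "continuous_on UNIV (lie A h)" if "linear A" for A
    using test_lie[OF that t] by (intro smooth_on_continuous[OF test_smooth])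
  have coh: "continuous_on UNIV h" using t by (intro smooth_on_continuous[OF test_smooth])
  show "(\<integral>x. (euler h x + 2 * a * h x) * norm x powr (2 * a) \<partial>haar) = 0"
  proof (rule integral_dilation_derivative_eq_0[of ?F, OF _ _ intF])
    show "((\<lambda>t. ?F (exp t *\<^sub>R x)) has_real_derivative (euler h x + 2 * a * h x) * norm x powr (2 * a)) (at 0)"
      if "x \<noteq> 0" for x
      using has_real_derivative_dilation[OF dF[OF that]] unfolding eF[OF that] .
    show "continuous_on (- {0}) (\<lambda>x. (euler h x + 2 * a * h x) * norm x powr (2 * a))"
      using co[OF linear_self] coh
      by (auto intro!: continuous_intros intro: continuous_on_subset)
    have "adm a r (\<lambda>x. euler h x + 2 * a * h x)"
      by (intro adm_add adm_lie linear_self t adm_cmult h)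
    then show "integrable haar (\<lambda>x. (euler h x + 2 * a * h x) * norm x powr (2 * a))"
      by (rule integrable_adm[OF _ a])
  qed
  assume ij: "i \<in> Basis" "j \<in> Basis"
  have rF: "lie (rot i j) ?F x = lie (rot i j) h x * norm x powr (2 * a)" if "x \<noteq> 0" for x
    using lie_mult[OF test_differentiable[OF t] dp[OF that], of "rot i j"] lie_norm_powr(2)[OF that]
    by simp
  have G: "integrable haar (\<lambda>x. lie (rot i j) h x * norm x powr (2 * a))"
    by (rule integrable_adm[OF adm_lie[OF linear_rot t] a])
  have cG: "continuous_on (- {0}) (\<lambda>x. lie (rot i j) h x * norm x powr (2 * a))"
    using co[OF linear_rot]
    by (auto intro!: continuous_intros intro: continuous_on_subset)
  have cG': "continuous_on (- {0}) (lie (rot i j) ?F)"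
    using cG by (rule continuous_on_eq) (simp add: rF)
  have mG: "lie (rot i j) ?F \<in> borel_measurable haar"
    using borel_measurable_continuous_nonzero[OF cG'] by (simp add: measurable_haar)
  have eq: "AE x in haar. lie (rot i j) h x * norm x powr (2 * a) = lie (rot i j) ?F x"
    using AE_haar_nonzero by eventually_elim (simp add: rF)
  have "(\<integral>x. lie (rot i j) h x * norm x powr (2 * a) \<partial>haar) = (\<integral>x. lie (rot i j) ?F x \<partial>haar)"
    using eq by (intro integral_cong_AE borel_measurable_integrable[OF G] mG)
  also have "\<dots> = 0"
  proof (rule integral_rotation_derivative_eq_0[OF ij dF cG' intF])
    show "integrable haar (lie (rot i j) ?F)"
      using G integrable_cong_AE[OF borel_measurable_integrable[OF G] mG eq] by blast
  qed
  finally show "(\<integral>x. lie (rot i j) h x * norm x powr (2 * a) \<partial>haar) = 0" .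
qed

section \<open>The Rellich integral in spherical form\<close>

lemma test_add: "test r f \<Longrightarrow> test r g \<Longrightarrow> test r (\<lambda>x. f x + g x)"
  by (simp add: test_def smooth_on_add)

lemma test_cmult: "test r f \<Longrightarrow> test r (\<lambda>x. c * f x)"
  by (simp add: test_def smooth_on_cmult)

definition ip :: "real \<Rightarrow> ('a::euclidean_space \<Rightarrow> real) \<Rightarrow> ('a \<Rightarrow> real) \<Rightarrow> real" where
  "ip a f g = (\<integral>x. f x * g x * norm x powr (2 * a) \<partial>haar)"

definition shifted_euler :: "real \<Rightarrow> ('a::euclidean_space \<Rightarrow> real) \<Rightarrow> 'a \<Rightarrow> real" where
  "shifted_euler a f x = euler f x + a * f x"

text \<open>The squared norm with values in [0, \<infinity>]: for a = 0 and u 0 \<noteq> 0 it is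
  infinite, a case that the real-valued \<open>ip\<close> cannot express.
  \<open>nn_integral_ip\<close> connects the two on admissible functions.\<close>

abbreviation wsq :: "real \<Rightarrow> ('a::euclidean_space \<Rightarrow> real) \<Rightarrow> ennreal" where
  "wsq a h \<equiv> \<integral>\<^sup>+x. ennreal ((h x)\<^sup>2 * norm x powr (2 * a)) \<partial>haar"

abbreviation wpot :: "real \<Rightarrow> (real \<Rightarrow> real) \<Rightarrow> ('a::euclidean_space \<Rightarrow> real) \<Rightarrow> ennreal" where
  "wpot a W h \<equiv>
    \<integral>\<^sup>+x. ennreal ((norm x)\<^sup>2 * W (norm x) * (h x)\<^sup>2 * norm x powr (2 * a)) \<partial>haar"

lemma ip_commute: "ip a f g = ip a g f"
  by (simp add: ip_def mult.commute)

lemma ip_integrable: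
  "adm a r f \<Longrightarrow> test r g \<Longrightarrow> 0 \<le> a \<Longrightarrow> integrable haar (\<lambda>x. f x * g x * norm x powr (2 * a))"
  by (rule integrable_adm[OF adm_mult])

lemma ip_add_right:
  assumes "adm a r f" "test r g" "test r h" "0 \<le> a"
  shows "ip a f (\<lambda>x. g x + h x) = ip a f g + ip a f h"
  using ip_integrable[OF assms(1,2,4)] ip_integrable[OF assms(1,3,4)]
  by (simp add: ip_def algebra_simps)

lemma ip_cmult_right: "ip a f (\<lambda>x. c * g x) = c * ip a f g"
proof -
  have "(\<lambda>x. f x * (c * g x) * norm x powr (2 * a)) = (\<lambda>x. c * (f x * g x * norm x powr (2 * a)))"
    by (simp add: mult_ac)
  then show ?thesis by (simp add: ip_def)
qed

lemma ip_sum_right: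
  assumes "adm a r f" "\<And>i. i \<in> I \<Longrightarrow> test r (g i)" "0 \<le> a"
  shows "ip a f (\<lambda>x. \<Sum>i\<in>I. g i x) = (\<Sum>i\<in>I. ip a f (g i))"
  unfolding ip_def using ip_integrable[OF assms(1) assms(2) assms(3)]
  by (subst Bochner_Integration.integral_sum[symmetric]) (auto simp: sum_distrib_left sum_distrib_right)

lemma test_shifted_euler: "test r f \<Longrightarrow> test r (shifted_euler a f)"
  unfolding shifted_euler_def by (intro test_add test_cmult test_lie linear_self)

lemma adm_shifted_euler:
  assumes "test r f" "0 \<le> a" shows "adm a r (shifted_euler a f)"
  unfolding shifted_euler_def
  using adm_add[OF adm_lie[OF linear_self assms(1)] adm_cmult_test[OF assms, of 1]] by simp

text \<open>The integral of (D + 2 a)(f g) against the weight is zero, and the shift by a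
  distributes the term 2 a f g evenly over the two factors.\<close>

lemma shifted_euler_skew:
  assumes f: "adm a r f" and g: "test r g" and a: "0 \<le> a"
  shows "ip a (shifted_euler a f) g = - ip a f (shifted_euler a g)"
proof -
  have t: "test r f" using f adm_test by blast
  have i1: "integrable haar (\<lambda>x. shifted_euler a f x * g x * norm x powr (2 * a))"
    by (rule ip_integrable[OF adm_shifted_euler[OF t a] g a])
  have i2: "integrable haar (\<lambda>x. f x * shifted_euler a g x * norm x powr (2 * a))"
    by (rule ip_integrable[OF f test_shifted_euler[OF g] a])
  have "0 = (\<integral>x. (euler (\<lambda>x. f x * g x) x + 2 * a * (f x * g x)) * norm x powr (2 * a) \<partial>haar)"
    using integral_lie_adm(1)[OF adm_mult[OF f g] a] by simp
  also have "\<dots> = (\<integral>x. shifted_euler a f x * g x * norm x powr (2 * a)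
      + f x * shifted_euler a g x * norm x powr (2 * a) \<partial>haar)"
    by (simp add: lie_mult[OF test_differentiable[OF t] test_differentiable[OF g]] shifted_euler_def algebra_simps)
  also have "\<dots> = ip a (shifted_euler a f) g + ip a f (shifted_euler a g)"
    using i1 i2 by (simp add: ip_def)
  finally show ?thesis by simp
qed

lemma rot_skew:
  assumes f: "adm a r f" and g: "test r g" and a: "0 \<le> a" and ij: "i \<in> Basis" "j \<in> Basis"
  shows "ip a (lie (rot i j) f) g = - ip a f (lie (rot i j) g)"
proof -
  have t: "test r f" using f adm_test by blast
  have i1: "integrable haar (\<lambda>x. lie (rot i j) f x * g x * norm x powr (2 * a))"
    by (rule ip_integrable[OF adm_lie[OF linear_rot t] g a])
  have i2: "integrable haar (\<lambda>x. f x * lie (rot i j) g x * norm x powr (2 * a))"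
    by (rule ip_integrable[OF f test_lie[OF linear_rot g] a])
  have "0 = (\<integral>x. lie (rot i j) (\<lambda>x. f x * g x) x * norm x powr (2 * a) \<partial>haar)"
    using integral_lie_adm(2)[OF adm_mult[OF f g] a ij] by simp
  also have "\<dots> = (\<integral>x. lie (rot i j) f x * g x * norm x powr (2 * a)
      + f x * lie (rot i j) g x * norm x powr (2 * a) \<partial>haar)"
    by (simp add: lie_mult[OF test_differentiable[OF t] test_differentiable[OF g]] algebra_simps)
  also have "\<dots> = ip a (lie (rot i j) f) g + ip a f (lie (rot i j) g)"
    using i1 i2 by (simp add: ip_def)
  finally show ?thesis by simp
qed

lemma shifted_euler_cmult:
  assumes "test r f" shows "shifted_euler a (\<lambda>x. c * f x) = (\<lambda>x. c * shifted_euler a f x)"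
  using lie_cmult[OF test_differentiable[OF assms]] by (auto simp: shifted_euler_def algebra_simps)

lemma rot_shifted_euler_commute:
  assumes f: "test r f"
  shows "lie (rot i j) (shifted_euler a f) = shifted_euler a (lie (rot i j) f)"
proof
  fix x
  have "lie (rot i j) (shifted_euler a f) x = lie (rot i j) (euler f) x + lie (rot i j) (\<lambda>x. a * f x) x"
    unfolding shifted_euler_def
    by (rule lie_add[OF test_differentiable[OF test_lie[OF linear_self f]] test_differentiable[OF test_cmult[OF f]]])
  then show "lie (rot i j) (shifted_euler a f) x = shifted_euler a (lie (rot i j) f) x"
    using lie_commute[OF test_smooth[OF f] linear_rot[of i j] linear_self]
    by (simp add: lie_cmult[OF test_differentiable[OF f]] shifted_euler_def)
qed

definition spherical_laplacian :: "('a::euclidean_space \<Rightarrow> real) \<Rightarrow> 'a \<Rightarrow> real" where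
  "spherical_laplacian u x = (\<Sum>i\<in>Basis. \<Sum>j\<in>Basis. lie (rot i j) (lie (rot i j) u) x) / 2"

definition angular_part :: "real \<Rightarrow> real \<Rightarrow> ('a::euclidean_space \<Rightarrow> real) \<Rightarrow> 'a \<Rightarrow> real" where
  "angular_part a p u x = a * p * u x - spherical_laplacian u x"

lemma test_lie_rot2: "test r u \<Longrightarrow> test r (lie (rot i j) (lie (rot i j) u))"
  by (intro test_lie linear_rot)

lemma adm_spherical_laplacian: "test r u \<Longrightarrow> adm a r (spherical_laplacian u)"
proof -
  assume u: "test r u"
  have "spherical_laplacian u = (\<lambda>x. (1/2) * (\<Sum>i\<in>Basis. \<Sum>j\<in>Basis. lie (rot i j) (lie (rot i j) u) x))"
    by (auto simp: spherical_laplacian_def)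
  then show ?thesis
    by (simp only:) (intro adm_cmult adm_sum adm_lie linear_rot test_lie u)
qed

lemma adm_angular_part:
  assumes "test r u" "0 \<le> a" shows "adm a r (angular_part a p u)"
proof -
  have "angular_part a p u = (\<lambda>x. a * p * u x + (-1) * spherical_laplacian u x)"
    by (auto simp: angular_part_def)
  then show ?thesis
    using adm_add[OF adm_cmult_test[OF assms, of p] adm_cmult[OF adm_spherical_laplacian[OF assms(1)], of a "-1"]]
    by simp
qed

text \<open>One rotation of each squared pair is moved onto f. This yields the bilinear form of a p
  - \<Lambda>, with the factor 1/2 from the ordered pairs.\<close>

lemma ip_angular_part:
  assumes f: "adm a r f" and u: "test r u" and a: "0 \<le> a"
  shows "ip a f (angular_part a p u) = a * p * ip a f u
     + (\<Sum>i\<in>Basis. \<Sum>j\<in>Basis. ip a (lie (rot i j) f) (lie (rot i j) u)) / 2"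
proof -
  have eq: "angular_part a p u = (\<lambda>x. (a * p) * u x +
      (- 1 / 2) * (\<Sum>i\<in>Basis. \<Sum>j\<in>Basis. lie (rot i j) (lie (rot i j) u) x))"
    by (auto simp: angular_part_def spherical_laplacian_def)
  have t2: "test r (\<lambda>x. \<Sum>j\<in>Basis. lie (rot i j) (lie (rot i j) u) x)" for i :: 'a
    by (rule adm_test[of 1], intro adm_sum adm_lie linear_rot test_lie u)
  have t3: "test r (\<lambda>x. \<Sum>i\<in>Basis. \<Sum>j\<in>Basis. lie (rot i j) (lie (rot i j) u) x)"
    by (rule adm_test[of 1], intro adm_sum adm_lie linear_rot test_lie u)
  have "ip a f (angular_part a p u) = a * p * ip a f u +
      (- 1 / 2) * (\<Sum>i\<in>Basis. \<Sum>j\<in>Basis. ip a f (lie (rot i j) (lie (rot i j) u)))"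
    unfolding eq
    by (subst ip_add_right[OF f test_cmult[OF u] test_cmult[OF t3] a])
       (simp only: ip_cmult_right ip_sum_right[OF f t2 a] ip_sum_right[OF f test_lie_rot2[OF u] a])
  also have "(\<Sum>i\<in>Basis. \<Sum>j\<in>Basis. ip a f (lie (rot i j) (lie (rot i j) u))) =
      - (\<Sum>i\<in>Basis. \<Sum>j\<in>Basis. ip a (lie (rot i j) f) (lie (rot i j) u))"
    by (simp add: rot_skew[OF f test_lie[OF linear_rot u] a] sum_negf)
  finally show ?thesis by simp
qed

lemma shifted_euler_ip_self:
  assumes "adm a r f" "0 \<le> a" shows "ip a (shifted_euler a f) f = 0"
  using shifted_euler_skew[OF assms(1) adm_test[OF assms(1)] assms(2)] ip_commute[of a f] by simp

lemma ip_nonneg: "0 \<le> ip a f f"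
  unfolding ip_def by (rule integral_nonneg_AE) simp

lemma ip_square_sum3:
  assumes f: "adm a r f" and g: "adm a r g" and h: "adm a r h" and a: "0 \<le> a"
  shows "ip a (\<lambda>x. f x + c * g x - h x) (\<lambda>x. f x + c * g x - h x) =
    ip a f f + c\<^sup>2 * ip a g g + ip a h h + 2 * c * ip a f g - 2 * ip a f h - 2 * c * ip a g h"
proof -
  note t = adm_test[OF f] adm_test[OF g] adm_test[OF h]
  let ?w = "\<lambda>x::'a. norm x powr (2 * a)"
  note i = ip_integrable[OF f t(1) a] ip_integrable[OF g t(2) a] ip_integrable[OF h t(3) a]
    ip_integrable[OF f t(2) a] ip_integrable[OF f t(3) a] ip_integrable[OF g t(3) a]
  have "ip a (\<lambda>x. f x + c * g x - h x) (\<lambda>x. f x + c * g x - h x) =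
    (\<integral>x. f x * f x * ?w x + c\<^sup>2 * (g x * g x * ?w x) + h x * h x * ?w x + 2 * c * (f x * g x * ?w x)
       - 2 * (f x * h x * ?w x) - 2 * c * (g x * h x * ?w x) \<partial>haar)"
    unfolding ip_def by (intro Bochner_Integration.integral_cong refl) (simp add: algebra_simps power2_eq_square)
  also have "\<dots> = ip a f f + c\<^sup>2 * ip a g g + ip a h h + 2 * c * ip a f g - 2 * ip a f h - 2 * c * ip a g h"
    using i by (simp add: ip_def)
  finally show ?thesis .
qed

lemma scaled_laplacian_eq:
  fixes u :: "'a::euclidean_space \<Rightarrow> real"
  assumes u: "test r u" and ap: "a + p = real DIM('a) - 2"
  shows "(norm x)\<^sup>2 * laplacian u x =
    shifted_euler a (shifted_euler a u) x + (p - a) * shifted_euler a u x - angular_part a p u x"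
proof -
  have "euler (\<lambda>x. euler u x + a * u x) x = euler (euler u) x + a * euler u x"
    using lie_add[OF test_differentiable[OF test_lie[OF linear_self u]] test_differentiable[OF test_cmult[OF u]]]
      lie_cmult[OF test_differentiable[OF u]] by metis
  moreover have "(norm x)\<^sup>2 * laplacian u x = euler (euler u) x + (a + p) * euler u x + spherical_laplacian u x"
    using laplacian_decomposition[OF test_smooth[OF u]] unfolding ap spherical_laplacian_def by simp
  ultimately show ?thesis
    unfolding shifted_euler_def[abs_def] angular_part_def by (simp add: algebra_simps)
qed

text \<open>Put X = E^2 u, Y = E u, Z = (a p - \<Lambda>) u. Since E is skew and commutes with the
  rotations, X is orthogonal to Y and Y to Z. The only surviving cross term is -2 <X, Z>, equal to 2
  a p times the squared norm of Y plus the squared norms of all L_ij Y.\<close>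

lemma rellich_identity:
  fixes u :: "'a::euclidean_space \<Rightarrow> real"
  assumes u: "test r u" and a: "0 \<le> a" and ap: "a + p = real DIM('a) - 2"
  defines "L \<equiv> \<lambda>x. (norm x)\<^sup>2 * laplacian u x"
  shows "ip a L L = ip a (shifted_euler a (euler u)) (shifted_euler a (euler u))
    + p\<^sup>2 * ip a (shifted_euler a u) (shifted_euler a u)
    + (\<Sum>i\<in>Basis. \<Sum>j\<in>Basis. ip a (lie (rot i j) (shifted_euler a u)) (lie (rot i j) (shifted_euler a u)))
    + ip a (angular_part a p u) (angular_part a p u)"
proof -
  let ?Y = "shifted_euler a u"
  let ?X = "shifted_euler a ?Y"
  let ?Z = "angular_part a p u"
  let ?S = "\<Sum>i\<in>Basis. \<Sum>j\<in>Basis. ip a (lie (rot i j) ?Y) (lie (rot i j) ?Y)"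
  have Y: "adm a r ?Y" by (rule adm_shifted_euler[OF u a])
  have X: "adm a r ?X" by (rule adm_shifted_euler[OF adm_test[OF Y] a])
  have Z: "adm a r ?Z" by (rule adm_angular_part[OF u a])
  have Lu: "adm a r (lie (rot i j) u)" for i j by (rule adm_lie[OF linear_rot u])
  have LY: "lie (rot i j) ?Y = shifted_euler a (lie (rot i j) u)" for i j
    by (rule rot_shifted_euler_commute[OF u])
  have aLY: "adm a r (lie (rot i j) ?Y)" for i j by (rule adm_lie[OF linear_rot adm_test[OF Y]])
  have XY: "ip a ?X ?Y = 0" by (rule shifted_euler_ip_self[OF Y a])
  \<comment> \<open>For a = 0 the function u itself need not be admissible. Skewness is therefore
    applied to a p u, which always is.\<close>
  have Yu: "a * p * ip a ?Y u = 0"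
  proof -
    have f: "adm a r (\<lambda>x. a * p * u x)" by (rule adm_cmult_test[OF u a])
    have "ip a (\<lambda>x. (a * p) * ?Y x) u = - ip a (\<lambda>x. (a * p) * u x) ?Y"
      using shifted_euler_skew[OF f u a] shifted_euler_cmult[OF u, of a "a * p"] by simp
    moreover have "ip a (\<lambda>x. (a * p) * ?Y x) u = (a * p) * ip a u ?Y"
      using ip_cmult_right[of a u "a * p" ?Y] ip_commute[of a "\<lambda>x. (a * p) * ?Y x" u] by metis
    moreover have "ip a (\<lambda>x. (a * p) * u x) ?Y = (a * p) * ip a ?Y u"
      using ip_cmult_right[of a ?Y "a * p" u] ip_commute[of a "\<lambda>x. (a * p) * u x" ?Y] by metis
    moreover have "ip a u ?Y = ip a ?Y u" by (rule ip_commute)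
    ultimately have "a * p * ip a ?Y u = - (a * p * ip a ?Y u)" by metis
    then show ?thesis by simp
  qed
  have YZ: "ip a ?Y ?Z = 0"
    unfolding ip_angular_part[OF Y u a] using shifted_euler_ip_self[OF Lu a] Yu by (simp add: LY)
  have "a * p * ip a ?X u = - (a * p * ip a ?Y ?Y)"
    using shifted_euler_skew[OF Y u a] by simp
  moreover have "ip a (lie (rot i j) ?X) (lie (rot i j) u) = - ip a (lie (rot i j) ?Y) (lie (rot i j) ?Y)" for i j
    unfolding rot_shifted_euler_commute[OF adm_test[OF Y]]
    using shifted_euler_skew[OF aLY adm_test[OF Lu] a, of i j i j] by (simp add: LY)
  ultimately have XZ: "ip a ?X ?Z = - (a * p * ip a ?Y ?Y) - ?S / 2"
    unfolding ip_angular_part[OF X u a] by (simp add: sum_negf)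
  have L: "L = (\<lambda>x. ?X x + (p - a) * ?Y x - ?Z x)"
    unfolding L_def using scaled_laplacian_eq[OF u ap] by auto
  have "ip a L L = ip a ?X ?X + ((p - a)\<^sup>2 + 2 * a * p) * ip a ?Y ?Y + ?S + ip a ?Z ?Z"
    unfolding L ip_square_sum3[OF X Y Z a] XY YZ XZ by (simp add: algebra_simps)
  \<comment> \<open>From D = E - a one gets E D u = X - a Y, and X is orthogonal to Y.\<close>
  moreover have "ip a (shifted_euler a (euler u)) (shifted_euler a (euler u)) = ip a ?X ?X + a\<^sup>2 * ip a ?Y ?Y"
  proof -
    have "euler ?Y x = euler (euler u) x + a * euler u x" for x
      unfolding shifted_euler_def[abs_def]
      using lie_add[OF test_differentiable[OF test_lie[OF linear_self u]] test_differentiable[OF test_cmult[OF u]]]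
        lie_cmult[OF test_differentiable[OF u]] by metis
    then have "shifted_euler a (euler u) = (\<lambda>x. ?X x + (- a) * ?Y x - 0)"
      by (auto simp: shifted_euler_def)
    moreover have "adm a r (\<lambda>_::'a. 0)" by (simp add: adm_def smooth_on_const)
    ultimately show ?thesis
      using ip_square_sum3[OF X Y, of "\<lambda>_. 0" "- a"] a XY by (simp add: ip_def)
  qed
  ultimately show ?thesis by (simp add: algebra_simps power2_eq_square)
qed

lemma nn_integral_ip:
  assumes f: "adm a r f" and a: "0 \<le> a"
  shows "wsq a f = ennreal (ip a f f)"
  unfolding ip_def using nn_integral_eq_integral[OF ip_integrable[OF f adm_test[OF f] a]]
  by (simp add: power2_eq_square)

section \<open>Radial vector fields and Hardy inequalities\<close>

text \<open>Nothing is known of k outside (0, R). Since \<rho> < R, the open sets 0 < |x| < R and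
  |x| > \<rho> cover the punctured space, and on the second one the product is zero.\<close>

lemma continuous_on_radial_mult:
  fixes h :: "'a::euclidean_space \<Rightarrow> real"
  assumes k: "continuous_on {0<..<R} k" and h: "continuous_on UNIV h"
    and z: "\<And>x. \<rho> < norm x \<Longrightarrow> h x = 0" and "\<rho> < R"
  shows "continuous_on (- {0}) (\<lambda>x. k (norm x) * h x)"
proof -
  have 1: "continuous_on {x::'a. 0 < norm x \<and> norm x < R} (\<lambda>x. k (norm x) * h x)"
    by (intro continuous_intros continuous_on_compose2[OF k] continuous_on_subset[OF h]) auto
  have "continuous_on {x::'a. \<rho> < norm x} (\<lambda>x. 0::real)" by simp
  then have 2: "continuous_on {x::'a. \<rho> < norm x} (\<lambda>x. k (norm x) * h x)"
    by (rule continuous_on_eq) (simp add: z)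
  have "continuous_on ({x::'a. 0 < norm x \<and> norm x < R} \<union> {x. \<rho> < norm x}) (\<lambda>x. k (norm x) * h x)"
    by (intro continuous_on_open_Un 1 2 open_Collect_conj open_Collect_less continuous_intros)
  then show ?thesis by (rule continuous_on_subset) (use \<open>\<rho> < R\<close> in auto)
qed

lemma integrable_shell:
  fixes h :: "'a::euclidean_space \<Rightarrow> real"
  assumes k: "continuous_on {0<..<R} k" and h: "continuous_on UNIV h"
    and z: "\<And>x. \<rho> < norm x \<Longrightarrow> h x = 0" and "\<rho> < R" and e: "0 < e"
    and k0: "\<And>r. 0 < r \<Longrightarrow> r \<le> e \<Longrightarrow> k r = 0"
  shows "integrable haar (\<lambda>x. k (norm x) * h x)"
proof -
  have cont: "continuous_on (- {0}) (\<lambda>x. k (norm x) * h x)"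
    by (rule continuous_on_radial_mult[OF k h z \<open>\<rho> < R\<close>])
  have "compact ((\<lambda>x. k (norm x) * h x) ` {x. e \<le> norm x \<and> norm x \<le> \<rho>})"
  proof (intro compact_continuous_image continuous_on_subset[OF cont])
    have "{x::'a. e \<le> norm x \<and> norm x \<le> \<rho>} = cball 0 \<rho> - ball 0 e" by auto
    then show "compact {x::'a. e \<le> norm x \<and> norm x \<le> \<rho>}" by (simp add: compact_diff)
  qed (use e in auto)
  then obtain C where "C > 0" and C: "\<And>y. y \<in> (\<lambda>x. k (norm x) * h x) ` {x. e \<le> norm x \<and> norm x \<le> \<rho>} \<Longrightarrow> norm y \<le> C"
    using compact_imp_bounded bounded_pos by metis
  show ?thesis
  proof (rule integrable_haar_bound[where \<delta>=1 and r=\<rho> and C="C / e"])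
    fix x :: 'a assume x: "x \<noteq> 0" "norm x \<le> \<rho>"
    show "\<bar>k (norm x) * h x\<bar> \<le> C / e * norm x powr 1"
    proof (cases "norm x \<le> e")
      case True
      then show ?thesis using k0 x \<open>C > 0\<close> e by simp
    next
      case False
      then have "\<bar>k (norm x) * h x\<bar> \<le> C" using C x by auto
      also have "C \<le> C / e * norm x" using False e \<open>C > 0\<close> by (simp add: field_simps)
      finally show ?thesis by simp
    qed
  qed (use z borel_measurable_continuous_nonzero[OF cont] in auto)
qed

lemma integral_radial_divergence:
  fixes h :: "'a::euclidean_space \<Rightarrow> real"
  assumes k: "\<And>r. 0 < r \<Longrightarrow> r < R \<Longrightarrow> (k has_real_derivative k' r) (at r)"
    and k': "continuous_on {0<..<R} k'"
    and h: "test \<rho> h" and \<rho>: "\<rho> < R" and e: "0 < e"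
    and k0: "\<And>r. 0 < r \<Longrightarrow> r \<le> e \<Longrightarrow> k r = 0" and k'0: "\<And>r. 0 < r \<Longrightarrow> r \<le> e \<Longrightarrow> k' r = 0"
  defines "G \<equiv> \<lambda>x. (norm x * k' (norm x)) * h x + k (norm x) * euler h x"
  shows "integrable haar G" "(\<integral>x. G x \<partial>haar) = 0"
proof -
  have ck: "continuous_on {0<..<R} k"
    by (rule continuous_at_imp_continuous_on) (simp add: DERIV_isCont[OF k])
  have ck': "continuous_on {0<..<R} (\<lambda>r. r * k' r)" by (intro continuous_intros k')
  have ch: "continuous_on UNIV h" "continuous_on UNIV (euler h)"
    using smooth_on_continuous[OF test_smooth[OF h]]
      smooth_on_continuous[OF test_smooth[OF test_lie[OF linear_self h]]] by auto
  have z: "h x = 0" "euler h x = 0" if "\<rho> < norm x" for x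
    using h test_lie[OF linear_self h] that by (auto simp: test_def)
  note c1 = continuous_on_radial_mult[OF ck' ch(1) z(1) \<rho>]
  note c2 = continuous_on_radial_mult[OF ck ch(2) z(2) \<rho>]
  show iG: "integrable haar G" unfolding G_def
    by (intro Bochner_Integration.integrable_add integrable_shell[OF ck' ch(1) z(1) \<rho> e]
        integrable_shell[OF ck ch(2) z(2) \<rho> e k0]) (simp_all add: k'0)
  show "(\<integral>x. G x \<partial>haar) = 0"
  proof (rule integral_dilation_derivative_eq_0[where F="\<lambda>x. k (norm x) * h x"])
    show "continuous_on (- {0}) G" unfolding G_def by (intro continuous_on_add c1 c2)
    show "integrable haar (\<lambda>x. k (norm x) * h x)"
      by (rule integrable_shell[OF ck ch(1) z(1) \<rho> e k0])
    show "integrable haar G" by (rule iG)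
    fix x :: 'a assume x: "x \<noteq> 0"
    show "((\<lambda>t. k (norm (exp t *\<^sub>R x)) * h (exp t *\<^sub>R x)) has_real_derivative G x) (at 0)"
    proof (cases "norm x < R")
      case True
      have "((\<lambda>t. k (exp t * norm x)) has_real_derivative k' (norm x) * norm x) (at 0)"
      proof (rule DERIV_chain2[where f=k])
        show "(k has_real_derivative k' (norm x)) (at (exp 0 * norm x))"
          using k[of "norm x"] True x by simp
        show "((\<lambda>t. exp t * norm x) has_real_derivative norm x) (at 0)"
          by (auto intro!: derivative_eq_intros)
      qed
      from DERIV_mult[OF this has_real_derivative_dilation[OF test_differentiable[OF h, of x]]]
      show ?thesis by (simp add: G_def algebra_simps)
    next
      \<comment> \<open>Here k may be arbitrary, but the dilated point stays beyond radius \<rho>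
        for small t, so the product is locally zero along the orbit.\<close>
      case False
      have "\<forall>\<^sub>F t in nhds 0. \<rho> < exp t * norm x"
      proof -
        have "((\<lambda>t. exp t * norm x) \<longlongrightarrow> exp 0 * norm x) (at 0)" by (intro tendsto_intros)
        then have "((\<lambda>t. exp t * norm x) \<longlongrightarrow> exp 0 * norm x) (nhds 0)" by (simp add: tendsto_nhds_iff)
        from order_tendstoD(1)[OF this, of \<rho>] show ?thesis using False \<rho> by simp
      qed
      then have "\<forall>\<^sub>F t in nhds 0. (0::real) = k (norm (exp t *\<^sub>R x)) * h (exp t *\<^sub>R x)"
        by eventually_elim (simp add: z)
      then have "((\<lambda>t. k (norm (exp t *\<^sub>R x)) * h (exp t *\<^sub>R x)) has_real_derivative 0) (at 0)
         \<longleftrightarrow> ((\<lambda>t. 0::real) has_real_derivative 0) (at (0::real))"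
        by (intro DERIV_cong_ev) (auto elim: eventually_mono)
      moreover have "G x = 0" using False \<rho> by (simp add: G_def z)
      ultimately show ?thesis by simp
    qed
  qed
qed

text \<open>Integrability of q is not assumed. If the integral of s is finite, it follows from q
  \<le> s + |G|; otherwise there is nothing to show.\<close>

lemma nn_integral_le_of_null_integral:
  fixes q s G :: "'a \<Rightarrow> real"
  assumes G: "integrable M G" "(\<integral>x. G x \<partial>M) = 0"
    and q: "q \<in> borel_measurable M" "AE x in M. 0 \<le> q x"
    and s: "s \<in> borel_measurable M" "AE x in M. 0 \<le> s x"
    and le: "AE x in M. q x + G x \<le> s x"
  shows "(\<integral>\<^sup>+x. ennreal (q x) \<partial>M) \<le> (\<integral>\<^sup>+x. ennreal (s x) \<partial>M)"
proof (cases "(\<integral>\<^sup>+x. ennreal (s x) \<partial>M) = \<infinity>")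
  case False
  have ints: "integrable M s"
    by (rule integrableI_nonneg[OF s]) (use False in \<open>simp add: less_top\<close>)
  have iq: "integrable M q"
  proof (rule Bochner_Integration.integrable_bound[where f="\<lambda>x. s x + \<bar>G x\<bar>"])
    show "AE x in M. norm (q x) \<le> norm (s x + \<bar>G x\<bar>)"
      using q(2) s(2) le by eventually_elim auto
  qed (use ints G q in auto)
  have "(\<integral>x. q x + G x \<partial>M) \<le> (\<integral>x. s x \<partial>M)"
    by (rule integral_mono_AE[OF Bochner_Integration.integrable_add[OF iq G(1)] ints le])
  then have "(\<integral>x. q x \<partial>M) \<le> (\<integral>x. s x \<partial>M)" using iq G by simp
  then show ?thesis
    by (simp add: nn_integral_eq_integral[OF iq q(2)] nn_integral_eq_integral[OF ints s(2)] ennreal_leI)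
qed simp

section \<open>A cutoff near the origin and the Riccati equation\<close>

lemma DERIV_max_0_square:
  "((\<lambda>y::real. (max 0 y)\<^sup>2) has_real_derivative 2 * max 0 y) (at y)"
proof -
  consider "y < 0" | "y > 0" | "y = 0" by linarith
  then show ?thesis
  proof cases
    case 1
    have "((\<lambda>y::real. 0) has_real_derivative 0) (at y)" by simp
    then have "((\<lambda>y::real. (max 0 y)\<^sup>2) has_real_derivative 0) (at y)"
      by (rule has_field_derivative_transform_within_open[of _ _ _ "{..<0}"]) (use 1 in auto)
    then show ?thesis using 1 by simp
  next
    case 2
    have "((\<lambda>y::real. y\<^sup>2) has_real_derivative 2 * y) (at y)"
      by (auto intro!: derivative_eq_intros)
    then have "((\<lambda>y::real. (max 0 y)\<^sup>2) has_real_derivative 2 * y) (at y)"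
      by (rule has_field_derivative_transform_within_open[of _ _ _ "{0<..}"]) (use 2 in auto)
    then show ?thesis using 2 by simp
  next
    case 3
    have "((\<lambda>h::real. ((max 0 (0 + h))\<^sup>2 - (max 0 0)\<^sup>2) / h) \<longlongrightarrow> 0) (at 0)"
    proof (rule Lim_null_comparison[where g="\<lambda>h. \<bar>h\<bar>"])
      show "\<forall>\<^sub>F h in at 0. norm (((max 0 (0 + h))\<^sup>2 - (max 0 0)\<^sup>2) / h) \<le> \<bar>h::real\<bar>"
        by (rule always_eventually) (auto simp: max_def power2_eq_square)
      show "((\<lambda>h::real. \<bar>h\<bar>) \<longlongrightarrow> 0) (at 0)" using tendsto_rabs_zero[OF tendsto_ident_at] by simp
    qed
    then show ?thesis using 3 by (simp add: DERIV_def)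
  qed
qed

text \<open>Zero for 0 < r \<le> e, increasing in r > 0, and tending to 1 for each fixed r > 0 as e
  tends to 0. The square makes it continuously differentiable at r = e.\<close>

definition ramp :: "real \<Rightarrow> real \<Rightarrow> real" where
  "ramp e r = (max 0 (1 - e / r))\<^sup>2"

definition ramp' :: "real \<Rightarrow> real \<Rightarrow> real" where
  "ramp' e r = 2 * max 0 (1 - e / r) * (e / r\<^sup>2)"

lemma ramp_bounds:
  assumes "0 < e" "0 < r" shows "0 \<le> ramp e r" "ramp e r \<le> 1" "0 \<le> ramp' e r"
proof -
  have "0 \<le> max 0 (1 - e / r)" "max 0 (1 - e / r) \<le> 1" using assms by auto
  then show "0 \<le> ramp e r" "ramp e r \<le> 1" "0 \<le> ramp' e r"
    using assms by (auto simp: ramp_def ramp'_def power_le_one)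
qed

lemma ramp_derivative:
  assumes r: "0 < r"
  shows "(ramp e has_real_derivative ramp' e r) (at r)"
proof -
  have "((\<lambda>r. 1 - e / r) has_real_derivative e / r\<^sup>2) (at r)"
    using r by (auto intro!: derivative_eq_intros simp: power2_eq_square)
  from DERIV_chain2[OF DERIV_max_0_square this] show ?thesis
    by (simp add: ramp_def[abs_def] ramp'_def)
qed

lemma ramp_eq_0: "0 < r \<Longrightarrow> r \<le> e \<Longrightarrow> ramp e r = 0" "0 < r \<Longrightarrow> r \<le> e \<Longrightarrow> ramp' e r = 0"
  by (auto simp: ramp_def ramp'_def field_simps max_def)

lemma continuous_on_ramp: "continuous_on {0<..<R} (ramp e)" "continuous_on {0<..<R} (ramp' e)"
  unfolding ramp_def ramp'_def by (intro continuous_intros; simp)+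

text \<open>The boundary term at the origin of \<open>div (H(r) \<phi>\<^sup>2 x)\<close> has a sign since \<open>H \<le> 0\<close>; this is what
  makes the increasing cutoff \<open>ramp\<close> work without any decay of \<open>H\<close>.\<close>

lemma radial_vector_field_inequality:
  fixes \<phi> S Q :: "'a::euclidean_space \<Rightarrow> real"
  assumes H: "\<And>r. 0 < r \<Longrightarrow> r < R \<Longrightarrow> (H has_real_derivative H' r) (at r)"
    and H': "continuous_on {0<..<R} H'" and H0: "\<And>r. 0 < r \<Longrightarrow> r < R \<Longrightarrow> H r \<le> 0"
    and \<phi>: "test \<rho> \<phi>" and \<rho>: "\<rho> < R"
    and [measurable]: "S \<in> borel_measurable borel" "Q \<in> borel_measurable borel"
    and S0: "\<And>x. x \<noteq> 0 \<Longrightarrow> 0 \<le> S x" and Q0: "\<And>x. x \<noteq> 0 \<Longrightarrow> 0 \<le> Q x"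
    and Qz: "\<And>x. \<rho> < norm x \<Longrightarrow> Q x = 0"
    and le: "\<And>x. x \<noteq> 0 \<Longrightarrow> norm x < R \<Longrightarrow> Q x + (norm x * H' (norm x) + 2 * a * H (norm x)) * (\<phi> x)\<^sup>2
        + 2 * H (norm x) * (\<phi> x * euler \<phi> x) \<le> S x"
  shows "(\<integral>\<^sup>+x. ennreal (Q x * norm x powr (2 * a)) \<partial>haar) \<le> (\<integral>\<^sup>+x. ennreal (S x * norm x powr (2 * a)) \<partial>haar)"
    (is "?Q \<le> ?S")
proof -
  let ?w = "\<lambda>x::'a. norm x powr (2 * a)"
  have cut: "(\<integral>\<^sup>+x. ennreal (ramp e (norm x) * (Q x * ?w x)) \<partial>haar) \<le> ?S" if e: "0 < e" for e
  proof -
    \<comment> \<open>With the weight built into k, differentiating along dilations produces the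
      term 2 a H \<phi>^2 of the pointwise hypothesis.\<close>
    define k where "k r = ramp e r * H r * r powr (2 * a)" for r
    define k' where "k' r = (ramp' e r * H r + ramp e r * H' r + ramp e r * H r * (2 * a / r)) * r powr (2 * a)" for r
    define h where "h x = \<phi> x * \<phi> x" for x
    define G where "G x = (norm x * k' (norm x)) * h x + k (norm x) * euler h x" for x
    have h: "test \<rho> h" unfolding h_def by (rule test_mult[OF \<phi> \<phi>])
    have eh: "euler h x = 2 * (\<phi> x * euler \<phi> x)" for x
      unfolding h_def using lie_mult[OF test_differentiable[OF \<phi>] test_differentiable[OF \<phi>]] by simp
    have dk: "(k has_real_derivative k' r) (at r)" if r: "0 < r" "r < R" for r
    proof -
      have "((\<lambda>r. r powr (2 * a)) has_real_derivative (2 * a / r) * r powr (2 * a)) (at r)"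
        using r powr_diff[of r "2 * a" 1] by (auto intro!: derivative_eq_intros)
      from DERIV_mult[OF DERIV_mult[OF ramp_derivative[OF r(1)] H[OF r]] this] show ?thesis
        by (simp add: k_def[abs_def] k'_def algebra_simps)
    qed
    have cH: "continuous_on {0<..<R} H"
      by (rule continuous_at_imp_continuous_on) (simp add: DERIV_isCont[OF H])
    have ck': "continuous_on {0<..<R} k'"
      unfolding k'_def by (intro continuous_intros continuous_on_ramp cH H') auto
    have G: "integrable haar G" "(\<integral>x. G x \<partial>haar) = 0"
      unfolding G_def[abs_def]
      by (rule integral_radial_divergence[OF dk ck' h \<rho> e]; simp add: k_def k'_def ramp_eq_0)+
    show ?thesis
    proof (rule nn_integral_le_of_null_integral[OF G])
      show "AE x in haar. 0 \<le> ramp e (norm x) * (Q x * ?w x)"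
        using AE_haar_nonzero by eventually_elim (use ramp_bounds(1)[OF e] Q0 in auto)
      show "AE x in haar. 0 \<le> S x * ?w x"
        using AE_haar_nonzero by eventually_elim (use S0 in auto)
      show "AE x in haar. ramp e (norm x) * (Q x * ?w x) + G x \<le> S x * ?w x"
        using AE_haar_nonzero
      proof eventually_elim
        case (elim x)
        show ?case
        proof (cases "norm x < R")
          case False
          then have "\<rho> < norm x" using \<rho> by simp
          then have "G x = 0" "Q x = 0"
            using h test_lie[OF linear_self h] Qz by (auto simp: test_def G_def)
          then show ?thesis using S0[OF elim] by simp
        next
          case True
          let ?r = "norm x"
          let ?d = "(?r * H' ?r + 2 * a * H ?r) * (\<phi> x)\<^sup>2 + 2 * H ?r * (\<phi> x * euler \<phi> x)"
          have r: "0 < ?r" using elim by simp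
          have "G x = (?r * ramp' e ?r * H ?r * (\<phi> x)\<^sup>2 + ramp e ?r * ?d) * ?w x"
            using r unfolding G_def k_def k'_def h_def[symmetric] eh
            by (simp add: h_def field_simps power2_eq_square)
          then have eq: "ramp e ?r * (Q x * ?w x) + G x =
              (?r * ramp' e ?r * H ?r * (\<phi> x)\<^sup>2 + ramp e ?r * (Q x + ?d)) * ?w x"
            by (simp add: algebra_simps)
          have "?r * ramp' e ?r * H ?r * (\<phi> x)\<^sup>2 \<le> 0"
            using r ramp_bounds(3)[OF e r] H0[OF r True] by (intro mult_nonpos_nonneg mult_nonneg_nonpos) auto
          moreover have "ramp e ?r * (Q x + ?d) \<le> ramp e ?r * S x"
            using le[OF elim True] ramp_bounds(1)[OF e r] by (intro mult_left_mono) auto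
          moreover have "ramp e ?r * S x \<le> S x"
            using ramp_bounds(2)[OF e r] S0[OF elim] by (rule mult_left_le_one_le[rotated 2]) (use ramp_bounds(1)[OF e r] in auto)
          ultimately show ?thesis unfolding eq by (intro mult_right_mono) auto
        qed
      qed
      show "(\<lambda>x. ramp e (norm x) * (Q x * ?w x)) \<in> borel_measurable haar"
        unfolding ramp_def by measurable
      show "(\<lambda>x. S x * ?w x) \<in> borel_measurable haar" by measurable
    qed
  qed
  \<comment> \<open>The cutoff estimate has the same right side for every e, so Fatou's lemma along
    e = 1 / (n + 1) removes the cutoff.\<close>
  let ?f = "\<lambda>n x. ennreal (ramp (1 / real (Suc n)) (norm x) * (Q x * ?w x))"
  have "?Q = (\<integral>\<^sup>+x. liminf (\<lambda>n. ?f n x) \<partial>haar)"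
  proof (rule nn_integral_cong_AE)
    show "AE x in haar. ennreal (Q x * ?w x) = liminf (\<lambda>n. ?f n x)"
      using AE_haar_nonzero
    proof eventually_elim
      case (elim x)
      have "(\<lambda>n. (max 0 (1 - 1 / real (Suc n) / norm x))\<^sup>2) \<longlonglongrightarrow> (max 0 (1 - 0 / norm x))\<^sup>2"
        using elim by (intro tendsto_intros LIMSEQ_Suc[OF lim_1_over_n]) auto
      then have "(\<lambda>n. ramp (1 / real (Suc n)) (norm x)) \<longlonglongrightarrow> 1"
        unfolding ramp_def by simp
      then have "(\<lambda>n. ?f n x) \<longlonglongrightarrow> ennreal (1 * (Q x * ?w x))"
        by (intro tendsto_ennrealI tendsto_mult tendsto_const)
      then show ?case by (simp add: lim_imp_Liminf)
    qed
  qed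
  also have "\<dots> \<le> liminf (\<lambda>n. \<integral>\<^sup>+x. ?f n x \<partial>haar)"
    by (rule nn_integral_liminf) (simp add: ramp_def)
  also have "\<dots> \<le> liminf (\<lambda>n::nat. ?S)"
    by (rule Liminf_mono) (simp add: cut)
  also have "\<dots> = ?S" by (simp add: Liminf_const)
  finally show ?thesis .
qed

text \<open>With \<open>G = r y' / y\<close> for a positive solution \<open>y\<close>, the equation becomes the Riccati equation
  \<open>r G' = - c r\<^sup>2 W - G\<^sup>2\<close>. If \<open>G\<close> were positive somewhere then, \<open>r y'\<close> being decreasing, \<open>y\<close> would
  lie below a multiple of \<open>ln r\<close> and become negative near the origin.\<close>

lemma bessel_riccati:
  assumes c: "bessel_constant R W c" and W: "continuous_on {0<..<R} W"
    and W0: "\<And>r. 0 < r \<Longrightarrow> r < R \<Longrightarrow> 0 \<le> W r"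
  obtains G G' where "\<And>r. 0 < r \<Longrightarrow> r < R \<Longrightarrow> (G has_real_derivative G' r) (at r)"
    "continuous_on {0<..<R} G'" "\<And>r. 0 < r \<Longrightarrow> r < R \<Longrightarrow> G r \<le> 0"
    "\<And>r. 0 < r \<Longrightarrow> r < R \<Longrightarrow> r * G' r = - (c * r\<^sup>2 * W r) - (G r)\<^sup>2"
proof -
  obtain y y' y'' where cpos: "0 < c"
    and all: "\<forall>r\<in>{0<..<R}. 0 < y r \<and> (y has_real_derivative y' r) (at r) \<and>
        (y' has_real_derivative y'' r) (at r) \<and> y'' r + 1 / r * y' r + c * W r * y r = 0"
    using c unfolding bessel_constant_def by blast
  have y: "0 < y r" "(y has_real_derivative y' r) (at r)" "(y' has_real_derivative y'' r) (at r)"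
    "y'' r = - (y' r / r) - c * W r * y r" if "0 < r" "r < R" for r
    using all[rule_format, of r] that by (auto simp: algebra_simps)
  define G where "G r = r * y' r / y r" for r
  define G' where "G' r = (- (c * r\<^sup>2 * W r) - (G r)\<^sup>2) / r" for r
  have dG: "(G has_real_derivative G' r) (at r)" if r: "0 < r" "r < R" for r
  proof -
    have "y r \<noteq> 0" using y(1)[OF r] by simp
    then have "((\<lambda>r. r * y' r / y r) has_real_derivative
      ((1 * y' r + y'' r * r) * y r - r * y' r * y' r) / (y r * y r)) (at r)"
      using DERIV_divide[OF DERIV_mult[OF DERIV_ident y(3)[OF r]] y(2)[OF r]] by simp
    moreover have "((1 * y' r + y'' r * r) * y r - r * y' r * y' r) / (y r * y r) = G' r"
      using r \<open>y r \<noteq> 0\<close> unfolding y(4)[OF r] G'_def G_def by (simp add: field_simps power2_eq_square)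
    ultimately show ?thesis by (simp add: G_def[abs_def])
  qed
  have "continuous_on {0<..<R} G"
    by (rule continuous_at_imp_continuous_on) (simp add: DERIV_isCont[OF dG])
  then have cG': "continuous_on {0<..<R} G'"
    unfolding G'_def by (intro continuous_intros W) auto
  have G0: "G r \<le> 0" if r: "0 < r" "r < R" for r
  proof (rule ccontr)
    assume "\<not> G r \<le> 0"
    then have "0 < r * y' r / y r" by (simp add: G_def)
    then have k: "0 < r * y' r" using y(1)[OF r] by (simp add: zero_less_divide_iff)
    define k where "k = r * y' r"
    have lower: "k \<le> s * y' s" if s: "0 < s" "s \<le> r" for s
    proof -
      have "\<exists>D. ((\<lambda>s. s * y' s) has_real_derivative D) (at t) \<and> D \<le> 0" if t: "s \<le> t" "t \<le> r" for t
      proof (intro exI conjI)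
        have t': "0 < t" "t < R" using t s r by auto
        show "((\<lambda>s. s * y' s) has_real_derivative 1 * y' t + y'' t * t) (at t)"
          using DERIV_mult[OF DERIV_ident y(3)[OF t']] by simp
        show "1 * y' t + y'' t * t \<le> 0"
          unfolding y(4)[OF t'] using t' W0[OF t'] y(1)[OF t'] cpos by (simp add: field_simps)
      qed
      from DERIV_nonpos_imp_nonincreasing[OF s(2) this] show ?thesis by (simp add: k_def)
    qed
    \<comment> \<open>The point at which the bound y r - k (ln r - ln s) is exactly 0.\<close>
    define s where "s = r * exp (- (y r / k))"
    have kpos: "0 < k" using k by (simp add: k_def)
    have s: "0 < s" "s \<le> r" using r y(1)[OF r] kpos by (auto simp: s_def)
    have "\<exists>D. ((\<lambda>t. y t - k * ln t) has_real_derivative D) (at t) \<and> 0 \<le> D" if t: "s \<le> t" "t \<le> r" for t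
    proof (intro exI conjI)
      have t': "0 < t" "t < R" using t s r by auto
      show "((\<lambda>t. y t - k * ln t) has_real_derivative y' t - k / t) (at t)"
        using t' y(2)[OF t'] by (auto intro!: derivative_eq_intros simp: divide_inverse)
      show "0 \<le> y' t - k / t" using lower[OF t'(1) t(2)] t' by (simp add: field_simps)
    qed
    from DERIV_nonneg_imp_nondecreasing[OF s(2) this]
    have "y s \<le> y r - k * (ln r - ln s)" by (simp add: algebra_simps)
    also have "ln s = ln r - y r / k" using r by (simp add: s_def ln_mult)
    finally have "y s \<le> 0" using kpos by simp
    moreover have "0 < y s" using y(1)[of s] s r by simp
    ultimately show False by simp
  qed
  show ?thesis
    by (rule that[of G G', OF dG cG' G0]) (simp_all add: G'_def)
qed

lemma radial_weight_measurable:
  assumes "continuous_on {0<..<R} k" "test \<rho> h" "\<rho> < R"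
  shows "(\<lambda>x. k (norm x) * (h x)\<^sup>2) \<in> borel_measurable borel"
  using continuous_on_radial_mult[OF assms(1) smooth_on_continuous[OF test_smooth[OF test_mult[OF assms(2,2)]]] _ assms(3)]
    assms(2) by (intro borel_measurable_continuous_nonzero) (auto simp: test_def power2_eq_square)

lemma wpot_cmult:
  assumes W: "continuous_on {0<..<R} W" and h: "test \<rho> h" and \<rho>: "\<rho> < R" and c: "0 \<le> c"
  shows "(\<lambda>x. c * ((norm x)\<^sup>2 * W (norm x) * (h x)\<^sup>2)) \<in> borel_measurable borel"
    "(\<integral>\<^sup>+x. ennreal (c * ((norm x)\<^sup>2 * W (norm x) * (h x)\<^sup>2) * norm x powr (2 * a)) \<partial>haar) =
      ennreal c * wpot a W h"
proof -
  have m: "(\<lambda>x. (norm x)\<^sup>2 * W (norm x) * (h x)\<^sup>2) \<in> borel_measurable borel"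
    by (rule radial_weight_measurable[OF _ h \<rho>]) (intro continuous_intros W)
  then show "(\<lambda>x. c * ((norm x)\<^sup>2 * W (norm x) * (h x)\<^sup>2)) \<in> borel_measurable borel" by measurable
  have "(\<integral>\<^sup>+x. ennreal (c * ((norm x)\<^sup>2 * W (norm x) * (h x)\<^sup>2) * norm x powr (2 * a)) \<partial>haar) =
      (\<integral>\<^sup>+x. ennreal c * ennreal ((norm x)\<^sup>2 * W (norm x) * (h x)\<^sup>2 * norm x powr (2 * a)) \<partial>haar)"
    using c by (intro nn_integral_cong) (simp add: ennreal_mult'[symmetric] mult_ac)
  also have "\<dots> = ennreal c * wpot a W h"
    using borel_measurable_times[OF m, of "\<lambda>x. norm x powr (2 * a)"]
    by (intro nn_integral_cmult measurable_compose[OF _ measurable_ennreal]) (simp add: measurable_haar)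
  finally show "(\<integral>\<^sup>+x. ennreal (c * ((norm x)\<^sup>2 * W (norm x) * (h x)\<^sup>2) * norm x powr (2 * a)) \<partial>haar) =
      ennreal c * wpot a W h" .
qed

text \<open>Expand 0 \<le> (E \<phi> - G \<phi>)^2 and replace -G^2 by c r^2 W + r G' through the
  Riccati equation: what is left besides the two sides of the claim is the divergence belonging to H
  = G.\<close>

lemma hardy_bessel:
  fixes \<phi> :: "'a::euclidean_space \<Rightarrow> real"
  assumes c: "bessel_constant R W c" and W: "continuous_on {0<..<R} W"
    and W0: "\<And>r. 0 < r \<Longrightarrow> r < R \<Longrightarrow> 0 \<le> W r"
    and \<phi>: "test \<rho> \<phi>" and \<rho>: "\<rho> < R"
  shows "ennreal c * wpot a W \<phi> \<le>
    wsq a (shifted_euler a \<phi>)"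
proof -
  obtain G G' where G: "\<And>r. 0 < r \<Longrightarrow> r < R \<Longrightarrow> (G has_real_derivative G' r) (at r)"
    "continuous_on {0<..<R} G'" "\<And>r. 0 < r \<Longrightarrow> r < R \<Longrightarrow> G r \<le> 0"
    "\<And>r. 0 < r \<Longrightarrow> r < R \<Longrightarrow> r * G' r = - (c * r\<^sup>2 * W r) - (G r)\<^sup>2"
    using bessel_riccati[OF c W W0] by blast
  have cpos: "0 < c" using c by (simp add: bessel_constant_def)
  have mE: "shifted_euler a \<phi> \<in> borel_measurable borel"
    by (intro borel_measurable_continuous_onI smooth_on_continuous test_smooth[OF test_shifted_euler[OF \<phi>]])
  have z: "\<phi> x = 0" if "\<rho> < norm x" for x using \<phi> that by (simp add: test_def)
  show ?thesis
    unfolding wpot_cmult(2)[OF W \<phi> \<rho> less_imp_le[OF cpos], symmetric]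
  proof (rule radial_vector_field_inequality[OF G(1-3) \<phi> \<rho>])
    show "(\<lambda>x. (shifted_euler a \<phi> x)\<^sup>2) \<in> borel_measurable borel" using mE by measurable
    show "(\<lambda>x. c * ((norm x)\<^sup>2 * W (norm x) * (\<phi> x)\<^sup>2)) \<in> borel_measurable borel"
      using wpot_cmult(1)[OF W \<phi> \<rho>] cpos by simp
    fix x :: 'a assume x: "x \<noteq> 0"
    show "0 \<le> c * ((norm x)\<^sup>2 * W (norm x) * (\<phi> x)\<^sup>2)"
      using cpos W0[of "norm x"] x z[of x] \<rho> by (cases "norm x < R") auto
    assume "norm x < R"
    then have r: "0 < norm x" "norm x < R" using x by auto
    have "0 \<le> (shifted_euler a \<phi> x - G (norm x) * \<phi> x)\<^sup>2" by simp
    then show "c * ((norm x)\<^sup>2 * W (norm x) * (\<phi> x)\<^sup>2) + (norm x * G' (norm x) + 2 * a * G (norm x)) * (\<phi> x)\<^sup>2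
        + 2 * G (norm x) * (\<phi> x * euler \<phi> x) \<le> (shifted_euler a \<phi> x)\<^sup>2"
      unfolding G(4)[OF r] shifted_euler_def by (simp add: power2_eq_square algebra_simps)
  qed (use z in auto)
qed

text \<open>The growth condition says that r^(2a+2) W(r) has logarithmic derivative at least 2
  \<kappa> in ln r, where W is positive. The vector field is H = -\<kappa> r^2 W, the square behind
  the estimate is r^2 W (D u + \<kappa> u)^2, and \<kappa> \<ge> 0 gives H the required
  sign.\<close>

lemma hardy_growing_weight:
  fixes u :: "'a::euclidean_space \<Rightarrow> real"
  assumes W: "\<And>r. 0 < r \<Longrightarrow> r < R \<Longrightarrow> (W has_real_derivative W' r) (at r)"
    and W': "continuous_on {0<..<R} W'"
    and W0: "\<And>r. 0 < r \<Longrightarrow> r < R \<Longrightarrow> 0 \<le> W r"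
    and gr: "\<And>r. 0 < r \<Longrightarrow> r < R \<Longrightarrow> r * W' r \<ge> (2 * \<kappa> - 2 * a - 2) * W r"
    and \<kappa>: "0 \<le> \<kappa>"
    and u: "test \<rho> u" and \<rho>: "\<rho> < R"
  shows "ennreal (\<kappa>\<^sup>2) * wpot a W u \<le>
    wpot a W (euler u)"
proof -
  define H where "H r = - \<kappa> * (r\<^sup>2 * W r)" for r
  define H' where "H' r = - \<kappa> * (2 * r * W r + r\<^sup>2 * W' r)" for r
  have dH: "(H has_real_derivative H' r) (at r)" if r: "0 < r" "r < R" for r
    unfolding H_def H'_def using W[OF r] by (auto intro!: derivative_eq_intros)
  have cW: "continuous_on {0<..<R} W"
    by (rule continuous_at_imp_continuous_on) (simp add: DERIV_isCont[OF W])
  have cH': "continuous_on {0<..<R} H'" unfolding H'_def by (intro continuous_intros cW W')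
  have H0: "H r \<le> 0" if r: "0 < r" "r < R" for r
    using W0[OF r] \<kappa> by (simp add: H_def)
  have eu: "test \<rho> (euler u)" by (rule test_lie[OF linear_self u])
  have z: "u x = 0" "euler u x = 0" if "\<rho> < norm x" for x using u eu that by (auto simp: test_def)
  have nn: "0 \<le> (norm x)\<^sup>2 * W (norm x) * (h x)\<^sup>2" if "test \<rho> h" "x \<noteq> 0" for h and x :: 'a
    using W0[of "norm x"] that \<rho> by (cases "norm x < R") (auto simp: test_def)
  show ?thesis
    unfolding wpot_cmult(2)[OF cW u \<rho> zero_le_power2, symmetric]
  proof (rule radial_vector_field_inequality[OF dH cH' H0 u \<rho>])
    show "(\<lambda>x. (norm x)\<^sup>2 * W (norm x) * (euler u x)\<^sup>2) \<in> borel_measurable borel"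
      using wpot_cmult(1)[OF cW eu \<rho>, of 1] by simp
    show "(\<lambda>x. \<kappa>\<^sup>2 * ((norm x)\<^sup>2 * W (norm x) * (u x)\<^sup>2)) \<in> borel_measurable borel"
      by (rule wpot_cmult(1)[OF cW u \<rho> zero_le_power2])
    fix x :: 'a assume x: "x \<noteq> 0"
    show "0 \<le> (norm x)\<^sup>2 * W (norm x) * (euler u x)\<^sup>2" by (rule nn[OF eu x])
    show "0 \<le> \<kappa>\<^sup>2 * ((norm x)\<^sup>2 * W (norm x) * (u x)\<^sup>2)" using nn[OF u x] by simp
    assume "norm x < R"
    then have r: "0 < norm x" "norm x < R" using x by auto
    let ?r = "norm x"
    let ?V = "?r\<^sup>2 * W ?r"
    have V: "0 \<le> ?V" using W0[OF r] by simp
    have "?r * H' ?r + 2 * a * H ?r = - \<kappa> * ?r\<^sup>2 * (?r * W' ?r + (2 * a + 2) * W ?r)"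
      by (simp add: H_def H'_def algebra_simps power2_eq_square)
    also have "\<dots> \<le> - \<kappa> * ?r\<^sup>2 * (2 * \<kappa> * W ?r)"
      using gr[OF r] \<kappa> by (intro mult_left_mono_neg) (auto simp: algebra_simps)
    finally have "(?r * H' ?r + 2 * a * H ?r) * (u x)\<^sup>2 \<le> (- 2 * \<kappa>\<^sup>2 * ?V) * (u x)\<^sup>2"
      by (intro mult_right_mono) (simp_all add: algebra_simps power2_eq_square)
    moreover have "0 \<le> ?V * (euler u x + \<kappa> * u x)\<^sup>2" using V by simp
    ultimately show "\<kappa>\<^sup>2 * ((norm x)\<^sup>2 * W (norm x) * (u x)\<^sup>2) + (norm x * H' (norm x) + 2 * a * H (norm x)) * (u x)\<^sup>2
        + 2 * H (norm x) * (u x * euler u x) \<le> (norm x)\<^sup>2 * W (norm x) * (euler u x)\<^sup>2"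
      by (simp add: H_def power2_eq_square algebra_simps)
  qed (use z in auto)
qed

text \<open>Read off from the factored form: every summand is a derivative along a linear field or
  carries the factor a. This makes the left side of the final inequality finite even for a =
  0.\<close>

lemma adm_scaled_laplacian:
  fixes u :: "'a::euclidean_space \<Rightarrow> real"
  assumes u: "test \<rho> u" and a: "0 \<le> a"
  shows "adm a \<rho> (\<lambda>x. (norm x)\<^sup>2 * laplacian u x)"
proof -
  define p where "p = real DIM('a) - 2 - a"
  have eq: "(\<lambda>x. (norm x)\<^sup>2 * laplacian u x) = (\<lambda>x. shifted_euler a (shifted_euler a u) x +
      (p - a) * shifted_euler a u x + (-1) * angular_part a p u x)"
    using scaled_laplacian_eq[OF u, of a p] by (auto simp: p_def)
  show ?thesis unfolding eq
    by (intro adm_add adm_cmult adm_shifted_euler[OF _ a] test_shifted_euler adm_angular_part[OF _ a] u)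
qed

lemma rellich_bessel:
  fixes u :: "'a::euclidean_space \<Rightarrow> real"
  assumes c: "bessel_constant R W c"
    and W: "\<And>r. 0 < r \<Longrightarrow> r < R \<Longrightarrow> (W has_real_derivative W' r) (at r)"
    and W': "continuous_on {0<..<R} W'"
    and W0: "\<And>r. 0 < r \<Longrightarrow> r < R \<Longrightarrow> 0 \<le> W r"
    and gr: "\<And>r. 0 < r \<Longrightarrow> r < R \<Longrightarrow> r * W' r \<ge> (2 * \<kappa> - 2 * a - 2) * W r"
    and \<kappa>: "0 \<le> \<kappa>" and u: "test \<rho> u" and \<rho>: "\<rho> < R"
    and a: "0 \<le> a" and ap: "a + p = real DIM('a) - 2"
  shows "wsq a (angular_part a p u) +
    ennreal c * ennreal (p\<^sup>2 + \<kappa>\<^sup>2) *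
      wpot a W u \<le>
    wsq a (\<lambda>x. (norm x)\<^sup>2 * laplacian u x)"
proof -
  let ?L = "\<lambda>x. (norm x)\<^sup>2 * laplacian u x"
  have cW: "continuous_on {0<..<R} W"
    by (rule continuous_at_imp_continuous_on) (simp add: DERIV_isCont[OF W])
  have eu: "test \<rho> (euler u)" by (rule test_lie[OF linear_self u])
  have Y: "adm a \<rho> (shifted_euler a u)" by (rule adm_shifted_euler[OF u a])
  have E: "adm a \<rho> (shifted_euler a (euler u))" by (rule adm_shifted_euler[OF eu a])
  have Z: "adm a \<rho> (angular_part a p u)" by (rule adm_angular_part[OF u a])
  have L: "adm a \<rho> ?L" by (rule adm_scaled_laplacian[OF u a])
  have "ennreal c * ennreal (\<kappa>\<^sup>2) * wpot a W u = ennreal (\<kappa>\<^sup>2) * wpot a W u * ennreal c" by (simp add: mult_ac)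
  also have "\<dots> \<le> wpot a W (euler u) * ennreal c"
    by (intro mult_right_mono hardy_growing_weight[OF W W' W0 gr \<kappa> u \<rho>]) auto
  also have "\<dots> \<le> wsq a (shifted_euler a (euler u))"
    using hardy_bessel[OF c cW W0 eu \<rho>, of a] by (simp add: mult.commute)
  finally have 1: "ennreal c * ennreal (\<kappa>\<^sup>2) * wpot a W u \<le> wsq a (shifted_euler a (euler u))" .
  have "ennreal c * ennreal (p\<^sup>2) * wpot a W u = ennreal (p\<^sup>2) * (ennreal c * wpot a W u)" by (simp add: mult_ac)
  also have "\<dots> \<le> ennreal (p\<^sup>2) * wsq a (shifted_euler a u)"
    by (intro mult_left_mono hardy_bessel[OF c cW W0 u \<rho>]) auto
  finally have 2: "ennreal c * ennreal (p\<^sup>2) * wpot a W u \<le> ennreal (p\<^sup>2) * wsq a (shifted_euler a u)" .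
  have "wsq a (angular_part a p u) + ennreal c * ennreal (p\<^sup>2 + \<kappa>\<^sup>2) * wpot a W u =
    wsq a (angular_part a p u) + (ennreal c * ennreal (\<kappa>\<^sup>2) * wpot a W u + ennreal c * ennreal (p\<^sup>2) * wpot a W u)"
    by (simp add: ennreal_plus algebra_simps)
  also have "\<dots> \<le> wsq a (angular_part a p u) + (wsq a (shifted_euler a (euler u)) + ennreal (p\<^sup>2) * wsq a (shifted_euler a u))"
    by (intro add_left_mono add_mono 1 2)
  also have "\<dots> = ennreal (ip a (angular_part a p u) (angular_part a p u) +
      (ip a (shifted_euler a (euler u)) (shifted_euler a (euler u)) + p\<^sup>2 * ip a (shifted_euler a u) (shifted_euler a u)))"
    unfolding nn_integral_ip[OF Y a] nn_integral_ip[OF E a] nn_integral_ip[OF Z a]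
    by (simp add: ennreal_mult' ennreal_plus ip_nonneg)
  also have "\<dots> \<le> ennreal (ip a ?L ?L)"
  proof (rule ennreal_leI)
    \<comment> \<open>The mixed radial and angular terms are the only ones given away; the angular
      part is kept whole for the comparison with \<beta>.\<close>
    have "0 \<le> (\<Sum>i\<in>Basis. \<Sum>j\<in>Basis. ip a (lie (rot i j) (shifted_euler a u)) (lie (rot i j) (shifted_euler a u)))"
      by (intro sum_nonneg ip_nonneg)
    then show "ip a (angular_part a p u) (angular_part a p u) +
      (ip a (shifted_euler a (euler u)) (shifted_euler a (euler u)) + p\<^sup>2 * ip a (shifted_euler a u) (shifted_euler a u))
      \<le> ip a ?L ?L"
      unfolding rellich_identity[OF u a ap] by simp
  qed
  also have "\<dots> = wsq a ?L" by (rule nn_integral_ip[OF L a, symmetric])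
  finally show ?thesis .
qed

section \<open>Separated test functions\<close>

text \<open>The usual flat function divided by a power: the index j makes the family closed under
  differentiation, so that smoothness follows by an induction on the order.\<close>

definition flat :: "nat \<Rightarrow> real \<Rightarrow> real" where
  "flat j x = (if x \<le> 0 then 0 else exp (- 1 / x) / x ^ j)"

lemma flat_tendsto_0: "(flat j \<longlongrightarrow> 0) (at 0)"
proof -
  have "((\<lambda>x. inverse x ^ j / exp (inverse x)) \<longlongrightarrow> 0) (at_right (0::real))"
    by (rule filterlim_compose[OF tendsto_power_div_exp_0 filterlim_inverse_at_top_right])
  moreover have "\<forall>\<^sub>F x in at_right 0. inverse x ^ j / exp (inverse x) = flat j x"
    using eventually_at_right_less[of "0::real"]
  proof eventually_elim
    case (elim x)
    have "exp (- 1 / x) = inverse (exp (inverse x))" by (simp add: exp_minus[symmetric] divide_inverse)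
    with elim show ?case by (simp add: flat_def divide_inverse power_inverse mult.commute)
  qed
  ultimately have "(flat j \<longlongrightarrow> 0) (at_right 0)" by (rule Lim_transform_eventually)
  moreover have "(flat j \<longlongrightarrow> 0) (at_left 0)"
  proof (rule tendsto_eventually)
    show "\<forall>\<^sub>F x in at_left 0. flat j x = 0"
      by (simp add: eventually_at_filter flat_def)
  qed
  ultimately show ?thesis by (simp add: filterlim_split_at)
qed

lemma flat_derivative: "(flat j has_real_derivative - real j * flat (Suc j) x + flat (Suc (Suc j)) x) (at x)"
proof -
  consider "x < 0" | "x > 0" | "x = 0" by linarith
  then show ?thesis
  proof cases
    case 1
    have "((\<lambda>y::real. 0) has_real_derivative 0) (at x)" by simp
    then have "(flat j has_real_derivative 0) (at x)"
      by (rule has_field_derivative_transform_within_open[of _ _ _ "{..<0}"]) (use 1 in \<open>auto simp: flat_def\<close>)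
    then show ?thesis using 1 by (simp add: flat_def)
  next
    case 2
    have "((\<lambda>y. exp (- 1 / y) / y ^ j) has_real_derivative
        (exp (- 1 / x) * (1 / x\<^sup>2) * x ^ j - exp (- 1 / x) * (real j * x ^ (j - 1))) / (x ^ j * x ^ j)) (at x)"
      using 2 by (auto intro!: derivative_eq_intros simp: power2_eq_square)
    also have "(exp (- 1 / x) * (1 / x\<^sup>2) * x ^ j - exp (- 1 / x) * (real j * x ^ (j - 1))) / (x ^ j * x ^ j) =
        - real j * flat (Suc j) x + flat (Suc (Suc j)) x"
      using 2 by (cases j) (simp_all add: flat_def field_simps power2_eq_square)
    finally have "((\<lambda>y. exp (- 1 / y) / y ^ j) has_real_derivative - real j * flat (Suc j) x + flat (Suc (Suc j)) x) (at x)" .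
    then show ?thesis
      by (rule has_field_derivative_transform_within_open[of _ _ _ "{0<..}"]) (use 2 in \<open>auto simp: flat_def\<close>)
  next
    case 3
    \<comment> \<open>The difference quotient at 0 is the next member of the family, so the
      derivative there is its limit, namely 0.\<close>
    have "(\<lambda>h. (flat j (0 + h) - flat j 0) / h) = flat (Suc j)"
      by (auto simp: flat_def)
    then show ?thesis using 3 flat_tendsto_0[of "Suc j"] by (simp add: DERIV_def flat_def[of _ 0])
  qed
qed

lemma frechet_derivative_real:
  assumes "(f has_real_derivative D) (at x)"
  shows "frechet_derivative f (at x) = (\<lambda>h. D * h)"
  using assms unfolding has_field_derivative_def by (rule frechet_derivative_at')

lemma smooth_flat: "smooth_on UNIV (flat j)"
  unfolding smooth_on_def
proof
  fix k show "Ck_on k UNIV (flat j)"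
  proof (induction k arbitrary: j)
    case 0
    show ?case using DERIV_isCont[OF flat_derivative] by (auto intro!: continuous_at_imp_continuous_on)
  next
    case (Suc k)
    have "Ck_on k UNIV (\<lambda>x. (- real j) * flat (Suc j) x + flat (Suc (Suc j)) x)"
      by (rule Ck_on_add[OF open_UNIV Ck_on_mult[OF open_UNIV Ck_on_const Suc] Suc])
    moreover have "flat j differentiable (at x)" for x
      using flat_derivative by (auto simp: real_differentiable_def)
    ultimately show ?case by (simp add: frechet_derivative_real[OF flat_derivative])
  qed
qed

definition bump :: "real \<Rightarrow> real" where
  "bump s = flat 0 (1 + s) * flat 0 (1 + (- 1) * s)"

lemma smooth_on_affine:
  fixes g :: "real \<Rightarrow> real"
  assumes "smooth_on UNIV g" shows "smooth_on UNIV (\<lambda>s. g (c + b * s))"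
proof (rule smooth_on_compose[OF open_UNIV open_UNIV _ assms])
  fix d :: real assume "d \<in> Basis"
  have "smooth_on UNIV (\<lambda>s. c * d + s \<bullet> (b * d))"
    by (rule smooth_on_add[OF open_UNIV smooth_on_const smooth_on_inner])
  then show "smooth_on UNIV (\<lambda>s. (c + b * s) \<bullet> d)" by (simp add: algebra_simps)
qed simp

lemma smooth_bump: "smooth_on UNIV bump"
  unfolding bump_def[abs_def]
  by (rule smooth_on_mult[OF open_UNIV _ smooth_on_affine[OF smooth_flat]])
     (use smooth_on_affine[OF smooth_flat, of 0 1 1] in simp)

lemma bump_support: "bump s \<noteq> 0 \<longleftrightarrow> \<bar>s\<bar> < 1"
  by (auto simp: bump_def flat_def abs_if)

definition rderiv :: "(real \<Rightarrow> real) \<Rightarrow> real \<Rightarrow> real" where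
  "rderiv f s = pd f 1 s"

lemma has_real_derivative_rderiv:
  assumes "smooth_on UNIV f" shows "(f has_real_derivative rderiv f s) (at s)"
proof -
  have "f differentiable (at s)" using smooth_on_differentiable[OF assms] by simp
  then obtain D where "(f has_real_derivative D) (at s)" by (auto simp: real_differentiable_def)
  then show ?thesis using frechet_derivative_real by (metis mult.right_neutral rderiv_def)
qed

lemma smooth_rderiv: "smooth_on UNIV f \<Longrightarrow> smooth_on UNIV (rderiv f)"
  unfolding rderiv_def[abs_def] by (rule smooth_on_partial) auto

lemma rderiv_affine:
  assumes "smooth_on UNIV f" shows "rderiv (\<lambda>s. f (c + b * s)) = (\<lambda>s. b * rderiv f (c + b * s))"
proof
  fix s
  have "((\<lambda>s. f (c + b * s)) has_real_derivative rderiv f (c + b * s) * b) (at s)"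
    by (rule DERIV_chain2[OF has_real_derivative_rderiv[OF assms]]) (auto intro!: derivative_eq_intros)
  from frechet_derivative_real[OF this] show "rderiv (\<lambda>s. f (c + b * s)) s = b * rderiv f (c + b * s)"
    by (simp add: rderiv_def)
qed

lemma rderiv_eq_0:
  assumes "smooth_on UNIV f" "open A" "s \<in> A" "\<And>t. t \<in> A \<Longrightarrow> f t = 0"
  shows "rderiv f s = 0"
proof -
  have "((\<lambda>_. 0) has_real_derivative rderiv f s) (at s)"
    by (rule has_field_derivative_transform_within_open[OF has_real_derivative_rderiv[OF assms(1)] assms(2,3)])
       (simp add: assms(4))
  then show ?thesis using DERIV_const DERIV_unique by blast
qed

text \<open>In the logarithmic variable \<open>s = ln (norm x)\<close>, \<open>radial_sep a X f\<close> is \<open>e\<^bsup>-as\<^esup>\<close> times the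
  product of \<open>X s\<close> with the restriction of \<open>f\<close> to the sphere; \<open>shifted_euler\<close> acts on the first
  factor only, the rotations on the second one only.\<close>

definition radial_sep :: "real \<Rightarrow> (real \<Rightarrow> real) \<Rightarrow> ('a::euclidean_space \<Rightarrow> real) \<Rightarrow> 'a \<Rightarrow> real" where
  "radial_sep a X f x = (if x = 0 then 0
     else X (ln (norm x)) * norm x powr (- a) * f ((1 / norm x) *\<^sub>R x))"

definition supported_in :: "real \<Rightarrow> real \<Rightarrow> (real \<Rightarrow> real) \<Rightarrow> bool" where
  "supported_in l1 l2 X \<longleftrightarrow> smooth_on UNIV X \<and> (\<forall>s. s < l1 \<or> l2 < s \<longrightarrow> X s = 0)"

lemma supported_in_rderiv:
  assumes "supported_in l1 l2 X" shows "supported_in l1 l2 (rderiv X)"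
proof -
  have X: "smooth_on UNIV X" "\<And>s. s < l1 \<or> l2 < s \<Longrightarrow> X s = 0"
    using assms by (auto simp: supported_in_def)
  have "open ({..<l1} \<union> {l2<..})" by (intro open_Un) auto
  then have "rderiv X s = 0" if "s < l1 \<or> l2 < s" for s
    by (rule rderiv_eq_0[OF X(1)]) (use that X(2) in auto)
  then show ?thesis using smooth_rderiv[OF X(1)] by (auto simp: supported_in_def)
qed

text \<open>The product formula is smooth off the origin, and X vanishes for s < l1, so the function
  is zero on the ball of radius \<open>exp l1\<close>. These two open sets cover the space.\<close>

lemma test_radial_sep:
  fixes f :: "'a::euclidean_space \<Rightarrow> real"
  assumes X: "supported_in l1 l2 X" and f: "smooth_on UNIV f"
  shows "test (exp l2) (radial_sep a X f)"
proof -
  have sX: "smooth_on UNIV X" and zX: "\<And>s. s < l1 \<or> l2 < s \<Longrightarrow> X s = 0"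
    using X by (auto simp: supported_in_def)
  have o: "open (- {0::'a})" by auto
  have 1: "smooth_on (- {0}) (\<lambda>x::'a. X (ln (norm x)))"
  proof (rule smooth_on_compose[OF o open_UNIV _ sX])
    fix c :: real
    show "smooth_on (- {0}) (\<lambda>x::'a. ln (norm x) \<bullet> c)"
      using smooth_on_mult[OF o smooth_on_ln_norm smooth_on_const[of _ c]] by simp
  qed simp
  have 2: "smooth_on (- {0}) (\<lambda>x::'a. f ((1 / norm x) *\<^sub>R x))"
  proof (rule smooth_on_compose[OF o open_UNIV _ f])
    fix c :: 'a
    have "smooth_on (- {0}) (\<lambda>x::'a. norm x powr (- 1) * (x \<bullet> c))"
      by (rule smooth_on_mult[OF o smooth_on_norm_powr smooth_on_inner])
    then show "smooth_on (- {0}) (\<lambda>x::'a. ((1 / norm x) *\<^sub>R x) \<bullet> c)"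
      by (rule smooth_on_cong[OF o, rotated]) (simp add: powr_minus_divide)
  qed simp
  have "smooth_on (- {0}) (\<lambda>x::'a. X (ln (norm x)) * norm x powr (- a) * f ((1 / norm x) *\<^sub>R x))"
    by (rule smooth_on_mult[OF o smooth_on_mult[OF o 1 smooth_on_norm_powr] 2])
  then have A: "smooth_on (- {0}) (radial_sep a X f)"
    by (rule smooth_on_cong[OF o, rotated]) (simp add: radial_sep_def)
  have B: "smooth_on (ball 0 (exp l1)) (radial_sep a X f)"
  proof (rule smooth_on_cong[OF open_ball _ smooth_on_const[of _ 0]])
    fix x :: 'a assume "x \<in> ball 0 (exp l1)"
    then have "x \<noteq> 0 \<Longrightarrow> ln (norm x) < l1" using ln_less_cancel_iff[of "norm x" "exp l1"] by simp
    then show "0 = radial_sep a X f x" by (simp add: radial_sep_def zX)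
  qed
  have "- {0::'a} \<union> ball 0 (exp l1) = UNIV" by auto
  then have "smooth_on UNIV (radial_sep a X f)"
    using smooth_on_Un[OF o open_ball A B] by simp
  moreover have "radial_sep a X f x = 0" if "exp l2 < norm x" for x
  proof -
    have "0 < norm x" using that exp_gt_zero less_trans by blast
    then have "l2 < ln (norm x)" using that by (metis exp_less_cancel_iff exp_ln)
    then show ?thesis by (simp add: radial_sep_def zX)
  qed
  ultimately show ?thesis by (simp add: test_def)
qed

lemma lie_zero:
  assumes "u differentiable (at x)" "A x = 0" shows "lie A u x = 0"
  using linear_0[OF linear_frechet_derivative[OF assms(1)]] assms(2) by (simp add: lie_def)

text \<open>Along a dilation the spherical factor is constant, X is translated, and the power
  contributes -a, which the shift in \<open>shifted_euler\<close> cancels. Uniqueness of derivatives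
  identifies the result.\<close>

lemma shifted_euler_radial_sep:
  fixes f :: "'a::euclidean_space \<Rightarrow> real"
  assumes X: "supported_in l1 l2 X" and f: "smooth_on UNIV f"
  shows "shifted_euler a (radial_sep a X f) = radial_sep a (rderiv X) f"
proof
  fix x :: 'a
  note d = test_differentiable[OF test_radial_sep[OF X f, of a]]
  have sX: "smooth_on UNIV X" using X by (simp add: supported_in_def)
  show "shifted_euler a (radial_sep a X f) x = radial_sep a (rderiv X) f x"
  proof (cases "x = 0")
    case True
    then show ?thesis using lie_zero[OF d, of "\<lambda>x. x" 0] by (simp add: shifted_euler_def radial_sep_def)
  next
    case False
    have eq: "radial_sep a X f (exp t *\<^sub>R x) =
       X (ln (norm x) + 1 * t) * exp (- a * t) * (norm x powr (- a) * f ((1 / norm x) *\<^sub>R x))" for t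
    proof -
      have "(exp t * norm x) powr (- a) = exp (- a * t) * norm x powr (- a)"
        using False by (simp add: powr_def ln_mult exp_add[symmetric] algebra_simps)
      then show ?thesis using False by (simp add: radial_sep_def ln_mult add.commute mult_ac)
    qed
    have dX: "((\<lambda>t. X (ln (norm x) + 1 * t)) has_real_derivative rderiv X (ln (norm x)) * 1) (at 0)"
      by (rule DERIV_chain2[where f=X])
         (use has_real_derivative_rderiv[OF sX, of "ln (norm x)"] in \<open>auto intro!: derivative_eq_intros\<close>)
    have dE: "((\<lambda>t. exp (- a * t)) has_real_derivative - a) (at 0)"
      by (auto intro!: derivative_eq_intros)
    have "((\<lambda>t. X (ln (norm x) + 1 * t) * exp (- a * t)) has_real_derivative
       rderiv X (ln (norm x)) - a * X (ln (norm x))) (at 0)"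
      using DERIV_mult[OF dX dE] by (simp add: mult.commute)
    from DERIV_mult[OF this DERIV_const, of "norm x powr (- a) * f ((1 / norm x) *\<^sub>R x)"]
    have "((\<lambda>t. radial_sep a X f (exp t *\<^sub>R x)) has_real_derivative
        (rderiv X (ln (norm x)) - a * X (ln (norm x))) * (norm x powr (- a) * f ((1 / norm x) *\<^sub>R x))) (at 0)"
      unfolding eq by simp
    from DERIV_unique[OF has_real_derivative_dilation[OF d] this]
    show ?thesis using False by (simp add: shifted_euler_def radial_sep_def algebra_simps)
  qed
qed

lemma has_real_derivative_rotation:
  assumes ij: "i \<in> Basis" "j \<in> Basis" "i \<noteq> j" and d: "u differentiable (at x)"
  shows "((\<lambda>t. u (rotate_plane i j t x)) has_real_derivative lie (rot i j) u x) (at 0)"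
proof -
  have T0: "rotate_plane i j 0 x = x" by (simp add: rotate_plane_def)
  show ?thesis
    using has_real_derivative_along[of u "\<lambda>t. rotate_plane i j t x" 0 "rot i j"]
      rotate_plane_derivative[OF ij, of x 0] d by (simp add: T0)
qed

lemma rot_radial_sep:
  fixes f :: "'a::euclidean_space \<Rightarrow> real"
  assumes X: "supported_in l1 l2 X" and f: "smooth_on UNIV f" and ij: "i \<in> Basis" "j \<in> Basis"
  shows "lie (rot i j) (radial_sep a X f) = radial_sep a X (lie (rot i j) f)"
proof
  fix x :: 'a
  note d = test_differentiable[OF test_radial_sep[OF X f, of a]]
  have df: "f differentiable (at y)" for y using smooth_on_differentiable[OF f] by simp
  consider "x = 0" | "i = j" | "x \<noteq> 0" "i \<noteq> j" by blast
  then show "lie (rot i j) (radial_sep a X f) x = radial_sep a X (lie (rot i j) f) x"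
  proof cases
    case 1
    then show ?thesis using lie_zero[OF d, of "rot i j" x] by (simp add: radial_sep_def rot_def)
  next
    case 2
    then have "rot i j y = 0" for y by (simp add: rot_def)
    then show ?thesis using lie_zero[OF d] lie_zero[OF df] by (simp add: radial_sep_def)
  next
    case 3
    have o: "orthogonal_transformation (rotate_plane i j t)" for t
      by (rule orthogonal_rotate_plane[OF ij 3(2)])
    have n: "norm (rotate_plane i j t x) = norm x" for t
      by (rule orthogonal_transformation_norm[OF o])
    have "rotate_plane i j t x \<noteq> 0" for t using n[of t] 3 by auto
    moreover have "(1 / norm x) *\<^sub>R rotate_plane i j t x = rotate_plane i j t ((1 / norm x) *\<^sub>R x)" for t
      using linear_scale[OF orthogonal_transformation_linear[OF o]] by simp
    ultimately have eq: "radial_sep a X f (rotate_plane i j t x) =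
       (X (ln (norm x)) * norm x powr (- a)) * f (rotate_plane i j t ((1 / norm x) *\<^sub>R x))" for t
      using 3 by (simp add: radial_sep_def n)
    have "((\<lambda>t. radial_sep a X f (rotate_plane i j t x)) has_real_derivative
        (X (ln (norm x)) * norm x powr (- a)) * lie (rot i j) f ((1 / norm x) *\<^sub>R x)) (at 0)"
      unfolding eq by (rule DERIV_cmult[OF has_real_derivative_rotation[OF ij 3(2) df]])
    from DERIV_unique[OF has_real_derivative_rotation[OF ij 3(2) d] this]
    show ?thesis using 3 by (simp add: radial_sep_def)
  qed
qed

lemma angular_part_radial_sep:
  fixes f :: "'a::euclidean_space \<Rightarrow> real"
  assumes X: "supported_in l1 l2 X" and f: "smooth_on UNIV f"
  shows "angular_part a p (radial_sep a X f) = radial_sep a X (angular_part a p f)"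
proof
  fix x :: 'a
  have "lie (rot i j) (lie (rot i j) (radial_sep a X f)) = radial_sep a X (lie (rot i j) (lie (rot i j) f))"
    if "i \<in> Basis" "j \<in> Basis" for i j :: 'a
    using rot_radial_sep[OF X f that] rot_radial_sep[OF X smooth_on_lie[OF open_UNIV linear_rot f] that] by simp
  then have "spherical_laplacian (radial_sep a X f) x =
     (\<Sum>i\<in>Basis. \<Sum>j\<in>Basis. radial_sep a X (lie (rot i j) (lie (rot i j) f)) x) / 2"
    by (simp add: spherical_laplacian_def)
  also have "\<dots> = radial_sep a X (spherical_laplacian f) x"
    by (simp add: radial_sep_def spherical_laplacian_def sum_distrib_left)
  finally show "angular_part a p (radial_sep a X f) x = radial_sep a X (angular_part a p f) x"
    by (simp add: angular_part_def radial_sep_def algebra_simps)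
qed

lemma scaled_laplacian_radial_sep:
  fixes f :: "'a::euclidean_space \<Rightarrow> real"
  assumes X: "supported_in l1 l2 X" and f: "smooth_on UNIV f" and ap: "a + p = real DIM('a) - 2"
  shows "(norm x)\<^sup>2 * laplacian (radial_sep a X f) x =
    radial_sep a (\<lambda>s. rderiv (rderiv X) s + (p - a) * rderiv X s) f x - radial_sep a X (angular_part a p f) x"
  unfolding scaled_laplacian_eq[OF test_radial_sep[OF X f] ap] angular_part_radial_sep[OF X f]
    shifted_euler_radial_sep[OF X f] shifted_euler_radial_sep[OF supported_in_rderiv[OF X] f]
  by (simp add: radial_sep_def algebra_simps)

text \<open>Linear fields commute with dilations, so restricting u to a sphere of another radius
  introduces no power of t.\<close>

lemma lie_scale:
  assumes A: "linear A" and u: "smooth_on UNIV u"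
  shows "lie A (\<lambda>y. u (t *\<^sub>R y)) = (\<lambda>y. lie A u (t *\<^sub>R y))"
proof
  fix y
  have "(u has_derivative frechet_derivative u (at (t *\<^sub>R y))) (at (t *\<^sub>R y))"
    using smooth_on_differentiable[OF u] by (simp add: frechet_derivative_works)
  moreover have "((\<lambda>y. t *\<^sub>R y) has_derivative (\<lambda>h. t *\<^sub>R h)) (at y)"
    by (auto intro!: derivative_eq_intros)
  ultimately have "((\<lambda>y. u (t *\<^sub>R y)) has_derivative (\<lambda>h. pd u (t *\<^sub>R h) (t *\<^sub>R y))) (at y)"
    by (metis has_derivative_compose)
  then show "lie A (\<lambda>y. u (t *\<^sub>R y)) y = lie A u (t *\<^sub>R y)"
    by (simp add: lie_def frechet_derivative_at' linear_scale[OF A])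
qed

lemma smooth_scale:
  assumes "smooth_on UNIV u" shows "smooth_on UNIV (\<lambda>y. u (t *\<^sub>R y))"
  by (rule smooth_on_compose[OF open_UNIV open_UNIV _ assms])
     (use smooth_on_cmult[OF open_UNIV smooth_on_inner] in simp_all)

lemma angular_part_scale:
  assumes u: "smooth_on UNIV u"
  shows "angular_part a p (\<lambda>y. u (t *\<^sub>R y)) = (\<lambda>y. angular_part a p u (t *\<^sub>R y))"
  by (simp add: angular_part_def[abs_def] spherical_laplacian_def lie_scale[OF linear_rot u]
      lie_scale[OF linear_rot smooth_on_lie[OF open_UNIV linear_rot u]])

section \<open>The Rellich constant on the sphere\<close>

text \<open>Covers the degenerate denominators: an infinite B forces x = 0, and 0 times \<infinity>
  is 0.\<close>

lemma mult_le_of_le_divide_ennreal: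
  assumes "x \<le> A / (B::ennreal)" shows "x * B \<le> A"
proof -
  consider "B = 0" | "B = top" | "B \<noteq> 0" "B \<noteq> top" by blast
  then show ?thesis
  proof cases
    case 3
    have "x * B \<le> A / B * B" using assms by (rule mult_right_mono) simp
    also have "\<dots> = A" using 3 by (simp only: ennreal_divide_times ennreal_times_divide mult_divide_eq_ennreal not_False_eq_True)
    finally show ?thesis .
  qed (use assms in auto)
qed

lemma nn_integral_ball_haar:
  fixes A B :: "'a::euclidean_space \<Rightarrow> real"
  assumes [measurable]: "B \<in> borel_measurable borel"
    and eq: "\<And>x. x \<noteq> 0 \<Longrightarrow> norm x < R \<Longrightarrow> A x = norm x powr - real DIM('a) * B x"
    and z: "\<And>x. R \<le> norm x \<Longrightarrow> B x = 0"
  shows "(\<integral>\<^sup>+x\<in>ball 0 R. ennreal (A x) \<partial>lborel) = (\<integral>\<^sup>+x. ennreal (B x) \<partial>haar)"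
proof -
  have "(\<integral>\<^sup>+x\<in>ball 0 R. ennreal (A x) \<partial>lborel) =
     (\<integral>\<^sup>+x. ennreal (norm x powr - real DIM('a)) * ennreal (B x) \<partial>lborel)"
  proof (rule nn_integral_cong_AE)
    have "AE x in lborel. x \<noteq> (0::'a)" by (rule AE_lborel_singleton)
    then show "AE x in lborel. ennreal (A x) * indicator (ball 0 R) x =
        ennreal (norm x powr - real DIM('a)) * ennreal (B x)"
      by eventually_elim (auto simp: indicator_def eq z ennreal_mult'[symmetric])
  qed
  also have "\<dots> = (\<integral>\<^sup>+x. ennreal (B x) \<partial>haar)"
    by (simp add: nn_integral_haar)
  finally show ?thesis .
qed

text \<open>By the choice of a, the exponent 2 a - n is -(2 m + 4). The extra r^4 belongs to the
  square of |x|^2 \<Delta> u, the extra r^2 to the potential V.\<close>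

lemma powr_weight:
  fixes r N m a :: real
  assumes "0 < r" and a: "a = (N - 4 - 2 * m) / 2"
  shows "r powr - N * r powr (2 * a) = 1 / r powr (2 * m + 4)"
    "(r\<^sup>2)\<^sup>2 * (r powr - N * r powr (2 * a)) = 1 / r powr (2 * m)"
    "r\<^sup>2 * (r powr - N * r powr (2 * a)) = 1 / r powr (2 * m + 2)"
proof -
  have p: "r\<^sup>2 = r powr 2" "(r powr 2)\<^sup>2 = r powr 4"
    using assms by (simp_all add: powr_numeral powr_powr[symmetric] power_mult[symmetric])
  have e: "r powr - N * r powr (2 * a) = r powr - (2 * m + 4)"
    unfolding powr_add[symmetric] a by (rule arg_cong[where f="(powr) r"]) (simp add: field_simps)
  show "r powr - N * r powr (2 * a) = 1 / r powr (2 * m + 4)"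
    unfolding e by (simp only: powr_minus_divide)
  have a2: "2 * a = N - 4 - 2 * m" using a by simp
  show "(r\<^sup>2)\<^sup>2 * (r powr - N * r powr (2 * a)) = 1 / r powr (2 * m)"
    "r\<^sup>2 * (r powr - N * r powr (2 * a)) = 1 / r powr (2 * m + 2)"
    unfolding a2 p powr_add[symmetric] powr_minus_divide[symmetric] by (simp_all add: algebra_simps)
qed

lemma test_measurable: "test \<rho> h \<Longrightarrow> h \<in> borel_measurable borel"
  by (intro borel_measurable_continuous_onI smooth_on_continuous test_smooth)

lemma integrals_to_haar:
  fixes u :: "'a::euclidean_space \<Rightarrow> real"
  assumes u: "test \<rho> u" and \<rho>: "\<rho> < R" and a: "a = (real DIM('a) - 4 - 2 * m) / 2" "0 \<le> a"
  shows "(\<integral>\<^sup>+x\<in>ball 0 R. ennreal (\<bar>laplacian u x\<bar>\<^sup>2 / norm x powr (2 * m)) \<partial>lborel) =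
      wsq a (\<lambda>x. (norm x)\<^sup>2 * laplacian u x)"
    and "(\<integral>\<^sup>+x\<in>ball 0 R. ennreal ((u x)\<^sup>2 / norm x powr (2 * m + 4)) \<partial>lborel) =
      wsq a u"
    and "continuous_on {0<..<R} W \<Longrightarrow>
      (\<integral>\<^sup>+x\<in>ball 0 R. ennreal (W (norm x) / norm x powr (2 * m + 2) * (u x)\<^sup>2) \<partial>lborel) =
      wpot a W u"
proof -
  let ?L = "\<lambda>x. (norm x)\<^sup>2 * laplacian u x"
  have L: "test \<rho> ?L" by (rule adm_test[OF adm_scaled_laplacian[OF u a(2)]])
  note [measurable] = test_measurable[OF L] test_measurable[OF u]
  let ?N = "real DIM('a)"
  note pw = powr_weight[OF _ a(1)]
  have z: "u x = 0" "?L x = 0" if "R \<le> norm x" for x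
    using u L \<rho> that unfolding test_def by force+
  show "(\<integral>\<^sup>+x\<in>ball 0 R. ennreal (\<bar>laplacian u x\<bar>\<^sup>2 / norm x powr (2 * m)) \<partial>lborel) =
      wsq a ?L"
  proof (rule nn_integral_ball_haar)
    fix x :: 'a assume "x \<noteq> 0" "norm x < R"
    then have r: "0 < norm x" by simp
    have "norm x powr - ?N * ((?L x)\<^sup>2 * norm x powr (2 * a)) =
        (((norm x)\<^sup>2)\<^sup>2 * (norm x powr - ?N * norm x powr (2 * a))) * (laplacian u x)\<^sup>2"
      by (simp only: power_mult_distrib mult_ac)
    also have "\<dots> = \<bar>laplacian u x\<bar>\<^sup>2 / norm x powr (2 * m)"
      unfolding pw(2)[OF r] by simp
    finally show "\<bar>laplacian u x\<bar>\<^sup>2 / norm x powr (2 * m) =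
        norm x powr - ?N * ((?L x)\<^sup>2 * norm x powr (2 * a))" ..
  next
    fix x :: 'a assume "R \<le> norm x"
    then show "(?L x)\<^sup>2 * norm x powr (2 * a) = 0" by (simp only: z) simp
  qed measurable
  show "(\<integral>\<^sup>+x\<in>ball 0 R. ennreal ((u x)\<^sup>2 / norm x powr (2 * m + 4)) \<partial>lborel) =
      wsq a u"
  proof (rule nn_integral_ball_haar)
    fix x :: 'a assume "x \<noteq> 0" "norm x < R"
    then have r: "0 < norm x" by simp
    have "norm x powr - ?N * ((u x)\<^sup>2 * norm x powr (2 * a)) =
        (norm x powr - ?N * norm x powr (2 * a)) * (u x)\<^sup>2"
      by (simp only: mult_ac)
    also have "\<dots> = (u x)\<^sup>2 / norm x powr (2 * m + 4)"
      unfolding pw(1)[OF r] by simp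
    finally show "(u x)\<^sup>2 / norm x powr (2 * m + 4) =
        norm x powr - ?N * ((u x)\<^sup>2 * norm x powr (2 * a))" ..
  qed (simp_all add: z)
  assume W: "continuous_on {0<..<R} W"
  have "(\<lambda>x. (norm x)\<^sup>2 * W (norm x) * (u x)\<^sup>2) \<in> borel_measurable borel"
    by (rule radial_weight_measurable[OF _ u \<rho>]) (intro continuous_intros W)
  then have m: "(\<lambda>x. (norm x)\<^sup>2 * W (norm x) * (u x)\<^sup>2 * norm x powr (2 * a)) \<in> borel_measurable borel"
    by (rule borel_measurable_times) auto
  show "(\<integral>\<^sup>+x\<in>ball 0 R. ennreal (W (norm x) / norm x powr (2 * m + 2) * (u x)\<^sup>2) \<partial>lborel) =
      wpot a W u"
  proof (rule nn_integral_ball_haar[OF m])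
    fix x :: 'a assume "x \<noteq> 0" "norm x < R"
    then have r: "0 < norm x" by simp
    have "norm x powr - ?N * ((norm x)\<^sup>2 * W (norm x) * (u x)\<^sup>2 * norm x powr (2 * a)) =
        ((norm x)\<^sup>2 * (norm x powr - ?N * norm x powr (2 * a))) * (W (norm x) * (u x)\<^sup>2)"
      by (simp only: mult_ac)
    also have "\<dots> = W (norm x) / norm x powr (2 * m + 2) * (u x)\<^sup>2"
      unfolding pw(3)[OF r] by simp
    finally show "W (norm x) / norm x powr (2 * m + 2) * (u x)\<^sup>2 =
        norm x powr - ?N * ((norm x)\<^sup>2 * W (norm x) * (u x)\<^sup>2 * norm x powr (2 * a))" ..
  qed (simp add: z)
qed

lemma test_in_test_functions:
  assumes u: "test \<rho> u" and \<rho>: "\<rho> < R"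
  shows "u \<in> test_functions (ball 0 R)"
proof -
  have "{x. u x \<noteq> 0} \<subseteq> cball 0 \<rho>" using u by (force simp: test_def)
  then have c: "closure {x. u x \<noteq> 0} \<subseteq> cball 0 \<rho>" by (simp add: closure_minimal)
  then have "compact (closure {x. u x \<noteq> 0})"
    by (metis bounded_cball bounded_subset closed_closure compact_eq_bounded_closed)
  moreover have "closure {x. u x \<noteq> 0} \<subseteq> ball 0 R" using c \<rho> by (auto simp: subset_iff)
  ultimately show ?thesis using u by (simp add: test_functions_def test_def smooth_on_def)
qed

lemma test_functions_obtain_test:
  assumes u: "u \<in> test_functions (ball 0 R)"
  obtains \<rho> where "\<rho> < R" "test \<rho> u"
proof -
  let ?K = "closure {x. u x \<noteq> 0}"
  have K: "compact ?K" "?K \<subseteq> ball 0 R" and s: "smooth_on UNIV u"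
    using u by (auto simp: test_functions_def smooth_on_def)
  show ?thesis
  proof (cases "?K = {}")
    case True
    then have "u x = 0" for x using closure_subset[of "{x. u x \<noteq> 0}"] by auto
    then show ?thesis using that[of "R - 1"] s by (simp add: test_def)
  next
    case False
    obtain y where y: "y \<in> ?K" "\<forall>x\<in>?K. norm x \<le> norm y"
      using continuous_attains_sup[OF K(1) False, of norm] by (auto intro: continuous_intros)
    have "norm y < R" using y(1) K(2) by auto
    moreover have "u x = 0" if "norm y < norm x" for x
      using y(2) that closure_subset[of "{x. u x \<noteq> 0}"] by force
    ultimately show ?thesis using that[of "norm y"] s by (simp add: test_def)
  qed
qed

lemma rellich_constant_le:
  fixes v :: "'a::euclidean_space \<Rightarrow> real"
  assumes v: "test \<rho> v" and \<rho>: "\<rho> < R" and a: "a = (real DIM('a) - 4 - 2 * m) / 2" "0 \<le> a"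
  shows "rellich_constant TYPE('a) R m * wsq a v \<le>
    wsq a (\<lambda>x. (norm x)\<^sup>2 * laplacian v x)"
proof (cases "v = (\<lambda>_. 0)")
  case False
  then have "v \<in> test_functions (ball 0 R) - {\<lambda>_. 0}" using test_in_test_functions[OF v \<rho>] by blast
  then have "rellich_constant TYPE('a) R m \<le>
    (\<integral>\<^sup>+x\<in>ball 0 R. ennreal (\<bar>laplacian v x\<bar>\<^sup>2 / norm x powr (2 * m)) \<partial>lborel) /
    (\<integral>\<^sup>+x\<in>ball 0 R. ennreal ((v x)\<^sup>2 / norm x powr (2 * m + 4)) \<partial>lborel)"
    unfolding rellich_constant_def by (rule INF_lower)
  then show ?thesis
    unfolding integrals_to_haar[OF v \<rho> a] by (rule mult_le_of_le_divide_ennreal)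
qed simp

section \<open>Slowly varying radial cutoffs\<close>

lemma rderiv_cmult:
  assumes "smooth_on UNIV f" shows "rderiv (\<lambda>s. b * f s) = (\<lambda>s. b * rderiv f s)"
proof
  fix s
  have "((\<lambda>s. b * f s) has_real_derivative b * rderiv f s) (at s)"
    by (rule DERIV_cmult[OF has_real_derivative_rderiv[OF assms]])
  from frechet_derivative_real[OF this] show "rderiv (\<lambda>s. b * f s) s = b * rderiv f s"
    by (simp add: rderiv_def)
qed

text \<open>The large factor 1 + 1 / e is put on x, which will be of order e, while the angular term
  y keeps a factor close to 1.\<close>

lemma square_diff_young:
  fixes x y e :: real
  assumes "e > 0" shows "(x - y)\<^sup>2 \<le> (1 + 1 / e) * x\<^sup>2 + (1 + e) * y\<^sup>2"
proof -
  have "0 \<le> (x + e * y)\<^sup>2 / e" using assms by simp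
  also have "(x + e * y)\<^sup>2 / e = x\<^sup>2 / e + 2 * x * y + e * y\<^sup>2"
    using assms by (simp add: field_simps power2_eq_square)
  finally show ?thesis by (simp add: power2_eq_square algebra_simps)
qed

lemma supported_bump: "supported_in (- 1) 1 bump"
proof -
  have "bump s = 0" if "s < - 1 \<or> 1 < s" for s
    using that bump_support[of s] by (cases "bump s = 0") auto
  then show ?thesis using smooth_bump by (simp add: supported_in_def)
qed

lemma nn_integral_affine:
  fixes k :: "real \<Rightarrow> ennreal"
  assumes [measurable]: "k \<in> borel_measurable borel" and e: "0 < e"
  shows "ennreal e * (\<integral>\<^sup>+s. k (c + e * s) \<partial>lborel) = (\<integral>\<^sup>+s. k s \<partial>lborel)"
  using nn_integral_real_affine[of k e c] e by simp

text \<open>A cutoff \<open>X\<close> that varies slowly in \<open>ln (norm x)\<close>, far out in the interval \<open>s < ln R\<close>: its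
  derivatives are of order \<open>e\<close>, so the test function \<open>radial_sep a X f\<close> sees almost only the angular
  part of the Laplacian.\<close>

definition slow_cutoff ::
    "real \<Rightarrow> real \<Rightarrow> real \<Rightarrow> real \<Rightarrow> real \<Rightarrow> real \<Rightarrow> real \<Rightarrow> (real \<Rightarrow> real) \<Rightarrow> (real \<Rightarrow> real) \<Rightarrow> bool" where
  "slow_cutoff R q e K C l1 l2 X I \<longleftrightarrow> supported_in l1 l2 X \<and> exp l2 < R \<and> I \<in> borel_measurable borel \<and>
      (\<forall>s. 0 \<le> I s) \<and> (\<forall>s. (rderiv (rderiv X) s + q * rderiv X s)\<^sup>2 \<le> e\<^sup>2 * I s) \<and>
      ennreal e * (\<integral>\<^sup>+s. ennreal ((X s)\<^sup>2) \<partial>lborel) = ennreal K \<and>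
      ennreal e * (\<integral>\<^sup>+s. ennreal (I s) \<partial>lborel) = ennreal C"

text \<open>The bump is stretched by 1 / e. The factor e in the two normalisations compensates for
  that length, so K and C do not depend on e.\<close>

lemma slow_cutoff_exists:
  fixes R q :: real
  assumes R: "0 < R"
  obtains K C where "0 < K" "0 \<le> C"
    "\<forall>e. 0 < e \<longrightarrow> e \<le> 1 \<longrightarrow> (\<exists>X I l1 l2. slow_cutoff R q e K C l1 l2 X I)"
proof -
  note s0 = smooth_bump
  note s1 = smooth_rderiv[OF s0]
  note s2 = smooth_rderiv[OF s1]
  have sup: "supported_in (- 1) 1 (rderiv bump)" "supported_in (- 1) 1 (rderiv (rderiv bump))"
    by (intro supported_in_rderiv supported_bump)+
  have bd: "\<exists>C\<ge>0. \<forall>s. \<bar>h s\<bar> \<le> C" if "supported_in (- 1) 1 h" for h :: "real \<Rightarrow> real"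
  proof -
    have "continuous_on UNIV h" using that smooth_on_continuous by (auto simp: supported_in_def)
    moreover have "h s = 0" if "1 < norm s" for s
      using \<open>supported_in (- 1) 1 h\<close> that by (cases "s < 0") (simp_all add: supported_in_def)
    ultimately show ?thesis by (rule test_bounded) blast+
  qed
  obtain C1 where C1: "C1 \<ge> 0" "\<And>s. \<bar>rderiv bump s\<bar> \<le> C1" using bd[OF sup(1)] by blast
  obtain C2 where C2: "C2 \<ge> 0" "\<And>s. \<bar>rderiv (rderiv bump) s\<bar> \<le> C2" using bd[OF sup(2)] by blast
  define C where "C = C2 + \<bar>q\<bar> * C1"
  have C0: "0 \<le> C" using C1 C2 by (simp add: C_def)
  have mb [measurable]: "bump \<in> borel_measurable borel"
    by (intro borel_measurable_continuous_onI smooth_on_continuous s0)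
  obtain B where B: "B \<ge> 0" "\<And>s. \<bar>bump s\<bar> \<le> B" using bd[OF supported_bump] by blast
  have fin: "(\<integral>\<^sup>+s. ennreal ((bump s)\<^sup>2) \<partial>lborel) < \<infinity>"
  proof -
    have "(\<integral>\<^sup>+s. ennreal ((bump s)\<^sup>2) \<partial>lborel) \<le> (\<integral>\<^sup>+s. ennreal (B\<^sup>2) * indicator {-1..1::real} s \<partial>lborel)"
    proof (rule nn_integral_mono)
      fix s
      have *: "(bump s)\<^sup>2 \<le> B\<^sup>2" using power_mono[OF B(2)[of s] abs_ge_zero, of 2] by simp
      show "ennreal ((bump s)\<^sup>2) \<le> ennreal (B\<^sup>2) * indicator {-1..1::real} s"
      proof (cases "\<bar>s\<bar> < 1")
        case True
        then have "s \<in> {-1..1}" by auto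
        with * show ?thesis by (simp add: ennreal_leI)
      next
        case False
        then have "bump s = 0" using bump_support by blast
        then show ?thesis by simp
      qed
    qed
    also have "\<dots> = ennreal (B\<^sup>2) * 2" by (simp add: nn_integral_cmult)
    also have "\<dots> < \<infinity>" by (simp add: ennreal_mult_less_top)
    finally show ?thesis .
  qed
  have pos: "(\<integral>\<^sup>+s. ennreal ((bump s)\<^sup>2) \<partial>lborel) \<noteq> 0"
  proof
    assume "(\<integral>\<^sup>+s. ennreal ((bump s)\<^sup>2) \<partial>lborel) = 0"
    then have "AE s in lborel. ennreal ((bump s)\<^sup>2) = 0"
      by (subst (asm) nn_integral_0_iff_AE) auto
    then have "AE s in lborel. s \<notin> {-1<..<1::real}"
    proof eventually_elim
      case (elim s)
      then have "bump s = 0" by (simp add: ennreal_eq_0_iff)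
      then show ?case using bump_support[of s] by auto
    qed
    then have "emeasure lborel {-1<..<1::real} = 0"
      by (subst (asm) AE_iff_measurable[of "{-1<..<1}"]) auto
    then show False by simp
  qed
  define K where "K = enn2real (\<integral>\<^sup>+s. ennreal ((bump s)\<^sup>2) \<partial>lborel)"
  have K: "(\<integral>\<^sup>+s. ennreal ((bump s)\<^sup>2) \<partial>lborel) = ennreal K" using fin by (simp add: K_def)
  have Kpos: "0 < K" using pos K by (metis ennreal_eq_0_iff not_le)
  have main: "\<exists>X I l1 l2. slow_cutoff R q e K (2 * C\<^sup>2) l1 l2 X I" if e: "0 < e" "e \<le> 1" for e :: real
  proof -
    define l where "l = ln R"
    \<comment> \<open>Places the support, where |c + e s| \<le> 1, between l - 3 / e and l - 1 / e,
      strictly below l = ln R.\<close>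
    define c where "c = 2 - e * l"
    define X where "X s = bump (c + e * s)" for s
    define I where "I s = C\<^sup>2 * indicator {-1..1} (c + e * s)" for s
    have "X s = 0" if "s < l - 3 / e \<or> l - 1 / e < s" for s
    proof -
      have "e * s < e * (l - 3 / e) \<or> e * (l - 1 / e) < e * s"
        using that e by auto
      then have "e * s < e * l - 3 \<or> e * l - 1 < e * s" using e by (simp add: algebra_simps)
      then have "\<not> \<bar>c + e * s\<bar> < 1" by (auto simp: c_def)
      then show ?thesis using bump_support by (auto simp: X_def)
    qed
    then have 1: "supported_in (l - 3 / e) (l - 1 / e) X"
      using smooth_on_affine[OF s0, of c e] by (simp add: supported_in_def X_def[abs_def])
    have "exp (l - 1 / e) < exp l" using e by simp
    then have 2: "exp (l - 1 / e) < R" using R by (simp add: l_def)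
    have X1: "rderiv X = (\<lambda>s. e * rderiv bump (c + e * s))"
      unfolding X_def[abs_def] by (rule rderiv_affine[OF s0])
    have X2: "rderiv (rderiv X) = (\<lambda>s. e * (e * rderiv (rderiv bump) (c + e * s)))"
      unfolding X1 rderiv_cmult[OF smooth_on_affine[OF s1, of c e], of e] rderiv_affine[OF s1, of c e] ..
    have 3: "(rderiv (rderiv X) s + q * rderiv X s)\<^sup>2 \<le> e\<^sup>2 * I s" for s
    proof -
      let ?t = "c + e * s"
      have eq: "rderiv (rderiv X) s + q * rderiv X s = e * (e * rderiv (rderiv bump) ?t + q * rderiv bump ?t)"
        by (simp only: X2) (simp add: X1 algebra_simps)
      have "(e * rderiv (rderiv bump) ?t + q * rderiv bump ?t)\<^sup>2 \<le> C\<^sup>2 * indicator {-1..1} ?t"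
      proof (cases "?t \<in> {-1..1}")
        case True
        have "\<bar>e * rderiv (rderiv bump) ?t + q * rderiv bump ?t\<bar> \<le> \<bar>e * rderiv (rderiv bump) ?t\<bar> + \<bar>q * rderiv bump ?t\<bar>"
          by (rule abs_triangle_ineq)
        also have "\<bar>e * rderiv (rderiv bump) ?t\<bar> \<le> 1 * C2"
          unfolding abs_mult using e C2 by (intro mult_mono) auto
        also have "\<bar>q * rderiv bump ?t\<bar> \<le> \<bar>q\<bar> * C1"
          unfolding abs_mult using C1 by (intro mult_left_mono) auto
        finally have "\<bar>e * rderiv (rderiv bump) ?t + q * rderiv bump ?t\<bar> \<le> C" by (simp add: C_def)
        then show ?thesis using True C0 by (simp add: abs_le_square_iff[symmetric])
      next
        case False
        then have "rderiv bump ?t = 0" "rderiv (rderiv bump) ?t = 0"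
          using sup by (auto simp: supported_in_def)
        then show ?thesis by simp
      qed
      then show ?thesis unfolding eq I_def power_mult_distrib by (intro mult_left_mono) auto
    qed
    have 4: "ennreal e * (\<integral>\<^sup>+s. ennreal ((X s)\<^sup>2) \<partial>lborel) = ennreal K"
      unfolding X_def K[symmetric] by (rule nn_integral_affine[OF _ e(1)]) measurable
    have "(\<integral>\<^sup>+s. ennreal (C\<^sup>2 * indicator {-1..1::real} s) \<partial>lborel) = (\<integral>\<^sup>+s. ennreal (C\<^sup>2) * indicator {-1..1::real} s \<partial>lborel)"
      by (intro nn_integral_cong) (auto simp: indicator_def)
    also have "\<dots> = ennreal (C\<^sup>2) * ennreal 2" by (simp add: nn_integral_cmult)
    also have "\<dots> = ennreal (2 * C\<^sup>2)" by (simp add: ennreal_mult' mult.commute)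
    finally have "(\<integral>\<^sup>+s. ennreal (C\<^sup>2 * indicator {-1..1::real} s) \<partial>lborel) = ennreal (2 * C\<^sup>2)" .
    then have 5: "ennreal e * (\<integral>\<^sup>+s. ennreal (I s) \<partial>lborel) = ennreal (2 * C\<^sup>2)"
      using nn_integral_affine[OF _ e(1), of "\<lambda>s. ennreal (C\<^sup>2 * indicator {-1..1::real} s)" c] by (simp add: I_def)
    have 6: "I \<in> borel_measurable borel" unfolding I_def by measurable
    have 7: "0 \<le> I s" for s by (simp add: I_def)
    show ?thesis unfolding slow_cutoff_def
      by (intro exI[of _ X] exI[of _ I] exI[of _ "l - 3 / e"] exI[of _ "l - 1 / e"] conjI allI 1 2 3 4 5 6 7)
  qed
  show ?thesis by (rule that[OF Kpos, of "2 * C\<^sup>2"]; (intro allI impI main)?) simp_all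
qed

text \<open>Testing the Rellich quotient with \<open>radial_sep a X f\<close>, where \<open>f\<close> is the restriction of \<open>u\<close> to the
  sphere of radius \<open>e\<^bsup>s\<^esup>\<close>.\<close>

lemma rellich_constant_sphere:
  fixes u :: "'a::euclidean_space \<Rightarrow> real"
  assumes u: "test r u" and a: "a = (real DIM('a) - 4 - 2 * m) / 2" "0 \<le> a"
    and ap: "a + p = real DIM('a) - 2"
    and X: "supported_in l1 l2 X" and l2: "exp l2 < R" and I[measurable]: "I \<in> borel_measurable borel"
    and I0: "\<And>s. 0 \<le> I s" and I1: "\<And>s. (rderiv (rderiv X) s + (p - a) * rderiv X s)\<^sup>2 \<le> e\<^sup>2 * I s"
    and e: "0 < e" "e \<le> 1"
  defines "A \<equiv> \<lambda>k h s. \<integral>\<^sup>+x. ennreal (k (ln (norm x))) *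
      ennreal ((h ((exp s / norm x) *\<^sub>R x))\<^sup>2 * norm ((exp s / norm x) *\<^sub>R x) powr (2 * a)) \<partial>(haar :: 'a measure)"
  shows "rellich_constant TYPE('a) R m * A (\<lambda>t. (X t)\<^sup>2) u s \<le>
     ennreal (2 * e) * A I u s + ennreal (1 + e) * A (\<lambda>t. (X t)\<^sup>2) (angular_part a p u) s"
proof -
  define f where "f y = u (exp s *\<^sub>R y)" for y
  have sf: "smooth_on UNIV f" unfolding f_def by (rule smooth_scale[OF test_smooth[OF u]])
  define V where "V = radial_sep a X f"
  have V: "test (exp l2) V" unfolding V_def by (rule test_radial_sep[OF X sf])
  let ?y = "\<lambda>x::'a. (exp s / norm x) *\<^sub>R x"
  let ?Z = "angular_part a p u"
  have sX: "smooth_on UNIV X" using X by (simp add: supported_in_def)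
  have [measurable]: "X \<in> borel_measurable borel"
    by (intro borel_measurable_continuous_onI smooth_on_continuous sX)
  have Z: "test r ?Z" by (rule adm_test[OF adm_angular_part[OF u a(2)]])
  note [measurable] = test_measurable[OF u] test_measurable[OF Z] test_measurable[OF V]
  have ny: "norm (?y x) = exp s" if "x \<noteq> 0" for x using that by simp
  have w: "(norm x powr (- a))\<^sup>2 * norm x powr (2 * a) = 1" if "x \<noteq> 0" for x :: 'a
    using that by (simp add: power2_eq_square powr_add[symmetric])
  have fy: "f ((1 / norm x) *\<^sub>R x) = u (?y x)" for x by (simp add: f_def)
  have Zy: "angular_part a p f ((1 / norm x) *\<^sub>R x) = ?Z (?y x)" for x
    unfolding f_def using angular_part_scale[OF test_smooth[OF u], of a p "exp s"] by simp
  let ?c = "exp s powr (2 * a)"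
  let ?L = "\<lambda>x. (norm x)\<^sup>2 * laplacian V x"
  have Lm: "?L \<in> borel_measurable borel" by (rule test_measurable[OF adm_test[OF adm_scaled_laplacian[OF V a(2)]]])
  \<comment> \<open>In \<open>A\<close> the weight is frozen at the radius e^s, whereas in the norm
    of \<open>V\<close> it cancels against |x|^-a; the two differ by the constant e^(2 a s).\<close>
  have lhs: "A (\<lambda>t. (X t)\<^sup>2) u s = ennreal ?c * wsq a V"
  proof -
    have "A (\<lambda>t. (X t)\<^sup>2) u s = (\<integral>\<^sup>+x. ennreal ?c * ennreal ((V x)\<^sup>2 * norm x powr (2 * a)) \<partial>haar)"
      unfolding A_def
    proof (rule nn_integral_cong_AE)
      show "AE x in haar. ennreal ((X (ln (norm x)))\<^sup>2) * ennreal ((u (?y x))\<^sup>2 * norm (?y x) powr (2 * a)) =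
          ennreal ?c * ennreal ((V x)\<^sup>2 * norm x powr (2 * a))"
        using AE_haar_nonzero
      proof eventually_elim
        case (elim x)
        have "(V x)\<^sup>2 * norm x powr (2 * a) =
            (X (ln (norm x)))\<^sup>2 * (u (?y x))\<^sup>2 * ((norm x powr (- a))\<^sup>2 * norm x powr (2 * a))"
          using elim by (simp add: V_def radial_sep_def fy[symmetric] power_mult_distrib mult_ac)
        then have "(V x)\<^sup>2 * norm x powr (2 * a) = (X (ln (norm x)))\<^sup>2 * (u (?y x))\<^sup>2"
          unfolding w[OF elim] by simp
        then show ?case unfolding ny[OF elim] by (simp only: ennreal_mult'[symmetric] zero_le_power2 powr_ge_zero mult_ac)
      qed
    qed
    also have "\<dots> = ennreal ?c * wsq a V"
      by (rule nn_integral_cmult) measurable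
    finally show ?thesis .
  qed
  have "rellich_constant TYPE('a) R m * A (\<lambda>t. (X t)\<^sup>2) u s =
    ennreal ?c * (rellich_constant TYPE('a) R m * wsq a V)"
    unfolding lhs by (simp only: mult_ac)
  also have "\<dots> \<le> ennreal ?c * wsq a ?L"
    by (rule mult_left_mono[OF rellich_constant_le[OF V l2 a]]) simp
  also have "\<dots> = (\<integral>\<^sup>+x. ennreal ?c * ennreal ((?L x)\<^sup>2 * norm x powr (2 * a)) \<partial>haar)"
  proof (rule nn_integral_cmult[symmetric])
    have "(\<lambda>x. (?L x)\<^sup>2 * norm x powr (2 * a)) \<in> borel_measurable haar"
      unfolding measurable_haar by (rule borel_measurable_times[OF borel_measurable_power[OF Lm]]) simp
    then show "(\<lambda>x. ennreal ((?L x)\<^sup>2 * norm x powr (2 * a))) \<in> borel_measurable haar"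
      by (rule measurable_compose[OF _ measurable_ennreal])
  qed
  also have "\<dots> \<le> (\<integral>\<^sup>+x. ennreal (2 * e) * (ennreal (I (ln (norm x))) * ennreal ((u (?y x))\<^sup>2 * norm (?y x) powr (2 * a)))
      + ennreal (1 + e) * (ennreal ((X (ln (norm x)))\<^sup>2) * ennreal ((?Z (?y x))\<^sup>2 * norm (?y x) powr (2 * a))) \<partial>haar)"
  proof (rule nn_integral_mono_AE)
    show "AE x in haar. ennreal ?c * ennreal ((?L x)\<^sup>2 * norm x powr (2 * a)) \<le>
      ennreal (2 * e) * (ennreal (I (ln (norm x))) * ennreal ((u (?y x))\<^sup>2 * norm (?y x) powr (2 * a)))
      + ennreal (1 + e) * (ennreal ((X (ln (norm x)))\<^sup>2) * ennreal ((?Z (?y x))\<^sup>2 * norm (?y x) powr (2 * a)))"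
      using AE_haar_nonzero
    proof eventually_elim
      case (elim x)
      let ?t = "ln (norm x)"
      let ?k = "rderiv (rderiv X) ?t + (p - a) * rderiv X ?t"
      have "?L x = (?k * u (?y x) - X ?t * ?Z (?y x)) * norm x powr (- a)"
        unfolding V_def scaled_laplacian_radial_sep[OF X sf ap]
        using elim by (simp add: radial_sep_def fy Zy algebra_simps)
      then have "(?L x)\<^sup>2 * norm x powr (2 * a) =
          (?k * u (?y x) - X ?t * ?Z (?y x))\<^sup>2 * ((norm x powr (- a))\<^sup>2 * norm x powr (2 * a))"
        by (simp only: power_mult_distrib mult.assoc)
      then have "(?L x)\<^sup>2 * norm x powr (2 * a) = (?k * u (?y x) - X ?t * ?Z (?y x))\<^sup>2"
        unfolding w[OF elim] by simp
      also have "\<dots> \<le> (1 + 1 / e) * (?k * u (?y x))\<^sup>2 + (1 + e) * (X ?t * ?Z (?y x))\<^sup>2"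
        by (rule square_diff_young[OF e(1)])
      \<comment> \<open>The e^2 from the slow cutoff beats the Young factor: (1 + 1 / e) e^2 = e +
        e^2 \<le> 2 e.\<close>
      also have "(1 + 1 / e) * (?k * u (?y x))\<^sup>2 \<le> 2 * e * (I ?t * (u (?y x))\<^sup>2)"
      proof -
        have "(1 + 1 / e) * (?k * u (?y x))\<^sup>2 = (1 + 1 / e) * (?k\<^sup>2 * (u (?y x))\<^sup>2)" by (simp add: power_mult_distrib)
        also have "\<dots> \<le> (1 + 1 / e) * ((e\<^sup>2 * I ?t) * (u (?y x))\<^sup>2)"
          using e by (intro mult_left_mono mult_right_mono I1) auto
        also have "\<dots> = (e + e\<^sup>2) * (I ?t * (u (?y x))\<^sup>2)"
          using e by (simp add: field_simps power2_eq_square)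
        also have "\<dots> \<le> (2 * e) * (I ?t * (u (?y x))\<^sup>2)"
        proof (rule mult_right_mono)
          show "e + e\<^sup>2 \<le> 2 * e" using e mult_left_le[of e e] by (simp add: power2_eq_square)
        qed (use I0 in simp)
        finally show ?thesis .
      qed
      finally have le: "(?L x)\<^sup>2 * norm x powr (2 * a) \<le> 2 * e * (I ?t * (u (?y x))\<^sup>2) + (1 + e) * ((X ?t)\<^sup>2 * (?Z (?y x))\<^sup>2)"
        by (simp add: power_mult_distrib)
      have "ennreal ?c * ennreal ((?L x)\<^sup>2 * norm x powr (2 * a)) = ennreal (?c * ((?L x)\<^sup>2 * norm x powr (2 * a)))"
        by (rule ennreal_mult'[symmetric]) simp
      also have "\<dots> \<le> ennreal (?c * (2 * e * (I ?t * (u (?y x))\<^sup>2) + (1 + e) * ((X ?t)\<^sup>2 * (?Z (?y x))\<^sup>2)))"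
        by (intro ennreal_leI mult_left_mono le) simp
      also have "\<dots> = ennreal (2 * e * (I ?t * ((u (?y x))\<^sup>2 * ?c))) + ennreal ((1 + e) * ((X ?t)\<^sup>2 * ((?Z (?y x))\<^sup>2 * ?c)))"
        using e I0[of ?t] by (subst ennreal_plus[symmetric]) (simp_all add: algebra_simps)
      also have "\<dots> = ennreal (2 * e) * (ennreal (I ?t) * ennreal ((u (?y x))\<^sup>2 * norm (?y x) powr (2 * a)))
      + ennreal (1 + e) * (ennreal ((X ?t)\<^sup>2) * ennreal ((?Z (?y x))\<^sup>2 * norm (?y x) powr (2 * a)))"
        unfolding ny[OF elim] using e I0[of ?t] by (simp only: ennreal_mult' zero_le_power2 add_nonneg_nonneg mult_nonneg_nonneg zero_le_one zero_le_numeral less_imp_le)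
      finally show ?case .
    qed
  qed
  also have "\<dots> = ennreal (2 * e) * A I u s + ennreal (1 + e) * A (\<lambda>t. (X t)\<^sup>2) ?Z s"
    unfolding A_def by (subst nn_integral_add, measurable) (simp add: nn_integral_cmult)
  finally show ?thesis .
qed

text \<open>Integrating the estimate on spheres over s makes every term a product, by the shell
  formula. After multiplication by e the cutoff leaves only K and C, and e tends to 0. Finiteness of
  the norm of u makes the error term, of order e C times its square, vanish in the limit.\<close>

lemma rellich_constant_angular:
  fixes u :: "'a::euclidean_space \<Rightarrow> real"
  assumes R: "0 < R" and u: "test r u" and a: "a = (real DIM('a) - 4 - 2 * m) / 2" "0 \<le> a"
    and ap: "a + p = real DIM('a) - 2"
    and fin: "wsq a u < \<infinity>"
  shows "rellich_constant TYPE('a) R m * wsq a u \<le>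
    wsq a (angular_part a p u)"
proof -
  let ?\<beta> = "rellich_constant TYPE('a) R m"
  let ?Z = "angular_part a p u"
  let ?F = "\<lambda>h x. ennreal ((h x)\<^sup>2 * norm x powr (2 * a))"
  have Z: "test r ?Z" by (rule adm_test[OF adm_angular_part[OF u a(2)]])
  note [measurable] = test_measurable[OF u] test_measurable[OF Z]
  interpret sigma_finite_measure "haar :: 'a measure" by (rule sigma_finite_haar)
  obtain U where U0: "0 \<le> U" and U: "(\<integral>\<^sup>+x. ?F u x \<partial>haar) = ennreal U"
    using fin by (cases "\<integral>\<^sup>+x. ?F u x \<partial>haar") auto
  define Zt where "Zt = ip a ?Z ?Z"
  have Zt: "(\<integral>\<^sup>+x. ?F ?Z x \<partial>haar) = ennreal Zt"
    unfolding Zt_def by (rule nn_integral_ip[OF adm_angular_part[OF u a(2)] a(2)])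
  have Zt0: "0 \<le> Zt" by (simp add: Zt_def ip_nonneg)
  obtain K C where K: "0 < K" and C: "0 \<le> C" and cut:
    "\<forall>e. 0 < e \<longrightarrow> e \<le> 1 \<longrightarrow> (\<exists>X I l1 l2. slow_cutoff R (p - a) e K C l1 l2 X I)"
    by (rule slow_cutoff_exists[OF R, of "p - a"])
  have approx: "?\<beta> * (ennreal K * ennreal U) \<le> ennreal (2 * e * C * U + (1 + e) * K * Zt)"
    if e: "0 < e" "e \<le> 1" for e
  proof -
    obtain X I l1 l2 where X: "supported_in l1 l2 X" and l2: "exp l2 < R" and I: "I \<in> borel_measurable borel"
      and I0: "\<And>s. 0 \<le> I s" and I1: "\<And>s. (rderiv (rderiv X) s + (p - a) * rderiv X s)\<^sup>2 \<le> e\<^sup>2 * I s"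
      and KX: "ennreal e * (\<integral>\<^sup>+s. ennreal ((X s)\<^sup>2) \<partial>lborel) = ennreal K"
      and CI: "ennreal e * (\<integral>\<^sup>+s. ennreal (I s) \<partial>lborel) = ennreal C"
      using cut[rule_format, OF e] unfolding slow_cutoff_def by blast
    note [measurable] = I
    have [measurable]: "X \<in> borel_measurable borel"
      using X by (intro borel_measurable_continuous_onI smooth_on_continuous) (simp add: supported_in_def)
    define A where "A k h s = (\<integral>\<^sup>+x. ennreal (k (ln (norm x))) * ?F h ((exp s / norm x) *\<^sub>R x) \<partial>(haar :: 'a measure))"
      for k :: "real \<Rightarrow> real" and h :: "'a \<Rightarrow> real" and s
    have Am: "A k h \<in> borel_measurable borel"
      if [measurable]: "k \<in> borel_measurable borel" "h \<in> borel_measurable borel" for k h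
      unfolding A_def by measurable
    have S: "(\<integral>\<^sup>+s. A k h s \<partial>lborel) = (\<integral>\<^sup>+s. ennreal (k s) \<partial>lborel) * (\<integral>\<^sup>+x. ?F h x \<partial>haar)"
      if [measurable]: "k \<in> borel_measurable borel" "h \<in> borel_measurable borel" for k h
      unfolding A_def by (rule nn_integral_shell[of "?F h" "\<lambda>s. ennreal (k s)"]) measurable
    let ?X = "\<lambda>t. (X t)\<^sup>2"
    have mX: "?X \<in> borel_measurable borel" by measurable
    note mu = test_measurable[OF u] and mZ = test_measurable[OF Z]
    have "?\<beta> * (\<integral>\<^sup>+s. A ?X u s \<partial>lborel) = (\<integral>\<^sup>+s. ?\<beta> * A ?X u s \<partial>lborel)"
      using Am[OF mX mu] by (intro nn_integral_cmult[symmetric]) simp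
    also have "\<dots> \<le> (\<integral>\<^sup>+s. ennreal (2 * e) * A I u s + ennreal (1 + e) * A ?X ?Z s \<partial>lborel)"
      unfolding A_def by (intro nn_integral_mono rellich_constant_sphere[OF u a ap X l2 I I0 I1 e])
    also have "\<dots> = ennreal (2 * e) * (\<integral>\<^sup>+s. A I u s \<partial>lborel) + ennreal (1 + e) * (\<integral>\<^sup>+s. A ?X ?Z s \<partial>lborel)"
      using Am[OF I mu] Am[OF mX mZ] by (simp add: nn_integral_add nn_integral_cmult)
    finally have "?\<beta> * ((\<integral>\<^sup>+s. ennreal (?X s) \<partial>lborel) * ennreal U) \<le>
        ennreal (2 * e) * ((\<integral>\<^sup>+s. ennreal (I s) \<partial>lborel) * ennreal U) +
        ennreal (1 + e) * ((\<integral>\<^sup>+s. ennreal (?X s) \<partial>lborel) * ennreal Zt)"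
      unfolding S[OF mX mu] S[OF I mu] S[OF mX mZ] U Zt .
    then have "ennreal e * (?\<beta> * ((\<integral>\<^sup>+s. ennreal (?X s) \<partial>lborel) * ennreal U)) \<le>
        ennreal e * (ennreal (2 * e) * ((\<integral>\<^sup>+s. ennreal (I s) \<partial>lborel) * ennreal U) +
        ennreal (1 + e) * ((\<integral>\<^sup>+s. ennreal (?X s) \<partial>lborel) * ennreal Zt))"
      by (rule mult_left_mono) simp
    also have "ennreal e * (?\<beta> * ((\<integral>\<^sup>+s. ennreal (?X s) \<partial>lborel) * ennreal U)) = ?\<beta> * (ennreal K * ennreal U)"
      unfolding KX[symmetric] by (simp only: mult_ac)
    also have "ennreal e * (ennreal (2 * e) * ((\<integral>\<^sup>+s. ennreal (I s) \<partial>lborel) * ennreal U) +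
        ennreal (1 + e) * ((\<integral>\<^sup>+s. ennreal (?X s) \<partial>lborel) * ennreal Zt)) =
        ennreal (2 * e) * (ennreal C * ennreal U) + ennreal (1 + e) * (ennreal K * ennreal Zt)"
      unfolding KX[symmetric] CI[symmetric] by (simp only: distrib_left mult_ac)
    also have "\<dots> = ennreal (2 * e * (C * U)) + ennreal ((1 + e) * (K * Zt))"
      using e C U0 K Zt0 by (simp only: ennreal_mult' mult_nonneg_nonneg less_imp_le add_nonneg_nonneg zero_le_one zero_le_numeral)
    also have "\<dots> = ennreal (2 * e * C * U + (1 + e) * K * Zt)"
      using e C U0 K Zt0 by (subst ennreal_plus[symmetric]) (auto simp: mult.assoc)
    finally show ?thesis .
  qed
  have "?\<beta> * (ennreal K * ennreal U) \<le> ennreal (K * Zt)"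
  proof (rule ennreal_le_epsilon)
    fix d :: real assume d: "0 < d"
    \<comment> \<open>The error is e (2 C U + K Zt) \<le> e M; the summand 1 keeps M positive for
      the division.\<close>
    define M where "M = 2 * C * U + K * Zt + 1"
    have M: "0 < M" using C U0 K Zt0 by (simp add: M_def add_nonneg_pos)
    define e where "e = min 1 (d / M)"
    have e: "0 < e" "e \<le> 1" "e * M \<le> d"
      using d M by (auto simp: e_def min_def field_simps)
    have "2 * e * C * U + (1 + e) * K * Zt = K * Zt + e * (2 * C * U + K * Zt)" by (simp add: algebra_simps)
    also have "\<dots> \<le> K * Zt + e * M" using e by (simp add: M_def)
    also have "\<dots> \<le> K * Zt + d" using e by simp
    finally have "ennreal (2 * e * C * U + (1 + e) * K * Zt) \<le> ennreal (K * Zt + d)" by (rule ennreal_leI)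
    also have "\<dots> = ennreal (K * Zt) + ennreal d" using K Zt0 d by simp
    finally show "?\<beta> * (ennreal K * ennreal U) \<le> ennreal (K * Zt) + ennreal d"
      using approx[OF e(1,2)] by (rule order_trans[rotated])
  qed
  then have "ennreal (1 / K) * (?\<beta> * (ennreal K * ennreal U)) \<le> ennreal (1 / K) * ennreal (K * Zt)"
    by (rule mult_left_mono) simp
  also have "ennreal (1 / K) * (?\<beta> * (ennreal K * ennreal U)) = ?\<beta> * ennreal U * ennreal (1 / K * K)"
    using K by (simp only: ennreal_mult' mult_ac divide_nonneg_nonneg zero_le_one less_imp_le)
  also have "ennreal (1 / K) * ennreal (K * Zt) = ennreal Zt"
    using K by (simp add: ennreal_mult'[symmetric])
  finally show ?thesis using K unfolding U Zt by simp
qed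

section \<open>Assembly of the weighted inequality\<close>

theorem theorem3p14:
  fixes R m lam :: real and W f :: "real \<Rightarrow> real" and u :: "real ^ 'n \<Rightarrow> real"
  assumes R: "0 < R"
    and m: "m \<le> (real CARD('n) - 4) / 2"
    and W: "bessel_potential R W"
    and W_nonzero: "\<And>r. r \<in> {0<..<R} \<Longrightarrow> W r \<noteq> 0"
    and W_ratio: "\<And>r. r \<in> {0<..<R} \<Longrightarrow> deriv W r / W r = - lam / r + f r"
    and f_nonneg: "\<And>r. r \<in> {0<..<R} \<Longrightarrow> 0 \<le> f r"
    and f_lim: "((\<lambda>r. r * f r) \<longlongrightarrow> 0) (at_right 0)"
    and lam: "lam \<le> real CARD('n) - 2 * m - 2"
    and u: "u \<in> test_functions (ball 0 R)"
  shows "(\<integral>\<^sup>+x\<in>ball 0 R. ennreal (\<bar>laplacian u x\<bar>\<^sup>2 / norm x powr (2 * m)) \<partial>lborel)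
    \<ge> rellich_constant TYPE(real ^ 'n) R m *
        (\<integral>\<^sup>+x\<in>ball 0 R. ennreal ((u x)\<^sup>2 / norm x powr (2 * m + 4)) \<partial>lborel)
      + bessel_weight R W *
        ennreal ((real CARD('n) + 2 * m)\<^sup>2 / 4 + (real CARD('n) - 2 * m - lam - 2)\<^sup>2 / 4) *
        (\<integral>\<^sup>+x\<in>ball 0 R. ennreal (W (norm x) / norm x powr (2 * m + 2) * (u x)\<^sup>2) \<partial>lborel)"
proof -
  obtain \<rho> where \<rho>: "\<rho> < R" and t: "test \<rho> u" using test_functions_obtain_test[OF u] .
  define a where "a = (real DIM(real ^ 'n) - 4 - 2 * m) / 2"
  define p where "p = (real CARD('n) + 2 * m) / 2"
  define \<kappa> where "\<kappa> = (real CARD('n) - 2 * m - lam - 2) / 2"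
  have a0: "0 \<le> a" and ap: "a + p = real DIM(real ^ 'n) - 2" and \<kappa>: "0 \<le> \<kappa>"
    using m lam by (auto simp: a_def p_def \<kappa>_def field_simps)
  obtain W' where W'_deriv: "\<forall>r\<in>{0<..<R}. (W has_vector_derivative W' r) (at r)"
    and W'_cont: "continuous_on {0<..<R} W'"
    using W unfolding bessel_potential_def C1_differentiable_on_def by blast
  have W': "\<And>r. 0 < r \<Longrightarrow> r < R \<Longrightarrow> (W has_real_derivative W' r) (at r)" "continuous_on {0<..<R} W'"
    using W'_deriv W'_cont by (simp_all add: has_real_derivative_iff_has_vector_derivative)
  have W0: "0 \<le> W r" if "0 < r" "r < R" for r
    using W that by (simp add: bessel_potential_def)
  \<comment> \<open>With 2 \<kappa> - 2 a - 2 = -lam this is the ratio condition on W after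
    discarding r f(r) W(r) \<ge> 0.\<close>
  have gr: "r * W' r \<ge> (2 * \<kappa> - 2 * a - 2) * W r" if r: "0 < r" "r < R" for r
  proof -
    have w: "0 < W r" using W0[OF r] W_nonzero[of r] r by simp
    have "W' r / W r = - lam / r + f r"
      using W_ratio[of r] r DERIV_imp_deriv[OF W'(1)[OF r]] by simp
    then have "r * W' r = (- lam + r * f r) * W r"
      using w r by (simp add: field_simps)
    moreover have "(- lam) * W r \<le> (- lam + r * f r) * W r"
      using w r f_nonneg[of r] by (intro mult_right_mono) auto
    moreover have "2 * \<kappa> - 2 * a - 2 = - lam" by (simp add: \<kappa>_def a_def field_simps)
    ultimately show ?thesis by simp
  qed
  have cW: "continuous_on {0<..<R} W"
    by (rule continuous_at_imp_continuous_on) (simp add: DERIV_isCont[OF W'(1)])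
  let ?\<beta> = "rellich_constant TYPE(real ^ 'n) R m"
  let ?U = "wsq a u"
  let ?V = "wpot a W u"
  let ?N = "wsq a (\<lambda>x. (norm x)\<^sup>2 * laplacian u x)"
  let ?Z = "wsq a (angular_part a p u)"
  have N: "?N < \<infinity>"
    unfolding nn_integral_ip[OF adm_scaled_laplacian[OF t a0] a0] by simp
  have Z: "?Z < \<infinity>"
    unfolding nn_integral_ip[OF adm_angular_part[OF t a0] a0] by simp
  have \<beta>: "?\<beta> * ?U \<le> ?Z"
  proof (cases "?U < \<infinity>")
    case True
    then show ?thesis by (rule rellich_constant_angular[OF R t a_def a0 ap])
  next
    \<comment> \<open>An infinite norm of u occurs only when \<beta> = 0: the Rellich quotient of u
      itself gives \<beta> times \<infinity> \<le> \<open>?N\<close>, which is finite.\<close>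
    case False
    then have top: "?U = top" by (simp add: less_top[symmetric])
    then have "?\<beta> * top < top"
      using rellich_constant_le[OF t \<rho> a_def a0] N by (simp add: le_less_trans)
    then have "?\<beta> = 0" by (cases "?\<beta> = 0") (simp_all add: ennreal_mult_top)
    then show ?thesis by simp
  qed
  let ?k = "ennreal (p\<^sup>2 + \<kappa>\<^sup>2)"
  \<comment> \<open>Subtracting the finite term with \<beta> leaves a bound free of c, so the
    supremum that defines the weight can be taken on the left.\<close>
  have le: "ennreal c * ?k * ?V \<le> ?N - ?\<beta> * ?U" if c: "bessel_constant R W c" for c
  proof -
    have "?\<beta> * ?U + ennreal c * ?k * ?V \<le> ?N"
      using rellich_bessel[OF c W' W0 gr \<kappa> t \<rho> a0 ap] add_right_mono[OF \<beta>, of "ennreal c * ?k * ?V"]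
      by (meson order_trans)
    then have "(?\<beta> * ?U + ennreal c * ?k * ?V) - ?\<beta> * ?U \<le> ?N - ?\<beta> * ?U"
      by (rule ennreal_minus_mono) simp
    moreover have "?\<beta> * ?U \<noteq> top" using le_less_trans[OF \<beta> Z] by simp
    ultimately show ?thesis by simp
  qed
  have "bessel_weight R W * ?k * ?V = (SUP c\<in>{c. bessel_constant R W c}. ennreal c * ?k * ?V)"
    unfolding bessel_weight_def by (simp add: SUP_mult_right_ennreal)
  also have "\<dots> \<le> ?N - ?\<beta> * ?U" by (rule SUP_least) (rule le, simp)
  finally have "?\<beta> * ?U + bessel_weight R W * ?k * ?V \<le> ?\<beta> * ?U + (?N - ?\<beta> * ?U)"
    by (rule add_left_mono)
  also have "\<dots> = ?N"
  proof (rule add_diff_inverse_ennreal)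
    obtain c where c: "bessel_constant R W c" using W by (auto simp: bessel_potential_def)
    note \<beta>
    also have "?Z \<le> ?Z + ennreal c * ?k * ?V" by simp
    also have "\<dots> \<le> ?N" by (rule rellich_bessel[OF c W' W0 gr \<kappa> t \<rho> a0 ap])
    finally show "?\<beta> * ?U \<le> ?N" .
  qed
  finally have "?\<beta> * ?U + bessel_weight R W * ?k * ?V \<le> ?N" .
  moreover have "p\<^sup>2 + \<kappa>\<^sup>2 = (real CARD('n) + 2 * m)\<^sup>2 / 4 + (real CARD('n) - 2 * m - lam - 2)\<^sup>2 / 4"
    by (simp add: p_def \<kappa>_def power_divide)
  ultimately show ?thesis
    unfolding integrals_to_haar(1,2)[OF t \<rho> a_def a0] integrals_to_haar(3)[OF t \<rho> a_def a0 cW] by simp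
qed

end
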